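(* The operad $\mathcal{PL}$ defining pre-Lie algebras is isomorphic, as an operad, to the operad $\mathcal{RT}$ of rooted trees.
   Context: Ground ring: $k$ is a field or $k=\mathbb Z$; all modules and tensor products are over $k$. An operad $\mathcal P$ is a sequence of $k$-modules $\mathcal P(n)$, $n\ge 1$, with an action of the symmetric group $S_n$ on $\mathcal P(n)$ and composition maps $\gamma:\mathcal P(n)\otimes\mathcal P(i_1)\otimes\cdots\otimes\mathcal P(i_n)\to\mathcal P(i_1+\cdots+i_n)$ satisfying May's axioms of associativity, unitarity and equivariance. Equivalently it is given by a unit and partial compositions $\circ_i:\mathcal P(n)\otimes\mathcal P(m)\to\mathcal P(n+m-1)$, $1\le i\le n$, with $\gamma(\mu,\nu_1,\dots,\nu_n)=(\cdots((\mu\circ_n\nu_n)\circ_{n-1}\nu_{n-1})\cdots\circ_1\nu_1)$. A pre-Lie algebra is a $k$-module $L$ with a bilinear product $\cdot:L\times L\to L$ such that $(x\cdot y)\cdot z-x\cdot(y\cdot z)=(x\cdot z)\cdot y-x\cdot(z\cdot y)$ for all $x,y,z\in L$. The operad $\mathcal{PL}$: let $\mathcal F$ be the free operad generated by the regular representation of $S_2$ in arity 2; $\mathcal F(n)$ has as basis the parenthesized (non-associative, non-commutative) products of the variables $x_1,\dots,x_n$, each used exactly once, and composition is substitution. Let $R\subset\mathcal F(3)$ be the $S_3$-submodule generated by $r=((x_1x_2)x_3)-(x_1(x_2x_3))-((x_1x_3)x_2)+(x_1(x_3x_2))$, and let $(R)$ be the operadic ideal generated by $R$. Then $\mathcal{PL}=\mathcal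 F/(R)$. The operad $\mathcal{RT}$: an $n$-rooted tree ($n\ge1$) is a tree (non-empty connected graph without cycles) with vertex set $[n]=\{1,\dots,n\}$ together with a distinguished vertex called the root; edges are oriented towards the root. $\mathcal{RT}(n)$ is the free $k$-module on the set of $n$-rooted trees, with $S_n$ acting by permuting the labels. For an $n$-rooted tree $T$ and a vertex $i$ of $T$, let $\mathrm{In}(T,i)$ be the set of incoming edges at $i$. For an $m$-rooted tree $S$, set $T\circ_iS=\sum_{f:\mathrm{In}(T,i)\to[m]}T\circ_i^fS$, the sum being over all maps $f$, where $T\circ_i^fS$ is the rooted tree obtained by substituting $S$ for the vertex $i$ of $T$: the outgoing edge of $i$, if it exists, becomes the outgoing edge of the root of $S$ (if $i$ is the root of $T$, the root of $S$ becomes the root of the result), and each incoming edge $e$ of $i$ is grafted on the vertex $f(e)$ of $S$. The labels are reindexed in the usual way: labels $j<i$ of $T$ are unchanged, label $j$ of $S$ becomes $j+i-1$, and label $j>i$ of $T$ becomes $j+m-1$. The operadic unit is the unique $1$-rooted tree. *)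

theory Defs
  imports
    "HOL-Algebra.Algebra"
    "HOL-Algebra.Algebraic_Closure_Type"
    "HOL-Library.Poly_Mapping"
    "HOL-Library.FuncSet"
    "HOL-Combinatorics.Permutations"
begin

section \<open>Operads\<close>

text \<open>
  An operad is given by its modules, symmetric group actions, unit and partial compositions;
  \<open>op_comp P n m i x y\<close> is \<open>x \<circ>\<^sub>i y\<close> for \<open>x \<in> P(n)\<close> and \<open>y \<in> P(m)\<close>. Only arities
  \<open>n \<ge> 1\<close> are meaningful: nothing is required of the fields in arity 0.
\<close>

record ('k, 'a) operad =
  op_mod :: "nat \<Rightarrow> ('k, 'a) module"
  op_act :: "nat \<Rightarrow> (nat \<Rightarrow> nat) \<Rightarrow> 'a \<Rightarrow> 'a"
  op_unit :: 'a
  op_comp :: "nat \<Rightarrow> nat \<Rightarrow> nat \<Rightarrow> 'a \<Rightarrow> 'a \<Rightarrow> 'a"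

text \<open>
  Labels of \<open>x \<circ>\<^sub>i y\<close>: a label \<open>j \<noteq> i\<close> of \<open>x\<close> becomes \<open>outer_label m i j\<close>
  (where \<open>m\<close> is the arity of \<open>y\<close>), a label \<open>j\<close> of \<open>y\<close> becomes \<open>inner_label i j\<close>.
\<close>

definition outer_label :: "nat \<Rightarrow> nat \<Rightarrow> nat \<Rightarrow> nat" where
  "outer_label m i j = (if j < i then j else j + m - 1)"

definition inner_label :: "nat \<Rightarrow> nat \<Rightarrow> nat" where
  "inner_label i j = j + i - 1"

text \<open>
  The permutation of \<open>{1..n+m-1}\<close> induced by \<open>\<sigma>\<close> on \<open>{1..n}\<close> and \<open>\<tau>\<close> on \<open>{1..m}\<close>: it sends
  \<open>inner_label i j\<close> to \<open>inner_label (\<sigma> i) (\<tau> j)\<close> and \<open>outer_label m i j\<close> to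
  \<open>outer_label m (\<sigma> i) (\<sigma> j)\<close>.
\<close>

definition comp_perm :: "nat \<Rightarrow> nat \<Rightarrow> (nat \<Rightarrow> nat) \<Rightarrow> (nat \<Rightarrow> nat) \<Rightarrow> nat \<Rightarrow> nat" where
  "comp_perm m i \<sigma> \<tau> p =
     (if i \<le> p \<and> p < i + m then inner_label (\<sigma> i) (\<tau> (p + 1 - i))
      else outer_label m (\<sigma> i) (\<sigma> (if p < i then p else p + 1 - m)))"

text \<open>
  The symmetric groups act on the left (relabelling \<open>j\<close> as \<open>\<sigma> j\<close>); the corresponding right
  action is that of the inverse permutation.
\<close>

locale operad =
  fixes R :: "('k, 'z) ring_scheme" and P :: "('k, 'a) operad"
  assumes op_module: "n \<ge> 1 \<Longrightarrow> Module.module R (op_mod P n)"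
    and act_closed:
      "\<lbrakk>n \<ge> 1; \<sigma> permutes {1..n}; x \<in> carrier (op_mod P n)\<rbrakk>
        \<Longrightarrow> op_act P n \<sigma> x \<in> carrier (op_mod P n)"
    and act_add:
      "\<lbrakk>n \<ge> 1; \<sigma> permutes {1..n}; x \<in> carrier (op_mod P n); y \<in> carrier (op_mod P n)\<rbrakk>
        \<Longrightarrow> op_act P n \<sigma> (x \<oplus>\<^bsub>op_mod P n\<^esub> y) = op_act P n \<sigma> x \<oplus>\<^bsub>op_mod P n\<^esub> op_act P n \<sigma> y"
    and act_smult:
      "\<lbrakk>n \<ge> 1; \<sigma> permutes {1..n}; a \<in> carrier R; x \<in> carrier (op_mod P n)\<rbrakk>
        \<Longrightarrow> op_act P n \<sigma> (a \<odot>\<^bsub>op_mod P n\<^esub> x) = a \<odot>\<^bsub>op_mod P n\<^esub> op_act P n \<sigma> x"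
    and act_id: "\<lbrakk>n \<ge> 1; x \<in> carrier (op_mod P n)\<rbrakk> \<Longrightarrow> op_act P n id x = x"
    and act_comp:
      "\<lbrakk>n \<ge> 1; \<sigma> permutes {1..n}; \<tau> permutes {1..n}; x \<in> carrier (op_mod P n)\<rbrakk>
        \<Longrightarrow> op_act P n (\<sigma> \<circ> \<tau>) x = op_act P n \<sigma> (op_act P n \<tau> x)"
    and unit_closed: "op_unit P \<in> carrier (op_mod P 1)"
    and comp_closed:
      "\<lbrakk>i \<in> {1..n}; m \<ge> 1; x \<in> carrier (op_mod P n); y \<in> carrier (op_mod P m)\<rbrakk>
        \<Longrightarrow> op_comp P n m i x y \<in> carrier (op_mod P (n + m - 1))"
    and comp_add_left:
      "\<lbrakk>i \<in> {1..n}; m \<ge> 1; x \<in> carrier (op_mod P n); x' \<in> carrier (op_mod P n);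
        y \<in> carrier (op_mod P m)\<rbrakk>
        \<Longrightarrow> op_comp P n m i (x \<oplus>\<^bsub>op_mod P n\<^esub> x') y =
            op_comp P n m i x y \<oplus>\<^bsub>op_mod P (n + m - 1)\<^esub> op_comp P n m i x' y"
    and comp_add_right:
      "\<lbrakk>i \<in> {1..n}; m \<ge> 1; x \<in> carrier (op_mod P n); y \<in> carrier (op_mod P m);
        y' \<in> carrier (op_mod P m)\<rbrakk>
        \<Longrightarrow> op_comp P n m i x (y \<oplus>\<^bsub>op_mod P m\<^esub> y') =
            op_comp P n m i x y \<oplus>\<^bsub>op_mod P (n + m - 1)\<^esub> op_comp P n m i x y'"
    and comp_smult_left:
      "\<lbrakk>i \<in> {1..n}; m \<ge> 1; a \<in> carrier R; x \<in> carrier (op_mod P n); y \<in> carrier (op_mod P m)\<rbrakk>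
        \<Longrightarrow> op_comp P n m i (a \<odot>\<^bsub>op_mod P n\<^esub> x) y =
            a \<odot>\<^bsub>op_mod P (n + m - 1)\<^esub> op_comp P n m i x y"
    and comp_smult_right:
      "\<lbrakk>i \<in> {1..n}; m \<ge> 1; a \<in> carrier R; x \<in> carrier (op_mod P n); y \<in> carrier (op_mod P m)\<rbrakk>
        \<Longrightarrow> op_comp P n m i x (a \<odot>\<^bsub>op_mod P m\<^esub> y) =
            a \<odot>\<^bsub>op_mod P (n + m - 1)\<^esub> op_comp P n m i x y"
    and unit_left:
      "\<lbrakk>n \<ge> 1; x \<in> carrier (op_mod P n)\<rbrakk> \<Longrightarrow> op_comp P 1 n 1 (op_unit P) x = x"
    and unit_right:
      "\<lbrakk>i \<in> {1..n}; x \<in> carrier (op_mod P n)\<rbrakk> \<Longrightarrow> op_comp P n 1 i x (op_unit P) = x"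
    and assoc_sequential:
      "\<lbrakk>i \<in> {1..l}; j \<in> {1..m}; n \<ge> 1;
        x \<in> carrier (op_mod P l); y \<in> carrier (op_mod P m); z \<in> carrier (op_mod P n)\<rbrakk>
        \<Longrightarrow> op_comp P (l + m - 1) n (i + j - 1) (op_comp P l m i x y) z =
            op_comp P l (m + n - 1) i x (op_comp P m n j y z)"
    and assoc_parallel:
      "\<lbrakk>i \<in> {1..l}; k \<in> {1..l}; i < k; m \<ge> 1; n \<ge> 1;
        x \<in> carrier (op_mod P l); y \<in> carrier (op_mod P m); z \<in> carrier (op_mod P n)\<rbrakk>
        \<Longrightarrow> op_comp P (l + m - 1) n (k + m - 1) (op_comp P l m i x y) z =
            op_comp P (l + n - 1) m i (op_comp P l n k x z) y"
    and equivariance: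
      "\<lbrakk>i \<in> {1..n}; m \<ge> 1; \<sigma> permutes {1..n}; \<tau> permutes {1..m};
        x \<in> carrier (op_mod P n); y \<in> carrier (op_mod P m)\<rbrakk>
        \<Longrightarrow> op_comp P n m (\<sigma> i) (op_act P n \<sigma> x) (op_act P m \<tau> y) =
            op_act P (n + m - 1) (comp_perm m i \<sigma> \<tau>) (op_comp P n m i x y)"

definition operad_iso ::
    "('k, 'z) ring_scheme \<Rightarrow> ('k, 'a) operad \<Rightarrow> ('k, 'b) operad \<Rightarrow> (nat \<Rightarrow> 'a \<Rightarrow> 'b) \<Rightarrow> bool" where
  "operad_iso R P Q \<phi> \<longleftrightarrow>
     (\<forall>n\<ge>1. \<phi> n \<in> iso (add_monoid (op_mod P n)) (add_monoid (op_mod Q n))) \<and>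
     (\<forall>n\<ge>1. \<forall>a\<in>carrier R. \<forall>x\<in>carrier (op_mod P n).
        \<phi> n (a \<odot>\<^bsub>op_mod P n\<^esub> x) = a \<odot>\<^bsub>op_mod Q n\<^esub> \<phi> n x) \<and>
     (\<forall>n\<ge>1. \<forall>\<sigma>. \<sigma> permutes {1..n} \<longrightarrow> (\<forall>x\<in>carrier (op_mod P n).
        \<phi> n (op_act P n \<sigma> x) = op_act Q n \<sigma> (\<phi> n x))) \<and>
     \<phi> 1 (op_unit P) = op_unit Q \<and>
     (\<forall>n\<ge>1. \<forall>m\<ge>1. \<forall>i\<in>{1..n}. \<forall>x\<in>carrier (op_mod P n). \<forall>y\<in>carrier (op_mod P m).
        \<phi> (n + m - 1) (op_comp P n m i x y) = op_comp Q n m i (\<phi> n x) (\<phi> m y))"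

definition isomorphic_operads ::
    "('k, 'z) ring_scheme \<Rightarrow> ('k, 'a) operad \<Rightarrow> ('k, 'b) operad \<Rightarrow> bool" where
  "isomorphic_operads R P Q \<longleftrightarrow> operad R P \<and> operad R Q \<and> (\<exists>\<phi>. operad_iso R P Q \<phi>)"


section \<open>Operadic ideals and quotients\<close>

definition sym_submodule ::
    "('k, 'z) ring_scheme \<Rightarrow> ('k, 'a) operad \<Rightarrow> nat \<Rightarrow> 'a set \<Rightarrow> bool" where
  "sym_submodule R P n N \<longleftrightarrow>
     submodule N R (op_mod P n) \<and> (\<forall>\<sigma>. \<sigma> permutes {1..n} \<longrightarrow> (\<forall>x\<in>N. op_act P n \<sigma> x \<in> N))"

definition sym_submodule_generated ::
    "('k, 'z) ring_scheme \<Rightarrow> ('k, 'a) operad \<Rightarrow> nat \<Rightarrow> 'a set \<Rightarrow> 'a set" where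
  "sym_submodule_generated R P n G = \<Inter>{N. sym_submodule R P n N \<and> G \<subseteq> N}"

definition operad_ideal ::
    "('k, 'z) ring_scheme \<Rightarrow> ('k, 'a) operad \<Rightarrow> (nat \<Rightarrow> 'a set) \<Rightarrow> bool" where
  "operad_ideal R P I \<longleftrightarrow>
     (\<forall>n\<ge>1. sym_submodule R P n (I n)) \<and>
     (\<forall>n\<ge>1. \<forall>m\<ge>1. \<forall>i\<in>{1..n}. \<forall>x\<in>carrier (op_mod P n). \<forall>y\<in>carrier (op_mod P m).
        x \<in> I n \<or> y \<in> I m \<longrightarrow> op_comp P n m i x y \<in> I (n + m - 1))"

definition operad_ideal_generated ::
    "('k, 'z) ring_scheme \<Rightarrow> ('k, 'a) operad \<Rightarrow> (nat \<Rightarrow> 'a set) \<Rightarrow> nat \<Rightarrow> 'a set" where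
  "operad_ideal_generated R P G n =
     \<Inter>{I n | I. operad_ideal R P I \<and> (\<forall>m\<ge>1. G m \<subseteq> I m)}"

text \<open>
  Operations on cosets are written as unions over all representatives, which is the coset of the
  result whenever the operation is well defined. The \<open>module\<close> record inherits the
  fields \<open>mult\<close> and \<open>one\<close> from rings; they play no role for modules.
\<close>

definition quotient_module :: "('k, 'a) module \<Rightarrow> 'a set \<Rightarrow> ('k, 'a set) module" where
  "quotient_module M N =
     \<lparr>carrier = a_rcosets\<^bsub>M\<^esub> N, monoid.mult = undefined, monoid.one = undefined, ring.zero = N,
      ring.add = (\<lambda>C D. C <+>\<^bsub>M\<^esub> D), module.smult = (\<lambda>a C. \<Union>x\<in>C. N +>\<^bsub>M\<^esub> (a \<odot>\<^bsub>M\<^esub> x))\<rparr>"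

definition quotient_operad :: "('k, 'a) operad \<Rightarrow> (nat \<Rightarrow> 'a set) \<Rightarrow> ('k, 'a set) operad" where
  "quotient_operad P I =
     \<lparr>op_mod = (\<lambda>n. quotient_module (op_mod P n) (I n)),
      op_act = (\<lambda>n \<sigma> C. \<Union>x\<in>C. I n +>\<^bsub>op_mod P n\<^esub> op_act P n \<sigma> x),
      op_unit = I 1 +>\<^bsub>op_mod P 1\<^esub> op_unit P,
      op_comp = (\<lambda>n m i C D. \<Union>x\<in>C. \<Union>y\<in>D.
        I (n + m - 1) +>\<^bsub>op_mod P (n + m - 1)\<^esub> op_comp P n m i x y)\<rparr>"


section \<open>Free modules\<close>

definition free_module :: "'b set \<Rightarrow> ('k::comm_ring_1, 'b \<Rightarrow>\<^sub>0 'k) module" where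
  "free_module B =
     \<lparr>carrier = {x. Poly_Mapping.keys x \<subseteq> B}, monoid.mult = undefined, monoid.one = undefined, ring.zero = 0,
      ring.add = (+), module.smult = (\<lambda>a. Poly_Mapping.map ((*) a))\<rparr>"

abbreviation basis_elem :: "'b \<Rightarrow> ('b \<Rightarrow>\<^sub>0 'k::comm_ring_1)" where
  "basis_elem b \<equiv> Poly_Mapping.single b 1"

definition linear_ext :: "('b \<Rightarrow> ('c \<Rightarrow>\<^sub>0 'k)) \<Rightarrow> ('b \<Rightarrow>\<^sub>0 'k::comm_ring_1) \<Rightarrow> ('c \<Rightarrow>\<^sub>0 'k)" where
  "linear_ext g x =
     (\<Sum>b\<in>Poly_Mapping.keys x. Poly_Mapping.map ((*) (Poly_Mapping.lookup x b)) (g b))"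

definition bilinear_ext ::
    "('b \<Rightarrow> 'c \<Rightarrow> ('d \<Rightarrow>\<^sub>0 'k)) \<Rightarrow> ('b \<Rightarrow>\<^sub>0 'k::comm_ring_1) \<Rightarrow> ('c \<Rightarrow>\<^sub>0 'k) \<Rightarrow> ('d \<Rightarrow>\<^sub>0 'k)" where
  "bilinear_ext g x y = linear_ext (\<lambda>b. linear_ext (g b) y) x"


section \<open>The pre-Lie operad\<close>

datatype mag_term = Var nat | Prod mag_term mag_term

primrec term_vars :: "mag_term \<Rightarrow> nat list" where
  "term_vars (Var j) = [j]"
| "term_vars (Prod s t) = term_vars s @ term_vars t"

primrec term_subst :: "(nat \<Rightarrow> mag_term) \<Rightarrow> mag_term \<Rightarrow> mag_term" where
  "term_subst \<theta> (Var j) = \<theta> j"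
| "term_subst \<theta> (Prod s t) = Prod (term_subst \<theta> s) (term_subst \<theta> t)"

definition multilinear_terms :: "nat \<Rightarrow> mag_term set" where
  "multilinear_terms n = {t. distinct (term_vars t) \<and> set (term_vars t) = {1..n}}"

definition term_relabel :: "(nat \<Rightarrow> nat) \<Rightarrow> mag_term \<Rightarrow> mag_term" where
  "term_relabel \<sigma> = term_subst (\<lambda>j. Var (\<sigma> j))"

definition term_comp :: "nat \<Rightarrow> nat \<Rightarrow> mag_term \<Rightarrow> mag_term \<Rightarrow> mag_term" where
  "term_comp m i t s =
     term_subst (\<lambda>j. if j = i then term_relabel (inner_label i) s else Var (outer_label m i j)) t"

definition free_magmatic_operad :: "('k::comm_ring_1, mag_term \<Rightarrow>\<^sub>0 'k) operad" where
  "free_magmatic_operad =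
     \<lparr>op_mod = (\<lambda>n. free_module (multilinear_terms n)),
      op_act = (\<lambda>n \<sigma>. linear_ext (\<lambda>t. basis_elem (term_relabel \<sigma> t))),
      op_unit = basis_elem (Var 1),
      op_comp = (\<lambda>n m i. bilinear_ext (\<lambda>t s. basis_elem (term_comp m i t s)))\<rparr>"

definition pre_Lie_relator :: "mag_term \<Rightarrow>\<^sub>0 'k::comm_ring_1" where
  "pre_Lie_relator =
     basis_elem (Prod (Prod (Var 1) (Var 2)) (Var 3))
     - basis_elem (Prod (Var 1) (Prod (Var 2) (Var 3)))
     - basis_elem (Prod (Prod (Var 1) (Var 3)) (Var 2))
     + basis_elem (Prod (Var 1) (Prod (Var 3) (Var 2)))"

definition pre_Lie_relations :: "(mag_term \<Rightarrow>\<^sub>0 'k::comm_ring_1) set" where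
  "pre_Lie_relations =
     sym_submodule_generated ring_of_type_algebra free_magmatic_operad 3 {pre_Lie_relator}"

definition PL_operad :: "('k::comm_ring_1, (mag_term \<Rightarrow>\<^sub>0 'k) set) operad" where
  "PL_operad =
     quotient_operad free_magmatic_operad
       (operad_ideal_generated ring_of_type_algebra free_magmatic_operad
          (\<lambda>n. if n = 3 then pre_Lie_relations else {}))"


section \<open>The operad of rooted trees\<close>

definition adjacency :: "nat set set \<Rightarrow> (nat \<times> nat) set" where
  "adjacency E = {(u, v). {u, v} \<in> E}"

definition graph_cycle :: "nat set set \<Rightarrow> nat list \<Rightarrow> bool" where
  "graph_cycle E p \<longleftrightarrow>
     length p \<ge> 3 \<and> distinct p \<and> successively (\<lambda>u v. {u, v} \<in> E) p \<and> {last p, hd p} \<in> E"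

definition is_tree :: "nat set \<Rightarrow> nat set set \<Rightarrow> bool" where
  "is_tree V E \<longleftrightarrow>
     V \<noteq> {} \<and> (\<forall>e\<in>E. e \<subseteq> V \<and> card e = 2) \<and>
     (\<forall>u\<in>V. \<forall>v\<in>V. (u, v) \<in> (adjacency E)\<^sup>*) \<and> (\<nexists>p. graph_cycle E p)"

datatype rtree = RTree (tree_edges: "nat set set") (tree_root: nat)

definition rooted_trees :: "nat \<Rightarrow> rtree set" where
  "rooted_trees n = {T. is_tree {1..n} (tree_edges T) \<and> tree_root T \<in> {1..n}}"

text \<open>
  Edges oriented towards the root: \<open>(u, v)\<close> is an arc if \<open>v\<close> is the endpoint of the edge
  \<open>{u, v}\<close> that is still joined to the root when this edge is removed.
\<close>

definition tree_arcs :: "rtree \<Rightarrow> (nat \<times> nat) set" where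
  "tree_arcs T = {(u, v). {u, v} \<in> tree_edges T \<and>
     (v, tree_root T) \<in> (adjacency (tree_edges T - {{u, v}}))\<^sup>*}"

definition incoming_edges :: "rtree \<Rightarrow> nat \<Rightarrow> nat set set" where
  "incoming_edges T i = {{j, i} | j. (j, i) \<in> tree_arcs T}"

definition tree_relabel :: "(nat \<Rightarrow> nat) \<Rightarrow> rtree \<Rightarrow> rtree" where
  "tree_relabel \<sigma> T = RTree ((\<lambda>e. \<sigma> ` e) ` tree_edges T) (\<sigma> (tree_root T))"

text \<open>The tree \<open>T \<circ>\<^sub>i\<^sup>f S\<close>, for \<open>S\<close> with \<open>m\<close> vertices.\<close>

definition tree_graft :: "nat \<Rightarrow> nat \<Rightarrow> (nat set \<Rightarrow> nat) \<Rightarrow> rtree \<Rightarrow> rtree \<Rightarrow> rtree" where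
  "tree_graft m i f T S = RTree
     ({outer_label m i ` e | e. e \<in> tree_edges T \<and> i \<notin> e}
      \<union> {inner_label i ` e | e. e \<in> tree_edges S}
      \<union> {{outer_label m i j, inner_label i (f {j, i})} | j. (j, i) \<in> tree_arcs T}
      \<union> {{inner_label i (tree_root S), outer_label m i j} | j. (i, j) \<in> tree_arcs T})
     (if tree_root T = i then inner_label i (tree_root S) else outer_label m i (tree_root T))"

definition tree_comp :: "nat \<Rightarrow> nat \<Rightarrow> rtree \<Rightarrow> rtree \<Rightarrow> (rtree \<Rightarrow>\<^sub>0 'k::comm_ring_1)" where
  "tree_comp m i T S =
     (\<Sum>f\<in>incoming_edges T i \<rightarrow>\<^sub>E {1..m}. basis_elem (tree_graft m i f T S))"

definition RT_operad :: "('k::comm_ring_1, rtree \<Rightarrow>\<^sub>0 'k) operad" where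
  "RT_operad =
     \<lparr>op_mod = (\<lambda>n. free_module (rooted_trees n)),
      op_act = (\<lambda>n \<sigma>. linear_ext (\<lambda>T. basis_elem (tree_relabel \<sigma> T))),
      op_unit = basis_elem (RTree {} 1),
      op_comp = (\<lambda>n m i. bilinear_ext (tree_comp m i))\<rparr>"

end

theory Submission
  imports Defs
begin

text \<open>
  The isomorphism is induced by a map \<open>\<Phi>\<close> from the free magmatic operad to \<open>RT\<close>, called
  \<open>tree_expansion\<close> below. It sends the variable \<open>x\<^sub>j\<close> to the tree with the single vertex \<open>j\<close>, and a
  product \<open>s t\<close> to the sum, over the trees \<open>T\<close> of \<open>s\<close>, the trees \<open>S\<close> of \<open>t\<close> and the vertices \<open>v\<close> of
  \<open>T\<close>, of the tree obtained by grafting the root of \<open>S\<close> on \<open>v\<close>. Three facts about \<open>\<Phi>\<close> carry the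
  proof; they hold over every commutative ring.

  First, \<open>\<Phi>\<close> commutes with the operations (\<open>tree_sum_subst\<close>, \<open>tree_expansion_comp\<close>). This reduces
  to the compatibility of a single grafting with the substitution of a tree for a vertex.

  Second, \<open>\<Phi>\<close> is surjective in each arity (\<open>arc_tree_in_expansions\<close>). A tree \<open>T\<close> with at least two
  vertices is obtained by grafting some \<open>S\<close> on the root of some \<open>U\<close>. The product of preimages of \<open>U\<close>
  and \<open>S\<close> expands to \<open>T\<close> plus trees with as many vertices as \<open>T\<close> whose root has fewer children.

  Third, the kernel of \<open>\<Phi>\<close> is the ideal generated by the pre-Lie relator
  (\<open>generated_ideal_eq_kernel\<close>). The kernel is an operadic ideal that contains the relator. Conversely,
  let \<open>L\<close> be the quotient of the free magmatic algebra on all variables by the pre-Lie relations. In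
  every pre-Lie algebra one can define braces by
  \<open>x{} = x\<close> and \<open>x{y\<^sub>1,\<dots>,y\<^sub>n,z} = x{y\<^sub>1,\<dots>,y\<^sub>n} z - \<Sum>\<^sub>i x{y\<^sub>1,\<dots>,y\<^sub>i z,\<dots>,y\<^sub>n}\<close>,
  and the pre-Lie identity makes them symmetric in the \<open>y\<^sub>i\<close> (\<open>list_brace_swap\<close>). A rooted tree
  therefore has a value, the brace of the variable of its root with the values of the subtrees at
  the children of the root. The recursion for braces says exactly that the product of the values
  of two trees on disjoint sets of vertices is the sum of the values of their graftings
  (\<open>tree_value_mul\<close>). Hence the class in \<open>L\<close> of a multilinear monomial is the value of its expansion (\<open>term_eval_tree_sum\<close>), and an element of the kernel of \<open>\<Phi>\<close> is
  zero in \<open>L\<close>. It is thus a combination of instances of the relator in a monomial context, and the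
  multilinear instances lie in every operadic ideal that contains the relator
  (\<open>pre_Lie_ideal_multilinear\<close>).

  It remains to verify the operad axioms for the free magmatic operad only: they are inherited by
  the images of surjections (\<open>operad_target\<close>), hence by \<open>RT\<close> and by the quotient \<open>PL\<close>, and the two are
  then isomorphic by the first isomorphism theorem (\<open>quotient_by_kernel\<close>).

  In these arguments a rooted tree is given by its root and its set of arcs (child, parent);
  \<open>to_rtree\<close> is the passage to graphs, which is a bijection (\<open>rooted_trees_orientation\<close>,
  \<open>tree_arcs_to_rtree\<close>).
\<close>

(* Arities such as n + m - 1 are to be kept in this form by the simplifier. *)
declare One_nat_def [simp del]

alias keys = Poly_Mapping.keys
alias lookup = Poly_Mapping.lookup

section \<open>Linear maps between free modules\<close>

text \<open>
  Multiplication by a scalar.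
\<close>

abbreviation scale :: "'k::comm_ring_1 \<Rightarrow> ('b \<Rightarrow>\<^sub>0 'k) \<Rightarrow> ('b \<Rightarrow>\<^sub>0 'k)" where
  "scale a \<equiv> Poly_Mapping.map ((*) a)"

lemma lookup_scale [simp]: "lookup (scale a x) b = a * lookup x b"
  by (simp add: Poly_Mapping.map.rep_eq when_def)

lemma scale_add: "scale a (x + y) = scale a x + scale a y"
  by (rule poly_mapping_eqI) (simp add: lookup_add algebra_simps)
lemma scale_add_left: "scale (a + b) x = scale a x + scale b x"
  by (rule poly_mapping_eqI) (simp add: lookup_add algebra_simps)
lemma scale_scale: "scale a (scale b x) = scale (a * b) x"
  by (rule poly_mapping_eqI) (simp add: algebra_simps)
lemma scale_one [simp]: "scale 1 x = x"
  by (rule poly_mapping_eqI) simp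
lemma scale_minus_one: "scale (- 1) x = - x"
  by (rule poly_mapping_eqI) simp
lemma scale_0_left [simp]: "scale 0 x = 0"
  by (rule poly_mapping_eqI) simp
lemma scale_0_right [simp]: "scale a 0 = 0"
  by (rule poly_mapping_eqI) simp
lemma scale_diff: "scale a (x - y) = scale a x - scale a y"
  by (rule poly_mapping_eqI) (simp add: lookup_minus algebra_simps)
lemma scale_sum: "scale a (\<Sum>i\<in>I. f i) = (\<Sum>i\<in>I. scale a (f i))"
  by (induction I rule: infinite_finite_induct) (simp_all add: scale_add)

lemma keys_scale: "keys (scale a x) \<subseteq> keys x"
  by (auto simp: in_keys_iff)

text \<open>
  Linear maps. They are defined on all finitely supported functions, not only on the carrier of
  a free module; all maps between free modules that occur below are of this kind.
\<close>

definition klinear :: "(('b \<Rightarrow>\<^sub>0 'k::comm_ring_1) \<Rightarrow> ('c \<Rightarrow>\<^sub>0 'k)) \<Rightarrow> bool" where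
  "klinear f \<longleftrightarrow> (\<forall>x y. f (x + y) = f x + f y) \<and> (\<forall>a x. f (scale a x) = scale a (f x))"

lemma klinearI: "\<lbrakk>\<And>x y. f (x + y) = f x + f y; \<And>a x. f (scale a x) = scale a (f x)\<rbrakk> \<Longrightarrow> klinear f"
  by (simp add: klinear_def)
lemma klinear_add: "klinear f \<Longrightarrow> f (x + y) = f x + f y" by (simp add: klinear_def)
lemma klinear_scale: "klinear f \<Longrightarrow> f (scale a x) = scale a (f x)" by (simp add: klinear_def)
lemma klinear_0: "klinear f \<Longrightarrow> f 0 = 0" using klinear_scale[of f 0 0] by simp
lemma klinear_uminus: "klinear f \<Longrightarrow> f (- x) = - f x"
  using klinear_scale[of f "-1" x] by (simp add: scale_minus_one)
lemma klinear_diff: "klinear f \<Longrightarrow> f (x - y) = f x - f y"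
  using klinear_add[of f x "-y"] by (simp add: klinear_uminus)
lemma klinear_sum: "klinear f \<Longrightarrow> f (\<Sum>i\<in>I. g i) = (\<Sum>i\<in>I. f (g i))"
  by (induction I rule: infinite_finite_induct) (simp_all add: klinear_0 klinear_add)
lemma klinear_comp: "klinear f \<Longrightarrow> klinear g \<Longrightarrow> klinear (\<lambda>x. f (g x))"
  by (simp add: klinear_def)
lemma klinear_ident: "klinear (\<lambda>x. x)" by (simp add: klinear_def)

lemma sum_keys_superset:
  assumes "finite B" "keys x \<subseteq> B"
  shows "linear_ext g x = (\<Sum>b\<in>B. scale (lookup x b) (g b))"
  unfolding linear_ext_def using assms
  by (intro sum.mono_neutral_left) (auto simp: in_keys_iff)

lemma klinear_linear_ext: "klinear (linear_ext g)"
proof (rule klinearI)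
  fix x y :: "'a \<Rightarrow>\<^sub>0 'b"
  let ?B = "keys x \<union> keys y"
  have "keys (x + y) \<subseteq> ?B" by (rule keys_add)
  then show "linear_ext g (x + y) = linear_ext g x + linear_ext g y"
    by (simp add: sum_keys_superset[of ?B] lookup_add scale_add_left sum.distrib)
next
  fix a and x :: "'a \<Rightarrow>\<^sub>0 'b"
  show "linear_ext g (scale a x) = scale a (linear_ext g x)"
    by (simp add: sum_keys_superset[of "keys x"] keys_scale scale_scale scale_sum)
qed

lemma scale_basis: "scale a (basis_elem b) = Poly_Mapping.single b a"
  by (rule poly_mapping_eqI) (simp add: lookup_single when_def)

lemma klinear_single: "klinear f \<Longrightarrow> f (Poly_Mapping.single b a) = scale a (f (basis_elem b))"
  using klinear_scale[of f a "basis_elem b"] by (simp add: scale_basis)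

lemma linear_ext_basis [simp]: "linear_ext g (basis_elem b) = g b"
  by (simp add: linear_ext_def)

lemma poly_mapping_expand:
  "(x :: 'b \<Rightarrow>\<^sub>0 'k::comm_ring_1) = (\<Sum>b\<in>keys x. scale (lookup x b) (basis_elem b))"
proof (rule poly_mapping_eqI)
  fix c
  have "lookup (\<Sum>b\<in>keys x. scale (lookup x b) (basis_elem b)) c
    = (\<Sum>b\<in>keys x. if b = c then lookup x b else 0)"
    by (simp add: lookup_sum lookup_single when_def if_distrib cong: if_cong)
  then show "lookup x c = lookup (\<Sum>b\<in>keys x. scale (lookup x b) (basis_elem b)) c"
    by (simp add: in_keys_iff)
qed

lemma klinear_expand:
  assumes "klinear f"
  shows "f x = (\<Sum>b\<in>keys x. scale (lookup x b) (f (basis_elem b)))"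
proof -
  have "f x = f (\<Sum>b\<in>keys x. scale (lookup x b) (basis_elem b))"
    by (rule arg_cong[OF poly_mapping_expand])
  then show ?thesis by (simp only: klinear_sum[OF assms] klinear_scale[OF assms])
qed

lemma klinear_cong:
  assumes "klinear f" "klinear g" "keys x \<subseteq> B" "\<And>b. b \<in> B \<Longrightarrow> f (basis_elem b) = g (basis_elem b)"
  shows "f x = g x"
proof -
  have "f x = (\<Sum>b\<in>keys x. scale (lookup x b) (f (basis_elem b)))"
    by (rule klinear_expand[OF assms(1)])
  also have "\<dots> = (\<Sum>b\<in>keys x. scale (lookup x b) (g (basis_elem b)))"
    using assms(3,4) by (intro sum.cong) auto
  also have "\<dots> = g x" by (rule klinear_expand[OF assms(2), symmetric])
  finally show ?thesis .
qed

lemma klinear_bilinear_ext_left: "klinear (\<lambda>x. bilinear_ext g x y)"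
  unfolding bilinear_ext_def by (rule klinear_linear_ext)

lemma klinear_bilinear_ext_right: "klinear (bilinear_ext g x)"
proof (rule klinearI)
  fix y z
  show "bilinear_ext g x (y + z) = bilinear_ext g x y + bilinear_ext g x z"
    by (simp add: bilinear_ext_def linear_ext_def[where x = x] klinear_add[OF klinear_linear_ext]
        scale_add sum.distrib)
next
  fix a y
  show "bilinear_ext g x (scale a y) = scale a (bilinear_ext g x y)"
    by (simp add: bilinear_ext_def linear_ext_def[where x = x] klinear_scale[OF klinear_linear_ext]
        scale_scale scale_sum mult.commute)
qed

lemma bilinear_ext_basis [simp]: "bilinear_ext g (basis_elem b) (basis_elem c) = g b c"
  by (simp add: bilinear_ext_def)

lemma span_induct [consumes 1, case_names zero add basis]:
  fixes x :: "'b \<Rightarrow>\<^sub>0 'k::comm_ring_1"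
  assumes "keys x \<subseteq> B" and "P 0" and "\<And>x y. P x \<Longrightarrow> P y \<Longrightarrow> P (x + y)"
    and "\<And>a b. b \<in> B \<Longrightarrow> P (Poly_Mapping.single b a)"
  shows "P x"
proof -
  have *: "P (\<Sum>b\<in>I. scale (lookup x b) (basis_elem b))" if "finite I" "I \<subseteq> B" for I
    using that
  proof (induction I rule: finite_induct)
    case empty
    show ?case using assms(2) by simp
  next
    case (insert b I)
    then have "P (Poly_Mapping.single b (lookup x b))"
        "P (\<Sum>b\<in>I. scale (lookup x b) (basis_elem b))"
      by (blast intro: assms(4))+
    from assms(3)[OF this] show ?case using insert.hyps by (simp add: scale_basis)
  qed
  have "P (\<Sum>b\<in>keys x. scale (lookup x b) (basis_elem b))"
    by (rule *) (simp_all add: assms(1))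
  then show ?thesis by (rule ssubst[where P = P, OF poly_mapping_expand])
qed

lemma keys_klinear:
  assumes "klinear f" "keys x \<subseteq> B" "\<And>b. b \<in> B \<Longrightarrow> keys (f (basis_elem b)) \<subseteq> C"
  shows "keys (f x) \<subseteq> C"
  using assms(2)
proof (induction x rule: span_induct)
  case zero then show ?case by (simp add: klinear_0[OF assms(1)])
next
  case (add x y) then show ?case
    using keys_add[of "f x" "f y"] by (auto simp: klinear_add[OF assms(1)])
next
  case (basis a b) then show ?case
    using assms(3)[of b] keys_scale[of a "f (basis_elem b)"] 
    by (subst klinear_single[OF assms(1)]) blast
qed

lemma keys_basis_subset: "b \<in> C \<Longrightarrow> keys (basis_elem b) \<subseteq> C"
  by simp

lemma free_module_simps [simp]:
  "x \<in> carrier (free_module B) \<longleftrightarrow> keys x \<subseteq> B"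
  "ring.add (free_module B) = (+)" "ring.zero (free_module B) = 0"
  "module.smult (free_module B) = scale"
  by (simp_all add: free_module_def)

lemma ring_of_type_algebra_simps [simp]:
  "carrier ring_of_type_algebra = UNIV"
  "ring.add ring_of_type_algebra = (+)" "monoid.mult ring_of_type_algebra = (*)"
  "monoid.one ring_of_type_algebra = 1" "ring.zero ring_of_type_algebra = 0"
  by (simp_all add: ring_of_type_algebra_def)

lemma module_free_module:
  "Module.module (ring_of_type_algebra :: 'k::comm_ring_1 ring) (free_module B)"
proof (rule moduleI)
  show "cring (ring_of_type_algebra :: 'k ring)" by (rule cring_from_type_algebra)
  show "abelian_group (free_module B :: ('k, 'a \<Rightarrow>\<^sub>0 'k) module)"
  proof (rule abelian_groupI)
    fix x :: "'a \<Rightarrow>\<^sub>0 'k" assume "x \<in> carrier (free_module B)"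
    then show "\<exists>y\<in>carrier (free_module B). y \<oplus>\<^bsub>free_module B\<^esub> x = \<zero>\<^bsub>free_module B\<^esub>"
      by (intro bexI[of _ "- x"]) auto
  next
    fix x y :: "'a \<Rightarrow>\<^sub>0 'k"
    assume "x \<in> carrier (free_module B)" "y \<in> carrier (free_module B)"
    then show "x \<oplus>\<^bsub>free_module B\<^esub> y \<in> carrier (free_module B)"
      using Poly_Mapping.keys_add[of x y] by auto
  qed (simp_all add: add.assoc add.commute)
next
  fix a :: 'k and x :: "'a \<Rightarrow>\<^sub>0 'k" assume "x \<in> carrier (free_module B)"
  then show "a \<odot>\<^bsub>free_module B\<^esub> x \<in> carrier (free_module B)"
    using keys_scale[of a x] by auto
qed (simp_all add: scale_add scale_add_left scale_scale)

lemma a_inv_free_module: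
  assumes "x \<in> carrier (free_module B)"
  shows "\<ominus>\<^bsub>free_module B\<^esub> x = - (x :: 'a \<Rightarrow>\<^sub>0 'k::comm_ring_1)"
proof -
  interpret Module.module "ring_of_type_algebra :: 'k ring" "free_module B :: ('k, 'a \<Rightarrow>\<^sub>0 'k) module"
    by (rule module_free_module)
  have "x \<oplus>\<^bsub>free_module B\<^esub> (\<ominus>\<^bsub>free_module B\<^esub> x) = \<zero>\<^bsub>free_module B\<^esub>"
    using assms by (rule M.r_neg)
  then show ?thesis by (simp add: eq_neg_iff_add_eq_0 add.commute)
qed

section \<open>Transfer of operad structures along surjections\<close>

text \<open>
  The image of a module under a map that respects the operations is a module, whatever is known
  beforehand about the operations on the image.
\<close>

lemma module_surjective_image:
  fixes R (structure) and M and N and h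
  assumes "Module.module R M"
    and surj: "h ` carrier M = carrier N"
    and add: "\<And>x y. x \<in> carrier M \<Longrightarrow> y \<in> carrier M \<Longrightarrow> h (x \<oplus>\<^bsub>M\<^esub> y) = h x \<oplus>\<^bsub>N\<^esub> h y"
    and zero: "h \<zero>\<^bsub>M\<^esub> = \<zero>\<^bsub>N\<^esub>"
    and smult: "\<And>a x. a \<in> carrier R \<Longrightarrow> x \<in> carrier M \<Longrightarrow> h (a \<odot>\<^bsub>M\<^esub> x) = a \<odot>\<^bsub>N\<^esub> h x"
  shows "Module.module R N"
proof -
  interpret M: Module.module R M by fact
  have closed: "h x \<in> carrier N" if "x \<in> carrier M" for x using surj that by blast
  have ex: "\<exists>x\<in>carrier M. u = h x" if "u \<in> carrier N" for u using surj that by blast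
  show ?thesis
  proof (rule moduleI)
    show "cring R" by (rule M.R.cring_axioms)
    show "abelian_group N"
    proof (rule abelian_groupI)
      fix u v assume "u \<in> carrier N" "v \<in> carrier N"
      then obtain x y where *: "x \<in> carrier M" "u = h x" "y \<in> carrier M" "v = h y" using ex by metis
      then show "u \<oplus>\<^bsub>N\<^esub> v \<in> carrier N" by (simp add: closed flip: add)
      show "u \<oplus>\<^bsub>N\<^esub> v = v \<oplus>\<^bsub>N\<^esub> u" using * by (simp add: M.M.a_comm flip: add)
      fix w assume "w \<in> carrier N"
      then obtain z where "z \<in> carrier M" "w = h z" using ex by metis
      with * show "u \<oplus>\<^bsub>N\<^esub> v \<oplus>\<^bsub>N\<^esub> w = u \<oplus>\<^bsub>N\<^esub> (v \<oplus>\<^bsub>N\<^esub> w)"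
        by (simp add: M.M.a_assoc flip: add)
    next
      show "\<zero>\<^bsub>N\<^esub> \<in> carrier N" by (simp add: closed flip: zero)
      fix u assume "u \<in> carrier N"
      then obtain x where *: "x \<in> carrier M" "u = h x" using ex by metis
      then show "\<zero>\<^bsub>N\<^esub> \<oplus>\<^bsub>N\<^esub> u = u" by (simp flip: add zero)
      show "\<exists>v\<in>carrier N. v \<oplus>\<^bsub>N\<^esub> u = \<zero>\<^bsub>N\<^esub>"
        using * by (intro bexI[of _ "h (\<ominus>\<^bsub>M\<^esub> x)"]) (simp_all add: closed M.M.l_neg flip: add zero)
    qed
  next
    fix a u assume a: "a \<in> carrier R" and "u \<in> carrier N"
    then obtain x where *: "x \<in> carrier M" "u = h x" using ex by metis
    then show "a \<odot>\<^bsub>N\<^esub> u \<in> carrier N" using a by (simp add: closed flip: smult)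
    fix b assume "b \<in> carrier R"
    with a * show "(a \<oplus> b) \<odot>\<^bsub>N\<^esub> u = a \<odot>\<^bsub>N\<^esub> u \<oplus>\<^bsub>N\<^esub> b \<odot>\<^bsub>N\<^esub> u"
      and "(a \<otimes> b) \<odot>\<^bsub>N\<^esub> u = a \<odot>\<^bsub>N\<^esub> (b \<odot>\<^bsub>N\<^esub> u)"
      by (simp_all add: M.smult_l_distr M.smult_assoc1 flip: smult add)
  next
    fix a u v assume a: "a \<in> carrier R" and "u \<in> carrier N" "v \<in> carrier N"
    then obtain x y where *: "x \<in> carrier M" "u = h x" "y \<in> carrier M" "v = h y" using ex by metis
    then show "a \<odot>\<^bsub>N\<^esub> (u \<oplus>\<^bsub>N\<^esub> v) = a \<odot>\<^bsub>N\<^esub> u \<oplus>\<^bsub>N\<^esub> a \<odot>\<^bsub>N\<^esub> v"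
      using a by (simp add: M.smult_r_distr flip: smult add)
  next
    fix u assume "u \<in> carrier N"
    then obtain x where *: "x \<in> carrier M" "u = h x" using ex by metis
    then show "\<one> \<odot>\<^bsub>N\<^esub> u = u" by (simp flip: smult)
  qed
qed

lemma outer_label_neq_inner_label:
  "\<lbrakk>1 \<le> j; j \<le> m; k \<noteq> i; i \<ge> 1\<rbrakk> \<Longrightarrow> outer_label m i k \<noteq> inner_label i j"
  by (auto simp: outer_label_def inner_label_def)

text \<open>
  The labels of a composite are, without repetition, the outer labels \<open>k \<noteq> i\<close> and the inner labels.
  On these \<open>comp_perm\<close> has a simple description.
\<close>

lemma comp_perm_inner: "\<lbrakk>1 \<le> j; j \<le> m; i \<ge> 1\<rbrakk>
    \<Longrightarrow> comp_perm m i \<sigma> \<tau> (inner_label i j) = inner_label (\<sigma> i) (\<tau> j)"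
  by (auto simp: comp_perm_def inner_label_def)

lemma comp_perm_outer: "\<lbrakk>k \<noteq> i; m \<ge> 1\<rbrakk>
    \<Longrightarrow> comp_perm m i \<sigma> \<tau> (outer_label m i k) = outer_label m (\<sigma> i) (\<sigma> k)"
  by (auto simp: comp_perm_def outer_label_def)

lemma label_cases:
  assumes "m \<ge> 1" "i \<ge> 1"
  obtains (inner) j where "1 \<le> j" "j \<le> m" "p = inner_label i j" 
  | (outer) k where "k \<noteq> i" "p = outer_label m i k"
proof (cases "i \<le> p \<and> p < i + m")
  case True
  with assms show ?thesis by (intro inner[of "p + 1 - i"]) (auto simp: inner_label_def)
next
  case False
  with assms show ?thesis
    by (intro outer[of "if p < i then p else p + 1 - m"]) (auto simp: outer_label_def)
qed

lemma inj_outer_label: "m \<ge> 1 \<Longrightarrow> outer_label m i j = outer_label m i k \<longleftrightarrow> j = k"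
  by (auto simp: outer_label_def split: if_splits)

lemma inj_inner_label: "i \<ge> 1 \<Longrightarrow> inner_label i j = inner_label i k \<longleftrightarrow> j = k"
  by (auto simp: inner_label_def)

lemma outer_label_range: 
  "\<lbrakk>i \<in> {1..n}; m \<ge> 1; k \<noteq> i\<rbrakk> \<Longrightarrow> outer_label m i k \<in> {1..n + m - 1} \<longleftrightarrow> k \<in> {1..n}"
  by (auto simp: outer_label_def split: if_splits)

lemma inner_label_range: "\<lbrakk>i \<in> {1..n}; j \<in> {1..m}\<rbrakk> \<Longrightarrow> inner_label i j \<in> {1..n + m - 1}"
  by (auto simp: inner_label_def)

lemma comp_perm_permutes:
  assumes i: "i \<in> {1..n}" and m: "m \<ge> 1" and \<sigma>: "\<sigma> permutes {1..n}" and \<tau>: "\<tau> permutes {1..m}"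
  shows "comp_perm m i \<sigma> \<tau> permutes {1..n + m - 1}"
proof (rule inj_imp_permutes)
  have i1: "i \<ge> 1" using i by auto
  have si: "\<sigma> i \<in> {1..n}" using i \<sigma> by (simp only: permutes_in_image)
  then have si1: "\<sigma> i \<ge> 1" by auto
  have ti: "1 \<le> \<tau> j \<and> \<tau> j \<le> m" if "1 \<le> j" "j \<le> m" for j
    using that permutes_in_image[OF \<tau>, of j] by auto
  have sk: "\<sigma> k = \<sigma> j \<longleftrightarrow> k = j" for k j using permutes_inj[OF \<sigma>] by (auto dest: injD)
  have tk: "\<tau> k = \<tau> j \<longleftrightarrow> k = j" for k j using permutes_inj[OF \<tau>] by (auto dest: injD)
  show "finite {1..n + m - 1}" by simp
  show "inj_on (comp_perm m i \<sigma> \<tau>) {1..n + m - 1}"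
  proof (rule inj_onI)
    fix p q assume eq: "comp_perm m i \<sigma> \<tau> p = comp_perm m i \<sigma> \<tau> q"
    show "p = q"
    proof (rule label_cases[OF m i1, of p]; rule label_cases[OF m i1, of q])
      fix j k assume "1 \<le> j" "j \<le> m" "p = inner_label i j" "k \<noteq> i" "q = outer_label m i k"
      then show ?thesis
        using eq outer_label_neq_inner_label[of "\<tau> j" m "\<sigma> k" "\<sigma> i"] ti[of j]
        by (simp add: comp_perm_inner comp_perm_outer i1 m si1 sk)
    next
      fix j k assume "1 \<le> j" "j \<le> m" "q = inner_label i j" "k \<noteq> i" "p = outer_label m i k"
      then show ?thesis
        using eq outer_label_neq_inner_label[of "\<tau> j" m "\<sigma> k" "\<sigma> i"] ti[of j]
        by (simp add: comp_perm_inner comp_perm_outer i1 m si1 sk)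
    qed (use eq in \<open>simp_all add: comp_perm_inner comp_perm_outer i1 m si1 sk tk inj_inner_label inj_outer_label\<close>)
  qed
  show "comp_perm m i \<sigma> \<tau> p \<in> {1..n + m - 1}" if "p \<in> {1..n + m - 1}" for p
  proof (rule label_cases[OF m i1, of p])
    fix j assume "1 \<le> j" "j \<le> m" "p = inner_label i j"
    then show ?thesis using inner_label_range[OF si, of "\<tau> j" m] ti i1 by (auto simp: comp_perm_inner)
  next
    fix k assume k: "k \<noteq> i" "p = outer_label m i k"
    then have "k \<in> {1..n}" using that outer_label_range[OF i m] by auto
    then have "\<sigma> k \<in> {1..n}" using \<sigma> by (simp only: permutes_in_image)
    then show ?thesis using k m outer_label_range[OF si m, of "\<sigma> k"] sk by (simp add: comp_perm_outer)
  qed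
  show "comp_perm m i \<sigma> \<tau> p = p" if "p \<notin> {1..n + m - 1}" for p
  proof (rule label_cases[OF m i1, of p])
    fix j assume "1 \<le> j" "j \<le> m" "p = inner_label i j"
    then show ?thesis using inner_label_range[OF i, of j m] that by auto
  next
    fix k assume k: "k \<noteq> i" "p = outer_label m i k"
    then have "k \<notin> {1..n}" using that outer_label_range[OF i m] by auto
    then have "\<sigma> k = k" by (rule permutes_not_in[OF \<sigma>])
    then show ?thesis using k m i1 si \<open>k \<notin> {1..n}\<close> i
      by (simp add: comp_perm_outer) (auto simp: outer_label_def)
  qed
qed

text \<open>
  A surjective morphism from an operad \<open>P\<close> to a record \<open>Q\<close> of operad operations, of which only
  the modules are assumed to satisfy axioms.
\<close>

locale operad_surjection = operad R P for R :: "('k, 'z) ring_scheme" and P :: "('k, 'a) operad" +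
  fixes Q :: "('k, 'b) operad" and h :: "nat \<Rightarrow> 'a \<Rightarrow> 'b"
  assumes target_module: "n \<ge> 1 \<Longrightarrow> Module.module R (op_mod Q n)"
    and surj: "n \<ge> 1 \<Longrightarrow> h n ` carrier (op_mod P n) = carrier (op_mod Q n)"
    and hom_add: "\<lbrakk>n \<ge> 1; x \<in> carrier (op_mod P n); y \<in> carrier (op_mod P n)\<rbrakk>
      \<Longrightarrow> h n (x \<oplus>\<^bsub>op_mod P n\<^esub> y) = h n x \<oplus>\<^bsub>op_mod Q n\<^esub> h n y"
    and hom_smult: "\<lbrakk>n \<ge> 1; a \<in> carrier R; x \<in> carrier (op_mod P n)\<rbrakk>
      \<Longrightarrow> h n (a \<odot>\<^bsub>op_mod P n\<^esub> x) = a \<odot>\<^bsub>op_mod Q n\<^esub> h n x"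
    and hom_act: "\<lbrakk>n \<ge> 1; \<sigma> permutes {1..n}; x \<in> carrier (op_mod P n)\<rbrakk>
      \<Longrightarrow> h n (op_act P n \<sigma> x) = op_act Q n \<sigma> (h n x)"
    and hom_unit: "h 1 (op_unit P) = op_unit Q"
    and hom_comp: "\<lbrakk>i \<in> {1..n}; m \<ge> 1; x \<in> carrier (op_mod P n); y \<in> carrier (op_mod P m)\<rbrakk>
      \<Longrightarrow> h (n + m - 1) (op_comp P n m i x y) = op_comp Q n m i (h n x) (h m y)"
begin

lemma hom_closed: "\<lbrakk>n \<ge> 1; x \<in> carrier (op_mod P n)\<rbrakk> \<Longrightarrow> h n x \<in> carrier (op_mod Q n)"
  using surj by blast

lemma preimage:
  assumes "u \<in> carrier (op_mod Q n)" "n \<ge> 1"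
  obtains x where "x \<in> carrier (op_mod P n)" "u = h n x"
  using assms surj by blast

lemma add_closed: "\<lbrakk>n \<ge> 1; x \<in> carrier (op_mod P n); y \<in> carrier (op_mod P n)\<rbrakk>
    \<Longrightarrow> x \<oplus>\<^bsub>op_mod P n\<^esub> y \<in> carrier (op_mod P n)"
  using abelian_groupE(1)[OF Module.module.axioms(2)[OF op_module]] .

lemma smult_closed: "\<lbrakk>n \<ge> 1; a \<in> carrier R; x \<in> carrier (op_mod P n)\<rbrakk>
    \<Longrightarrow> a \<odot>\<^bsub>op_mod P n\<^esub> x \<in> carrier (op_mod P n)"
  using Module.module.smult_closed[OF op_module] .

text \<open>
  Every axiom is an identity between elements of \<open>Q\<close>; lifting the arguments to \<open>P\<close> reduces it to the
  same axiom for \<open>P\<close>.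
\<close>

lemma operad_target: "operad R Q"
proof (rule operad.intro, goal_cases)
  case (1 n)
  then show ?case by (rule target_module)
next
  case (2 n \<sigma> u)
  then obtain x where "x \<in> carrier (op_mod P n)" "u = h n x" by (elim preimage)
  with 2 show ?case by (simp add: hom_closed act_closed flip: hom_act)
next
  case (3 n \<sigma> u v)
  then obtain x y where "x \<in> carrier (op_mod P n)" "u = h n x" "y \<in> carrier (op_mod P n)" "v = h n y"
    by (meson preimage)
  with 3 show ?case by (simp add: add_closed act_closed act_add flip: hom_act hom_add)
next
  case (4 n \<sigma> a u)
  then obtain x where "x \<in> carrier (op_mod P n)" "u = h n x" by (meson preimage)
  with 4 show ?case by (simp add: smult_closed act_closed act_smult flip: hom_act hom_smult)
next
  case (5 n u)
  then obtain x where "x \<in> carrier (op_mod P n)" "u = h n x" by (meson preimage)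
  with 5 show ?case by (simp add: act_id permutes_id flip: hom_act)
next
  case (6 n \<sigma> \<tau> u)
  then obtain x where "x \<in> carrier (op_mod P n)" "u = h n x" by (meson preimage)
  with 6 show ?case by (simp add: act_comp act_closed permutes_compose flip: hom_act)
next
  case 7
  then show ?case using hom_closed[OF le_refl unit_closed] by (simp only: hom_unit)
next
  case (8 i n m u v)
  then obtain x y where *: "x \<in> carrier (op_mod P n)" "u = h n x" "y \<in> carrier (op_mod P m)" "v = h m y"
    using preimage[of u n] preimage[of v m] by (metis atLeastAtMost_iff le_trans)
  have "h (n + m - 1) (op_comp P n m i x y) \<in> carrier (op_mod Q (n + m - 1))"
    using 8 * by (intro hom_closed comp_closed) auto
  with 8 * show ?case by (simp add: hom_comp)
next
  case (9 i n m u u' v)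
  then have n: "n \<ge> 1" "n + m - 1 \<ge> 1" by auto
  obtain x x' y where *: "x \<in> carrier (op_mod P n)" "u = h n x" "x' \<in> carrier (op_mod P n)" "u' = h n x'"
     "y \<in> carrier (op_mod P m)" "v = h m y"
    using 9 n by (meson preimage)
  have "op_comp Q n m i (u \<oplus>\<^bsub>op_mod Q n\<^esub> u') v = h (n + m - 1) (op_comp P n m i (x \<oplus>\<^bsub>op_mod P n\<^esub> x') y)"
    using 9 n * by (simp add: hom_comp hom_add add_closed)
  also have "\<dots> = h (n + m - 1) (op_comp P n m i x y) \<oplus>\<^bsub>op_mod Q (n + m - 1)\<^esub> h (n + m - 1) (op_comp P n m i x' y)"
    by (subst comp_add_left) (use 9 n * in \<open>auto intro!: hom_add comp_closed\<close>)
  finally show ?case using 9 n * by (simp add: hom_comp)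
next
  case (10 i n m u v v')
  then have n: "n \<ge> 1" "n + m - 1 \<ge> 1" by auto
  obtain x y y' where *: "x \<in> carrier (op_mod P n)" "u = h n x" "y' \<in> carrier (op_mod P m)" "v' = h m y'"
     "y \<in> carrier (op_mod P m)" "v = h m y"
    using 10 n by (meson preimage)
  have "op_comp Q n m i u (v \<oplus>\<^bsub>op_mod Q m\<^esub> v') = h (n + m - 1) (op_comp P n m i x (y \<oplus>\<^bsub>op_mod P m\<^esub> y'))"
    using 10 n * by (simp add: hom_comp hom_add add_closed)
  also have "\<dots> = h (n + m - 1) (op_comp P n m i x y) \<oplus>\<^bsub>op_mod Q (n + m - 1)\<^esub> h (n + m - 1) (op_comp P n m i x y')"
    by (subst comp_add_right) (use 10 n * in \<open>auto intro!: hom_add comp_closed\<close>)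
  finally show ?case using 10 n * by (simp add: hom_comp)
next
  case (11 i n m a u v)
  then have n: "n \<ge> 1" "n + m - 1 \<ge> 1" by auto
  obtain x y where *: "x \<in> carrier (op_mod P n)" "u = h n x" "y \<in> carrier (op_mod P m)" "v = h m y"
    using 11 n by (meson preimage)
  have "op_comp Q n m i (a \<odot>\<^bsub>op_mod Q n\<^esub> u) v = h (n + m - 1) (op_comp P n m i (a \<odot>\<^bsub>op_mod P n\<^esub> x) y)"
    using 11 n * by (simp add: hom_comp hom_smult smult_closed)
  also have "\<dots> = a \<odot>\<^bsub>op_mod Q (n + m - 1)\<^esub> h (n + m - 1) (op_comp P n m i x y)"
    by (subst comp_smult_left) (use 11 n * in \<open>auto intro!: hom_smult comp_closed\<close>)
  finally show ?case using 11 n * by (simp add: hom_comp)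
next
  case (12 i n m a u v)
  then have n: "n \<ge> 1" "n + m - 1 \<ge> 1" by auto
  obtain x y where *: "x \<in> carrier (op_mod P n)" "u = h n x" "y \<in> carrier (op_mod P m)" "v = h m y"
    using 12 n by (meson preimage)
  have "op_comp Q n m i u (a \<odot>\<^bsub>op_mod Q m\<^esub> v) = h (n + m - 1) (op_comp P n m i x (a \<odot>\<^bsub>op_mod P m\<^esub> y))"
    using 12 n * by (simp add: hom_comp hom_smult smult_closed)
  also have "\<dots> = a \<odot>\<^bsub>op_mod Q (n + m - 1)\<^esub> h (n + m - 1) (op_comp P n m i x y)"
    by (subst comp_smult_right) (use 12 n * in \<open>auto intro!: hom_smult comp_closed\<close>)
  finally show ?case using 12 n * by (simp add: hom_comp)
next
  case (13 n u)
  then obtain x where x: "x \<in> carrier (op_mod P n)" "u = h n x" by (meson preimage)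
  have "op_comp Q 1 n 1 (op_unit Q) u = h (1 + n - 1) (op_comp P 1 n 1 (op_unit P) x)"
    using 13 x by (subst hom_comp) (auto simp: unit_closed hom_unit[symmetric])
  then show ?case using 13 x by (simp add: unit_left[OF _ x(1), simplified])
next
  case (14 i n u)
  then have n: "n \<ge> 1" by auto
  obtain x where x: "x \<in> carrier (op_mod P n)" "u = h n x" using 14 n by (meson preimage)
  have "op_comp Q n 1 i u (op_unit Q) = h (n + 1 - 1) (op_comp P n 1 i x (op_unit P))"
    using 14 x by (subst hom_comp) (auto simp: unit_closed hom_unit[symmetric])
  then show ?case using 14 x by (simp add: unit_right[OF _ x(1), simplified])
next
  case (15 i l j m n u v w)
  then have n: "l \<ge> 1" "m \<ge> 1" by auto
  obtain x y z where *: "x \<in> carrier (op_mod P l)" "u = h l x" "y \<in> carrier (op_mod P m)" "v = h m y"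
      "z \<in> carrier (op_mod P n)" "w = h n z"
    using 15 n by (meson preimage)
  have eq: "l + m - 1 + n - 1 = l + (m + n - 1) - 1" using 15 n by auto
  have "op_comp Q (l + m - 1) n (i + j - 1) (op_comp Q l m i u v) w
    = h (l + m - 1 + n - 1) (op_comp P (l + m - 1) n (i + j - 1) (op_comp P l m i x y) z)"
    using 15 n * by (subst hom_comp) (auto simp: hom_comp comp_closed)
  also have "\<dots> = h (l + (m + n - 1) - 1) (op_comp P l (m + n - 1) i x (op_comp P m n j y z))"
    unfolding eq using 15 * by (subst assoc_sequential) auto
  also have "\<dots> = op_comp Q l (m + n - 1) i u (op_comp Q m n j v w)"
    using 15 n * by (subst hom_comp) (auto simp: hom_comp comp_closed)
  finally show ?case .
next
  case (16 i l k m n u v w)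
  then have n: "l \<ge> 1" by auto
  obtain x y z where *: "x \<in> carrier (op_mod P l)" "u = h l x" "y \<in> carrier (op_mod P m)" "v = h m y"
      "z \<in> carrier (op_mod P n)" "w = h n z"
    using 16 n by (meson preimage)
  have eq: "l + m - 1 + n - 1 = l + n - 1 + m - 1" using 16 n by auto
  have "op_comp Q (l + m - 1) n (k + m - 1) (op_comp Q l m i u v) w
    = h (l + m - 1 + n - 1) (op_comp P (l + m - 1) n (k + m - 1) (op_comp P l m i x y) z)"
    using 16 n * by (subst hom_comp) (auto simp: hom_comp comp_closed)
  also have "\<dots> = h (l + n - 1 + m - 1) (op_comp P (l + n - 1) m i (op_comp P l n k x z) y)"
    unfolding eq using 16 * by (subst assoc_parallel) auto
  also have "\<dots> = op_comp Q (l + n - 1) m i (op_comp Q l n k u w) v"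
    using 16 n * by (subst hom_comp) (auto simp: hom_comp comp_closed)
  finally show ?case .
next
  case (17 i n m \<sigma> \<tau> u v)
  then have n: "n \<ge> 1" "n + m - 1 \<ge> 1" by auto
  obtain x y where *: "x \<in> carrier (op_mod P n)" "u = h n x" "y \<in> carrier (op_mod P m)" "v = h m y"
    using 17 n by (meson preimage)
  have si: "\<sigma> i \<in> {1..n}" using 17 permutes_in_image by metis
  have "op_comp Q n m (\<sigma> i) (op_act Q n \<sigma> u) (op_act Q m \<tau> v)
     = h (n + m - 1) (op_comp P n m (\<sigma> i) (op_act P n \<sigma> x) (op_act P m \<tau> y))"
    using 17 n * si by (simp add: hom_comp act_closed hom_act)
  also have "\<dots> = h (n + m - 1) (op_act P (n + m - 1) (comp_perm m i \<sigma> \<tau>) (op_comp P n m i x y))"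
    using 17 * by (subst equivariance) auto
  also have "\<dots> = op_act Q (n + m - 1) (comp_perm m i \<sigma> \<tau>) (h (n + m - 1) (op_comp P n m i x y))"
    by (rule hom_act) (use 17 n * in \<open>auto intro!: comp_perm_permutes comp_closed\<close>)
  finally show ?case using 17 n * by (simp add: hom_comp)
qed

end

context operad_surjection
begin

text \<open>
  The elements of arity \<open>n\<close> over \<open>u\<close>. The cosets of the kernel are the fibres, and in this form the
  operations on cosets are computed by applying \<open>h\<close>.
\<close>

definition fibre :: "nat \<Rightarrow> 'b \<Rightarrow> 'a set" where
  "fibre n u = {x \<in> carrier (op_mod P n). h n x = u}"

lemma hom_zero: "n \<ge> 1 \<Longrightarrow> h n \<zero>\<^bsub>op_mod P n\<^esub> = \<zero>\<^bsub>op_mod Q n\<^esub>"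
proof -
  assume n: "n \<ge> 1"
  interpret P: Module.module R "op_mod P n" by (rule op_module[OF n])
  interpret Q: Module.module R "op_mod Q n" by (rule target_module[OF n])
  have "h n \<zero>\<^bsub>op_mod P n\<^esub> \<oplus>\<^bsub>op_mod Q n\<^esub> h n \<zero>\<^bsub>op_mod P n\<^esub> = h n \<zero>\<^bsub>op_mod P n\<^esub>"
    using n by (simp flip: hom_add)
  then show ?thesis using hom_closed[OF n P.M.zero_closed]
    by (metis Q.M.add.r_cancel_one)
qed

lemma hom_minus:
  assumes "n \<ge> 1" "x \<in> carrier (op_mod P n)" "y \<in> carrier (op_mod P n)"
  shows "h n (x \<ominus>\<^bsub>op_mod P n\<^esub> y) \<oplus>\<^bsub>op_mod Q n\<^esub> h n y = h n x"
proof -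
  interpret P: Module.module R "op_mod P n" by (rule op_module[OF assms(1)])
  have "(x \<ominus>\<^bsub>op_mod P n\<^esub> y) \<oplus>\<^bsub>op_mod P n\<^esub> y = x"
    using assms by (simp add: a_minus_def P.M.a_assoc P.M.l_neg)
  then show ?thesis using assms by (simp flip: hom_add)
qed

lemma set_add_fibre:
  assumes n: "n \<ge> 1" and x: "x \<in> carrier (op_mod P n)" and y: "y \<in> carrier (op_mod P n)"
  shows "fibre n (h n x) <+>\<^bsub>op_mod P n\<^esub> fibre n (h n y) = fibre n (h n (x \<oplus>\<^bsub>op_mod P n\<^esub> y))"
proof -
  interpret P: Module.module R "op_mod P n" by (rule op_module[OF n])
  interpret Q: Module.module R "op_mod Q n" by (rule target_module[OF n])
  have "\<exists>x'\<in>fibre n (h n x). \<exists>y'\<in>fibre n (h n y). z = x' \<oplus>\<^bsub>op_mod P n\<^esub> y'"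
    if z: "z \<in> fibre n (h n (x \<oplus>\<^bsub>op_mod P n\<^esub> y))" for z
  proof (intro bexI)
    have zc: "z \<in> carrier (op_mod P n)" using z by (simp add: fibre_def)
    then show "z = (z \<ominus>\<^bsub>op_mod P n\<^esub> y) \<oplus>\<^bsub>op_mod P n\<^esub> y"
      using y by (simp add: a_minus_def P.M.a_assoc P.M.l_neg)
    have "h n (z \<ominus>\<^bsub>op_mod P n\<^esub> y) \<oplus>\<^bsub>op_mod Q n\<^esub> h n y = h n x \<oplus>\<^bsub>op_mod Q n\<^esub> h n y"
      using hom_minus[OF n zc y] z n x y by (simp add: fibre_def hom_add)
    then have "h n (z \<ominus>\<^bsub>op_mod P n\<^esub> y) = h n x"
      using hom_closed[OF n] x y zc by (metis P.M.minus_closed Q.M.add.r_cancel)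
    then show "z \<ominus>\<^bsub>op_mod P n\<^esub> y \<in> fibre n (h n x)" 
      using zc y by (simp add: fibre_def)
    show "y \<in> fibre n (h n y)" using y by (simp add: fibre_def)
  qed
  then show ?thesis
    using n by (auto simp: set_add_def' hom_add) (auto simp: fibre_def hom_add x y)
qed

text \<open>
  The first isomorphism theorem for operads.
\<close>

theorem quotient_by_kernel:
  assumes I: "\<And>n. n \<ge> 1 \<Longrightarrow> I n = {x \<in> carrier (op_mod P n). h n x = \<zero>\<^bsub>op_mod Q n\<^esub>}"
  shows "isomorphic_operads R (quotient_operad P I) Q"
proof -
  let ?F = "quotient_operad P I"
  define q where "q n x = fibre n (h n x)" for n x
  have coset: "I n +>\<^bsub>op_mod P n\<^esub> x = q n x" if n: "n \<ge> 1" and x: "x \<in> carrier (op_mod P n)" for n x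
  proof -
    interpret P: Module.module R "op_mod P n" by (rule op_module[OF n])
    interpret Q: Module.module R "op_mod Q n" by (rule target_module[OF n])
    have "\<exists>k\<in>I n. z = k \<oplus>\<^bsub>op_mod P n\<^esub> x" if z: "z \<in> fibre n (h n x)" for z
    proof (intro bexI)
      have zc: "z \<in> carrier (op_mod P n)" using z by (simp add: fibre_def)
      then show "z = (z \<ominus>\<^bsub>op_mod P n\<^esub> x) \<oplus>\<^bsub>op_mod P n\<^esub> x"
        using x by (simp add: a_minus_def P.M.a_assoc P.M.l_neg)
      have "h n (z \<ominus>\<^bsub>op_mod P n\<^esub> x) \<oplus>\<^bsub>op_mod Q n\<^esub> h n x = \<zero>\<^bsub>op_mod Q n\<^esub> \<oplus>\<^bsub>op_mod Q n\<^esub> h n x"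
        using hom_minus[OF n zc x] z hom_closed[OF n x] by (simp add: fibre_def)
      then have "h n (z \<ominus>\<^bsub>op_mod P n\<^esub> x) = \<zero>\<^bsub>op_mod Q n\<^esub>"
        using hom_closed[OF n] x zc by (metis P.M.minus_closed Q.M.zero_closed Q.M.add.r_cancel)
      then show "z \<ominus>\<^bsub>op_mod P n\<^esub> x \<in> I n" using zc x by (simp add: I n)
    qed
    then show ?thesis
      using hom_closed[OF n x]
      by (auto simp: a_r_coset_def' q_def) (auto simp: fibre_def I n hom_add x)
  qed
  have self: "x \<in> q n x" if "x \<in> carrier (op_mod P n)" for n x
    using that by (simp add: q_def fibre_def)
  have mem: "x' \<in> carrier (op_mod P n) \<and> h n x' = h n x" if "x' \<in> q n x" for n x x'
    using that by (simp add: q_def fibre_def)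
  have carrier: "carrier (op_mod ?F n) = q n ` carrier (op_mod P n)" if "n \<ge> 1" for n
    using that by (auto simp: quotient_operad_def quotient_module_def A_RCOSETS_def' coset)
  have zero: "\<zero>\<^bsub>op_mod ?F n\<^esub> = q n \<zero>\<^bsub>op_mod P n\<^esub>" if n: "n \<ge> 1" for n
    by (simp add: quotient_operad_def quotient_module_def I n q_def fibre_def hom_zero)
  have add: "q n x \<oplus>\<^bsub>op_mod ?F n\<^esub> q n y = q n (x \<oplus>\<^bsub>op_mod P n\<^esub> y)"
    if "n \<ge> 1" "x \<in> carrier (op_mod P n)" "y \<in> carrier (op_mod P n)" for n x y
    using that by (simp add: quotient_operad_def quotient_module_def q_def set_add_fibre)
  have smult: "a \<odot>\<^bsub>op_mod ?F n\<^esub> q n x = q n (a \<odot>\<^bsub>op_mod P n\<^esub> x)"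
    if "n \<ge> 1" "x \<in> carrier (op_mod P n)" "a \<in> carrier R" for n a x
  proof -
    have "I n +>\<^bsub>op_mod P n\<^esub> (a \<odot>\<^bsub>op_mod P n\<^esub> x') = q n (a \<odot>\<^bsub>op_mod P n\<^esub> x)" if "x' \<in> q n x" for x'
      using mem[OF that] \<open>n \<ge> 1\<close> \<open>x \<in> _\<close> \<open>a \<in> _\<close> by (simp add: coset smult_closed q_def hom_smult)
    then show ?thesis
      using self[OF that(2)] by (auto simp: quotient_operad_def quotient_module_def)
  qed
  have act: "op_act ?F n \<sigma> (q n x) = q n (op_act P n \<sigma> x)"
    if "n \<ge> 1" "x \<in> carrier (op_mod P n)" "\<sigma> permutes {1..n}" for n \<sigma> x
  proof -
    have "I n +>\<^bsub>op_mod P n\<^esub> (op_act P n \<sigma> x') = q n (op_act P n \<sigma> x)" if "x' \<in> q n x" for x'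
      using mem[OF that] \<open>n \<ge> 1\<close> \<open>x \<in> _\<close> \<open>\<sigma> permutes _\<close> by (simp add: coset act_closed q_def hom_act)
    then show ?thesis
      using self[OF that(2)] by (auto simp: quotient_operad_def)
  qed
  have comp: "op_comp ?F n m i (q n x) (q m y) = q (n + m - 1) (op_comp P n m i x y)"
    if "i \<in> {1..n}" "m \<ge> 1" "x \<in> carrier (op_mod P n)" "y \<in> carrier (op_mod P m)" for n m i x y
  proof -
    have n: "n + m - 1 \<ge> 1" using that by auto
    have "I (n + m - 1) +>\<^bsub>op_mod P (n + m - 1)\<^esub> (op_comp P n m i x' y') = q (n + m - 1) (op_comp P n m i x y)"
      if "x' \<in> q n x" "y' \<in> q m y" for x' y'
      using mem[OF that(1)] mem[OF that(2)] \<open>i \<in> _\<close> \<open>m \<ge> 1\<close> \<open>x \<in> _\<close> \<open>y \<in> _\<close> n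
      by (simp only: coset comp_closed q_def hom_comp)
    then show ?thesis
      using self[OF that(3)] self[OF that(4)] unfolding quotient_operad_def
      by (simp cong: SUP_cong_simp) blast
  qed
  have unit: "op_unit ?F = q 1 (op_unit P)"
    by (simp add: quotient_operad_def coset unit_closed)
  interpret F: operad_surjection R P ?F q
  proof (intro operad_surjection.intro operad_surjection_axioms.intro operad_axioms)
    show "Module.module R (op_mod ?F n)" if "n \<ge> 1" for n
      by (rule module_surjective_image[OF op_module[OF that], of "q n"])
        (simp_all add: carrier zero add smult that)
  qed (simp_all only: carrier add smult act unit comp)
  \<comment> \<open>The value of h on the coset C, which does not depend on the representative.\<close>
  define \<phi> where "\<phi> n C = h n (SOME x. x \<in> C)" for n C
  have \<phi>: "\<phi> n (q n x) = h n x" if "x \<in> carrier (op_mod P n)" for n x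
    using mem[OF someI[of "\<lambda>y. y \<in> q n x", OF self[OF that]]] by (simp add: \<phi>_def)
  have bij: "bij_betw (\<phi> n) (carrier (op_mod ?F n)) (carrier (op_mod Q n))" if n: "n \<ge> 1" for n
  proof (rule bij_betw_imageI)
    show "inj_on (\<phi> n) (carrier (op_mod ?F n))"
      by (auto simp: inj_on_def carrier n \<phi>) (simp_all add: q_def)
    show "\<phi> n ` carrier (op_mod ?F n) = carrier (op_mod Q n)"
      using surj[OF n] by (simp add: carrier n image_image \<phi> cong: image_cong_simp)
  qed
  have "operad_iso R ?F Q \<phi>"
    unfolding operad_iso_def
  proof (intro conjI allI impI ballI)
    fix n :: nat assume n: "n \<ge> 1"
    have "\<phi> n \<in> hom (add_monoid (op_mod ?F n)) (add_monoid (op_mod Q n))"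
      using n by (auto simp: hom_def carrier add \<phi> hom_closed add_closed hom_add)
    then show "\<phi> n \<in> iso (add_monoid (op_mod ?F n)) (add_monoid (op_mod Q n))"
      using bij[OF n] by (simp add: iso_def)
    fix C assume "C \<in> carrier (op_mod ?F n)"
    then obtain x where x: "x \<in> carrier (op_mod P n)" "C = q n x" using carrier[OF n] by auto
    show "\<phi> n (a \<odot>\<^bsub>op_mod ?F n\<^esub> C) = a \<odot>\<^bsub>op_mod Q n\<^esub> \<phi> n C" if "a \<in> carrier R" for a
      using that n x by (simp add: smult \<phi> smult_closed hom_smult)
    show "\<phi> n (op_act ?F n \<sigma> C) = op_act Q n \<sigma> (\<phi> n C)" if "\<sigma> permutes {1..n}" for \<sigma>
      using that n x by (simp add: act \<phi> act_closed hom_act)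
    fix m i D assume m: "m \<ge> 1" and i: "i \<in> {1..n}" and "D \<in> carrier (op_mod ?F m)"
    then obtain y where y: "y \<in> carrier (op_mod P m)" "D = q m y" using carrier[OF m] by auto
    show "\<phi> (n + m - 1) (op_comp ?F n m i C D) = op_comp Q n m i (\<phi> n C) (\<phi> m D)"
      unfolding x(2) y(2) using i m x(1) y(1) by (simp only: comp \<phi> comp_closed hom_comp)
  next
    show "\<phi> 1 (op_unit ?F) = op_unit Q" by (simp add: unit \<phi> unit_closed hom_unit)
  qed
  then show ?thesis
    unfolding isomorphic_operads_def using F.operad_target operad_target by blast
qed

end

section \<open>The free magmatic operad\<close>

lemma klinear_bil_left: "klinear f \<Longrightarrow> klinear (\<lambda>x. bilinear_ext g (f x) y)"
  by (rule klinear_comp[OF klinear_bilinear_ext_left])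
lemma klinear_bil_right: "klinear f \<Longrightarrow> klinear (\<lambda>x. bilinear_ext g y (f x))"
  by (rule klinear_comp[OF klinear_bilinear_ext_right])
lemma klinear_lin: "klinear f \<Longrightarrow> klinear (\<lambda>x. linear_ext g (f x))"
  by (rule klinear_comp[OF klinear_linear_ext])

lemmas klinear_intros = klinear_bil_left klinear_bil_right klinear_lin klinear_ident
  klinear_bilinear_ext_left klinear_bilinear_ext_right klinear_linear_ext

lemma bilinear_cong:
  assumes "\<And>y. klinear (\<lambda>x. f x y)" "\<And>x. klinear (\<lambda>y. f x y)"
    and "\<And>y. klinear (\<lambda>x. g x y)" "\<And>x. klinear (\<lambda>y. g x y)"
    and "keys x \<subseteq> B" "keys y \<subseteq> C"
    and "\<And>b c. b \<in> B \<Longrightarrow> c \<in> C \<Longrightarrow> f (basis_elem b) (basis_elem c) = g (basis_elem b) (basis_elem c)"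
  shows "f x y = g x y"
  by (rule klinear_cong[OF assms(1,3,5)], rule klinear_cong[OF assms(2,4,6)], rule assms(7))

lemma trilinear_cong:
  assumes "\<And>y z. klinear (\<lambda>x. f x y z)" "\<And>x z. klinear (\<lambda>y. f x y z)" "\<And>x y. klinear (\<lambda>z. f x y z)"
    and "\<And>y z. klinear (\<lambda>x. g x y z)" "\<And>x z. klinear (\<lambda>y. g x y z)" "\<And>x y. klinear (\<lambda>z. g x y z)"
    and "keys x \<subseteq> B" "keys y \<subseteq> C" "keys z \<subseteq> D"
    and "\<And>b c d. b \<in> B \<Longrightarrow> c \<in> C \<Longrightarrow> d \<in> D \<Longrightarrow>
      f (basis_elem b) (basis_elem c) (basis_elem d) = g (basis_elem b) (basis_elem c) (basis_elem d)"
  shows "f x y z = g x y z"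
  by (rule klinear_cong[OF assms(1,4,7)], rule klinear_cong[OF assms(2,5,8)],
      rule klinear_cong[OF assms(3,6,9)], rule assms(10))

lemma keys_bilinear:
  assumes "keys x \<subseteq> B" "keys y \<subseteq> C" "\<And>b c. b \<in> B \<Longrightarrow> c \<in> C \<Longrightarrow> keys (g b c) \<subseteq> D"
  shows "keys (bilinear_ext g x y) \<subseteq> D"
proof (rule keys_klinear[OF klinear_bilinear_ext_left assms(1)])
  fix b assume b: "b \<in> B"
  show "keys (bilinear_ext g (basis_elem b) y) \<subseteq> D"
    by (rule keys_klinear[OF klinear_bilinear_ext_right assms(2)]) (simp add: assms(3) b)
qed

lemma term_subst_cong:
  "(\<And>j. j \<in> set (term_vars t) \<Longrightarrow> \<theta> j = \<theta>' j) \<Longrightarrow> term_subst \<theta> t = term_subst \<theta>' t"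
  by (induction t) auto

lemma term_subst_subst: "term_subst \<theta> (term_subst \<theta>' t) = term_subst (\<lambda>j. term_subst \<theta> (\<theta>' j)) t"
  by (induction t) auto

lemma term_subst_Var [simp]: "term_subst Var t = t"
  by (induction t) auto

lemma set_term_vars_subst: "set (term_vars (term_subst \<theta> t)) = (\<Union>j\<in>set (term_vars t). set (term_vars (\<theta> j)))"
  by (induction t) auto

lemma distinct_term_vars_subst:
  assumes "distinct (term_vars t)" "\<And>j. j \<in> set (term_vars t) \<Longrightarrow> distinct (term_vars (\<theta> j))"
    and "\<And>j k. j \<in> set (term_vars t) \<Longrightarrow> k \<in> set (term_vars t) \<Longrightarrow> j \<noteq> k
      \<Longrightarrow> set (term_vars (\<theta> j)) \<inter> set (term_vars (\<theta> k)) = {}"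
  shows "distinct (term_vars (term_subst \<theta> t))"
  using assms
proof (induction t)
  case (Prod s t)
  have "set (term_vars (\<theta> j)) \<inter> set (term_vars (\<theta> k)) = {}"
    if "j \<in> set (term_vars s)" "k \<in> set (term_vars t)" for j k
    using that Prod.prems(1) by (intro Prod.prems(3)) auto
  then have "set (term_vars (term_subst \<theta> s)) \<inter> set (term_vars (term_subst \<theta> t)) = {}"
    unfolding set_term_vars_subst by blast
  moreover have "distinct (term_vars (term_subst \<theta> s))" "distinct (term_vars (term_subst \<theta> t))"
    using Prod.prems by (auto intro!: Prod.IH)
  ultimately show ?case by simp
qed simp

lemma term_vars_relabel: "term_vars (term_relabel \<rho> t) = map \<rho> (term_vars t)"
  by (induction t) (simp_all add: term_relabel_def)

lemma term_relabel_simps [simp]: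
  "term_relabel \<rho> (Var j) = Var (\<rho> j)"
  "term_relabel \<rho> (Prod s t) = Prod (term_relabel \<rho> s) (term_relabel \<rho> t)"
  by (simp_all add: term_relabel_def)

lemma term_relabel_relabel: "term_relabel \<rho> (term_relabel \<rho>' t) = term_relabel (\<lambda>j. \<rho> (\<rho>' j)) t"
  by (induction t) auto

lemma term_relabel_cong:
  "(\<And>j. j \<in> set (term_vars t) \<Longrightarrow> \<rho> j = \<rho>' j) \<Longrightarrow> term_relabel \<rho> t = term_relabel \<rho>' t"
  by (induction t) auto

text \<open>Monomials in which the variables of a set \<open>A\<close> occur exactly once.\<close>

definition monomials :: "nat set \<Rightarrow> mag_term set" where
  "monomials A = {t. distinct (term_vars t) \<and> set (term_vars t) = A}"

lemma multilinear_terms_eq: "multilinear_terms n = monomials {1..n}"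
  by (simp add: multilinear_terms_def monomials_def)

lemma relabel_monomials:
  "t \<in> monomials A \<Longrightarrow> bij_betw \<sigma> A B \<Longrightarrow> term_relabel \<sigma> t \<in> monomials B"
  by (auto simp: monomials_def term_vars_relabel distinct_map bij_betw_def)

lemma labels_image:
  assumes i: "i \<in> {1..n}" and m: "m \<ge> 1"
  shows "outer_label m i ` ({1..n} - {i}) \<union> inner_label i ` {1..m} = {1..n + m - 1}"
proof (intro equalityI subsetI)
  fix p assume "p \<in> outer_label m i ` ({1..n} - {i}) \<union> inner_label i ` {1..m}"
  then show "p \<in> {1..n + m - 1}"
    using outer_label_range[OF i m] inner_label_range[OF i] by blast
next
  fix p assume p: "p \<in> {1..n + m - 1}"
  have "i \<ge> 1" using i by simp
  then show "p \<in> outer_label m i ` ({1..n} - {i}) \<union> inner_label i ` {1..m}"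
    by (rule label_cases[OF m, of i p]) (use p outer_label_range[OF i m] in auto)
qed

lemma outer_inner_disjoint:
  "i \<ge> 1 \<Longrightarrow> outer_label m i ` (A - {i}) \<inter> inner_label i ` {1..m} = {}"
  by (auto simp: outer_label_def inner_label_def split: if_splits)

lemma term_comp_multilinear:
  assumes t: "t \<in> multilinear_terms n" and s: "s \<in> multilinear_terms m" and i: "i \<in> {1..n}" and m: "m \<ge> 1"
  shows "term_comp m i t s \<in> multilinear_terms (n + m - 1)"
proof -
  have t': "distinct (term_vars t)" "set (term_vars t) = {1..n}"
    and s': "distinct (term_vars s)" "set (term_vars s) = {1..m}"
    using t s by (auto simp: multilinear_terms_def)
  have i1: "i \<ge> 1" using i by simp
  have vars: "set (term_vars (if j = i then term_relabel (inner_label i) s else Var (outer_label m i j)))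
      = (if j = i then inner_label i ` {1..m} else {outer_label m i j})" for j
    by (simp add: term_vars_relabel s')
  have "set (term_vars (term_comp m i t s)) = outer_label m i ` ({1..n} - {i}) \<union> inner_label i ` {1..m}"
    unfolding term_comp_def set_term_vars_subst vars t' using i by auto
  moreover have "distinct (term_vars (term_comp m i t s))"
    unfolding term_comp_def
  proof (rule distinct_term_vars_subst[OF t'(1)], goal_cases)
    case (1 j)
    then show ?case
      using s' i1 by (simp add: term_vars_relabel distinct_map inj_on_def inj_inner_label)
  next
    case (2 j k)
    then show ?case
      unfolding vars using t'(2) i1 outer_label_neq_inner_label[OF _ _ _ i1, of _ m]
      by (auto simp: inj_outer_label[OF m])
  qed
  ultimately show ?thesis by (simp add: multilinear_terms_def labels_image[OF i m])
qed

lemma term_comp_unit_left: "term_comp n 1 (Var 1) t = t"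
proof -
  have "inner_label 1 = (\<lambda>j. j)" by (auto simp: inner_label_def)
  then show ?thesis by (simp add: term_comp_def term_relabel_def)
qed

lemma term_comp_unit_right: "term_comp 1 i t (Var 1) = t"
proof -
  have "(\<lambda>j. if j = i then term_relabel (inner_label i) (Var 1) else Var (outer_label 1 i j)) = Var"
    by (auto simp: inner_label_def outer_label_def)
  then show ?thesis by (simp add: term_comp_def)
qed

lemma term_comp_relabel_left:
  "term_subst \<theta> (term_relabel \<rho> t) = term_subst (\<lambda>j. \<theta> (\<rho> j)) t"
  by (simp add: term_relabel_def term_subst_subst)

lemma term_relabel_subst: "term_relabel \<rho> (term_subst \<theta> t) = term_subst (\<lambda>j. term_relabel \<rho> (\<theta> j)) t"
  by (simp add: term_relabel_def term_subst_subst)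

lemma term_comp_sequential:
  assumes "t \<in> multilinear_terms l" "s \<in> multilinear_terms m" "r \<in> multilinear_terms n"
    and i: "i \<in> {1..l}" and j: "j \<in> {1..m}" and n: "n \<ge> 1"
  shows "term_comp n (i + j - 1) (term_comp m i t s) r = term_comp (m + n - 1) i t (term_comp n j s r)"
proof -
  have inner: "term_comp n (i + j - 1) (term_relabel (inner_label i) s) r
      = term_relabel (inner_label i) (term_comp n j s r)"
    unfolding term_comp_def term_comp_relabel_left term_relabel_subst
  proof (rule term_subst_cong)
    fix p assume "p \<in> set (term_vars s)"
    then have p: "p \<in> {1..m}" using assms(2) by (simp add: multilinear_terms_def)
    have "term_relabel (inner_label (i + j - 1)) r = term_relabel (inner_label i) (term_relabel (inner_label j) r)"
      unfolding term_relabel_relabel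
      by (rule term_relabel_cong) (use i j in \<open>auto simp: inner_label_def\<close>)
    then show "(if inner_label i p = i + j - 1 then term_relabel (inner_label (i + j - 1)) r
           else Var (outer_label n (i + j - 1) (inner_label i p)))
        = term_relabel (inner_label i) (if p = j then term_relabel (inner_label j) r else Var (outer_label n j p))"
      using p i j n by (auto simp: inner_label_def outer_label_def)
  qed
  show ?thesis
    unfolding term_comp_def[of m i] term_comp_def[of n "i + j - 1"] term_subst_subst term_comp_def[of "m + n - 1"]
  proof (rule term_subst_cong)
    fix k assume "k \<in> set (term_vars t)"
    then have k: "k \<in> {1..l}" using assms(1) by (simp add: multilinear_terms_def)
    show "term_subst (\<lambda>p. if p = i + j - 1 then term_relabel (inner_label (i + j - 1)) r else Var (outer_label n (i + j - 1) p))
         (if k = i then term_relabel (inner_label i) s else Var (outer_label m i k))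
        = (if k = i then term_relabel (inner_label i) (term_comp n j s r) else Var (outer_label (m + n - 1) i k))"
    proof (cases "k = i")
      case True
      then show ?thesis using inner by (simp add: term_comp_def[of n "i + j - 1"])
    next
      case False
      then have "outer_label m i k \<noteq> i + j - 1"
          "outer_label n (i + j - 1) (outer_label m i k) = outer_label (m + n - 1) i k"
        using i j n by (auto simp: outer_label_def)
      then show ?thesis using False by simp
    qed
  qed
qed

lemma term_comp_parallel:
  assumes "t \<in> multilinear_terms l" "s \<in> multilinear_terms m" "r \<in> multilinear_terms n"
    and i: "i \<in> {1..l}" and k: "k \<in> {1..l}" "i < k" and m: "m \<ge> 1" and n: "n \<ge> 1"
  shows "term_comp n (k + m - 1) (term_comp m i t s) r = term_comp m i (term_comp n k t r) s"
  unfolding term_comp_def term_subst_subst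
proof (rule term_subst_cong)
  fix p assume "p \<in> set (term_vars t)"
  then have p: "p \<in> {1..l}" using assms(1) by (simp add: multilinear_terms_def)
  have s: "term_subst (\<lambda>p. if p = k + m - 1 then term_relabel (inner_label (k + m - 1)) r else Var (outer_label n (k + m - 1) p))
      (term_relabel (inner_label i) s) = term_relabel (inner_label i) s"
    unfolding term_relabel_def term_subst_subst
    by (rule term_subst_cong)
      (use assms(2) i k m in \<open>auto simp: multilinear_terms_def inner_label_def outer_label_def\<close>)
  have r: "term_subst (\<lambda>p. if p = i then term_relabel (inner_label i) s else Var (outer_label m i p))
      (term_relabel (inner_label k) r) = term_relabel (inner_label (k + m - 1)) r"
    unfolding term_relabel_def term_subst_subst
    by (rule term_subst_cong)
      (use assms(3) i k m in \<open>auto simp: multilinear_terms_def inner_label_def outer_label_def\<close>)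
  consider "p = i" | "p = k" | "p \<noteq> i" "p \<noteq> k" by blast
  then show "term_subst (\<lambda>p. if p = k + m - 1 then term_relabel (inner_label (k + m - 1)) r else Var (outer_label n (k + m - 1) p))
        (if p = i then term_relabel (inner_label i) s else Var (outer_label m i p))
      = term_subst (\<lambda>p. if p = i then term_relabel (inner_label i) s else Var (outer_label m i p))
        (if p = k then term_relabel (inner_label k) r else Var (outer_label n k p))"
  proof cases
    case 1
    then show ?thesis using s k by (simp add: outer_label_def)
  next
    case 2
    then show ?thesis using r k by (simp add: outer_label_def)
  next
    case 3
    have "outer_label m i p \<noteq> k + m - 1" "outer_label n k p \<noteq> i"
      using 3 k m n i by (auto simp: outer_label_def)
    moreover have "outer_label n (k + m - 1) (outer_label m i p) = outer_label m i (outer_label n k p)"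
      using 3 k m n i by (auto simp: outer_label_def)
    ultimately show ?thesis using 3 by simp
  qed
qed

lemma term_comp_equivariant:
  assumes "t \<in> multilinear_terms n" "s \<in> multilinear_terms m" and i: "i \<in> {1..n}" and m: "m \<ge> 1"
    and \<sigma>: "\<sigma> permutes {1..n}"
  shows "term_comp m (\<sigma> i) (term_relabel \<sigma> t) (term_relabel \<tau> s)
    = term_relabel (comp_perm m i \<sigma> \<tau>) (term_comp m i t s)"
  unfolding term_comp_def term_comp_relabel_left term_relabel_subst
proof (rule term_subst_cong)
  fix k
  have "\<sigma> k = \<sigma> i \<longleftrightarrow> k = i" using permutes_inj[OF \<sigma>] by (auto dest: injD)
  moreover have "term_relabel (inner_label (\<sigma> i)) (term_relabel \<tau> s)
      = term_relabel (comp_perm m i \<sigma> \<tau>) (term_relabel (inner_label i) s)"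
    unfolding term_relabel_relabel
    by (rule term_relabel_cong) (use assms(2) i in \<open>auto simp: multilinear_terms_def comp_perm_inner\<close>)
  ultimately show "(if \<sigma> k = \<sigma> i then term_relabel (inner_label (\<sigma> i)) (term_relabel \<tau> s) else Var (outer_label m (\<sigma> i) (\<sigma> k)))
     = term_relabel (comp_perm m i \<sigma> \<tau>) (if k = i then term_relabel (inner_label i) s else Var (outer_label m i k))"
    using m by (simp add: comp_perm_outer)
qed

lemma free_magmatic_simps [simp]:
  "op_mod free_magmatic_operad n = free_module (multilinear_terms n)"
  "op_act free_magmatic_operad n \<sigma> = linear_ext (\<lambda>t. basis_elem (term_relabel \<sigma> t))"
  "op_unit free_magmatic_operad = basis_elem (Var 1)"
  "op_comp free_magmatic_operad n m i = bilinear_ext (\<lambda>t s. basis_elem (term_comp m i t s))"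
  by (simp_all add: free_magmatic_operad_def)

lemma keys_act:
  assumes "\<sigma> permutes {1..n}" "keys x \<subseteq> multilinear_terms n"
  shows "keys (linear_ext (\<lambda>t. basis_elem (term_relabel \<sigma> t)) x :: _ \<Rightarrow>\<^sub>0 'k::comm_ring_1) \<subseteq> multilinear_terms n"
  using relabel_monomials[of _ "{1..n}" \<sigma> "{1..n}"] permutes_imp_bij[OF assms(1)]
  by (intro keys_klinear[OF klinear_linear_ext assms(2)]) (simp add: multilinear_terms_eq)

lemma keys_comp:
  assumes "i \<in> {1..n}" "m \<ge> 1" "keys x \<subseteq> multilinear_terms n" "keys y \<subseteq> multilinear_terms m"
  shows "keys (bilinear_ext (\<lambda>t s. basis_elem (term_comp m i t s)) x y :: _ \<Rightarrow>\<^sub>0 'k::comm_ring_1)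
    \<subseteq> multilinear_terms (n + m - 1)"
  using assms by (intro keys_bilinear[OF assms(3,4)]) (simp add: term_comp_multilinear)

theorem operad_free_magmatic:
  "operad (ring_of_type_algebra :: 'k::comm_ring_1 ring) free_magmatic_operad"
proof (rule operad.intro, goal_cases)
  case (1 n)
  show ?case by (simp add: module_free_module)
next
  case (2 n \<sigma> x)
  then show ?case by (simp add: keys_act)
next
  case (3 n \<sigma> x y)
  show ?case by (simp add: klinear_add[OF klinear_linear_ext])
next
  case (4 n \<sigma> a x)
  show ?case by (simp add: klinear_scale[OF klinear_linear_ext])
next
  case (5 n x)
  then have "keys x \<subseteq> multilinear_terms n" by simp
  then show ?case unfolding free_magmatic_simps
    by (rule klinear_cong[OF klinear_linear_ext klinear_ident]) (simp add: term_relabel_def)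
next
  case (6 n \<sigma> \<tau> x)
  then have "keys x \<subseteq> multilinear_terms n" by simp
  then show ?case unfolding free_magmatic_simps
    by (rule klinear_cong[OF klinear_linear_ext klinear_lin[OF klinear_linear_ext]])
      (simp add: term_relabel_relabel o_def)
next
  case 7
  show ?case by (simp add: multilinear_terms_def)
next
  case (8 i n m x y)
  then show ?case by (simp add: keys_comp)
next
  case (9 i n m x x' y)
  show ?case by (simp add: klinear_add[OF klinear_bilinear_ext_left])
next
  case (10 i n m x y y')
  show ?case by (simp add: klinear_add[OF klinear_bilinear_ext_right])
next
  case (11 i n m a x y)
  show ?case by (simp add: klinear_scale[OF klinear_bilinear_ext_left])
next
  case (12 i n m a x y)
  show ?case by (simp add: klinear_scale[OF klinear_bilinear_ext_right])
next
  case (13 n x)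
  then have "keys x \<subseteq> multilinear_terms n" by simp
  then show ?case unfolding free_magmatic_simps
    by (rule klinear_cong[OF klinear_bilinear_ext_right klinear_ident]) (simp add: term_comp_unit_left)
next
  case (14 i n x)
  then have "keys x \<subseteq> multilinear_terms n" by simp
  then show ?case unfolding free_magmatic_simps
    by (rule klinear_cong[OF klinear_bilinear_ext_left klinear_ident]) (simp add: term_comp_unit_right)
next
  case (15 i l j m n x y z)
  then have k: "keys x \<subseteq> multilinear_terms l" "keys y \<subseteq> multilinear_terms m" "keys z \<subseteq> multilinear_terms n"
    by simp_all
  show ?case unfolding free_magmatic_simps
    by (rule trilinear_cong[OF _ _ _ _ _ _ k]) (intro klinear_intros, use 15 in \<open>simp add: term_comp_sequential\<close>)+
next
  case (16 i l k m n x y z)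
  then have k: "keys x \<subseteq> multilinear_terms l" "keys y \<subseteq> multilinear_terms m" "keys z \<subseteq> multilinear_terms n"
    by simp_all
  show ?case unfolding free_magmatic_simps
    by (rule trilinear_cong[OF _ _ _ _ _ _ k]) (intro klinear_intros, use 16 in \<open>simp add: term_comp_parallel\<close>)+
next
  case (17 i n m \<sigma> \<tau> x y)
  then have k: "keys x \<subseteq> multilinear_terms n" "keys y \<subseteq> multilinear_terms m"
    by simp_all
  show ?case unfolding free_magmatic_simps
    by (rule bilinear_cong[OF _ _ _ _ k]) (intro klinear_intros, use 17 in \<open>simp add: term_comp_equivariant\<close>)+
qed

section \<open>Rooted trees as sets of arcs\<close>

text \<open>
  A tree is given by its set of arcs (child, parent) and its root. The root is needed separately
  only for the tree without arcs.
\<close>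

type_synonym arcs = "(nat \<times> nat) set"

definition verts :: "arcs \<times> nat \<Rightarrow> nat set" where
  "verts T = insert (snd T) (Domain (fst T))"

text \<open>
  Every vertex other than the root has exactly one parent, and the path of ancestors of every
  vertex ends at the root. The condition on \<open>Range\<close> forces the parents to be vertices, because the
  root is the only element outside the domain that can reach the root.
\<close>

definition arc_tree :: "arcs \<times> nat \<Rightarrow> bool" where
  "arc_tree T \<longleftrightarrow> finite (fst T) \<and> single_valued (fst T) \<and> snd T \<notin> Domain (fst T) \<and>
     (\<forall>v \<in> verts T \<union> Range (fst T). (v, snd T) \<in> (fst T)\<^sup>*)"

definition children :: "arcs \<Rightarrow> nat \<Rightarrow> nat set" where
  "children A v = {c. (c, v) \<in> A}"

text \<open>
  \<open>graft T S v\<close> adds an arc from the root of \<open>S\<close> to the vertex \<open>v\<close> of \<open>T\<close>.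
\<close>

definition graft :: "arcs \<times> nat \<Rightarrow> arcs \<times> nat \<Rightarrow> nat \<Rightarrow> arcs \<times> nat" where
  "graft T S v = (insert (snd S, v) (fst T \<union> fst S), snd T)"

definition map_tree :: "(nat \<Rightarrow> nat) \<Rightarrow> arcs \<times> nat \<Rightarrow> arcs \<times> nat" where
  "map_tree \<rho> T = ((\<lambda>(u, v). (\<rho> u, \<rho> v)) ` fst T, \<rho> (snd T))"

text \<open>
  Substitution of \<open>S\<close> for the vertex \<open>i\<close> of \<open>T\<close>. A child \<open>u\<close> of \<open>i\<close> is attached to the vertex \<open>f u\<close> of \<open>S\<close>,
  the parent of \<open>i\<close> becomes the parent of the root of \<open>S\<close>, and the other vertices of \<open>T\<close> are relabelled
  by \<open>\<rho>\<close>. The labels of \<open>S\<close> are unchanged.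
\<close>

definition subst_tree :: "(nat \<Rightarrow> nat) \<Rightarrow> nat \<Rightarrow> (nat \<Rightarrow> nat) \<Rightarrow> arcs \<times> nat \<Rightarrow> arcs \<times> nat \<Rightarrow> arcs \<times> nat" where
  "subst_tree \<rho> i f T S =
     ((\<lambda>(u, v). (if u = i then snd S else \<rho> u, if v = i then f u else \<rho> v)) ` fst T \<union> fst S,
      if snd T = i then snd S else \<rho> (snd T))"

lemma finite_verts: "arc_tree T \<Longrightarrow> finite (verts T)"
  by (simp add: arc_tree_def verts_def finite_Domain)

lemma arc_in_verts:
  assumes "arc_tree T" "(u, v) \<in> fst T"
  shows "u \<in> verts T" "v \<in> verts T"
proof -
  show "u \<in> verts T" using assms by (auto simp: verts_def)
  have "(v, snd T) \<in> (fst T)\<^sup>*" using assms by (auto simp: arc_tree_def)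
  then show "v \<in> verts T" by (cases rule: converse_rtranclE) (auto simp: verts_def)
qed

lemma root_in_verts: "snd T \<in> verts T" by (simp add: verts_def)

lemma root_no_arc: "arc_tree T \<Longrightarrow> (snd T, v) \<notin> fst T"
  by (auto simp: arc_tree_def)

lemma arc_tree_single: "arc_tree ({}, r)" and verts_single [simp]: "verts ({}, r) = {r}"
  by (auto simp: arc_tree_def verts_def)

lemma verts_graft [simp]: "verts (graft T S v) = verts T \<union> verts S"
  by (auto simp: verts_def graft_def)

lemma verts_map_tree [simp]: "verts (map_tree \<rho> T) = \<rho> ` verts T"
  by (force simp: verts_def map_tree_def)

lemma verts_subst_tree:
  "i \<in> verts T \<Longrightarrow> verts (subst_tree \<rho> i f T S) = \<rho> ` (verts T - {i}) \<union> verts S"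
  unfolding verts_def subst_tree_def
  by (auto simp: Domain_iff image_iff split: if_splits) force+

lemma arc_tree_graft:
  assumes T: "arc_tree T" and S: "arc_tree S" and disj: "verts T \<inter> verts S = {}" and v: "v \<in> verts T"
  shows "arc_tree (graft T S v)"
proof -
  let ?A = "insert (snd S, v) (fst T \<union> fst S)"
  have root: "(u, snd T) \<in> ?A\<^sup>*" if "u \<in> verts T" for u
  proof -
    have "(u, snd T) \<in> (fst T)\<^sup>*" using T that by (auto simp: arc_tree_def)
    then show ?thesis by (rule rev_subsetD[OF _ rtrancl_mono]) auto
  qed
  have S_root: "(u, snd T) \<in> ?A\<^sup>*" if "u \<in> verts S" for u
  proof -
    have "(u, snd S) \<in> (fst S)\<^sup>*" using S that by (auto simp: arc_tree_def)
    then have "(u, snd S) \<in> ?A\<^sup>*" by (rule rev_subsetD[OF _ rtrancl_mono]) auto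
    also have "(snd S, v) \<in> ?A\<^sup>*" by auto
    also have "(v, snd T) \<in> ?A\<^sup>*" by (rule root[OF v])
    finally show ?thesis .
  qed
  have "single_valued ?A"
    using T S disj by (auto simp: single_valued_def arc_tree_def verts_def)
  moreover have "snd T \<notin> Domain ?A" 
    using T disj by (auto simp: arc_tree_def verts_def)
  moreover have "(u, snd T) \<in> ?A\<^sup>*" if "u \<in> verts (graft T S v) \<union> Range ?A" for u
    using that root S_root v arc_in_verts[OF T] arc_in_verts[OF S] by auto
  ultimately show ?thesis
    using T S by (simp add: arc_tree_def graft_def)
qed

section \<open>The trees of a monomial\<close>

text \<open>
  The sum of \<open>g\<close> over the trees in the expansion of a monomial, with multiplicity. To sum over the
  trees of \<open>s t\<close> is to sum over those of \<open>s\<close>, those of \<open>t\<close> and the places of grafting. Working with the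
  sum of an arbitrary \<open>g\<close> instead of the formal sum of trees lets one iterate such sums.
\<close>

primrec tree_sum :: "mag_term \<Rightarrow> (arcs \<times> nat \<Rightarrow> 'x::comm_monoid_add) \<Rightarrow> 'x" where
  "tree_sum (Var j) g = g ({}, j)"
| "tree_sum (Prod s t) g = tree_sum s (\<lambda>T. tree_sum t (\<lambda>S. \<Sum>v\<in>verts T. g (graft T S v)))"

text \<open>
  The trees of a multilinear monomial are trees on the set of its variables.
\<close>

lemma tree_sum_cong:
  assumes "distinct (term_vars t)"
    and "\<And>T. arc_tree T \<Longrightarrow> verts T = set (term_vars t) \<Longrightarrow> g T = g' T"
  shows "tree_sum t g = tree_sum t g'"
  using assms
proof (induction t arbitrary: g g')
  case (Var j)
  then show ?case by (simp add: arc_tree_single)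
next
  case (Prod s t)
  have "(\<Sum>v\<in>verts T. g (graft T S v)) = (\<Sum>v\<in>verts T. g' (graft T S v))"
    if "arc_tree T" "verts T = set (term_vars s)" "arc_tree S" "verts S = set (term_vars t)" for T S
    using Prod.prems(1) that by (intro sum.cong refl Prod.prems(2) arc_tree_graft) auto
  then show ?case
    using Prod.prems(1) by (auto intro!: Prod.IH)
qed

lemma tree_sum_0: "tree_sum t (\<lambda>T. 0) = 0"
  by (induction t) simp_all

lemma tree_sum_add: "tree_sum t (\<lambda>T. g T + h T) = tree_sum t g + tree_sum t h"
  by (induction t arbitrary: g h) (simp_all add: sum.distrib)

lemma tree_sum_sum: "tree_sum t (\<lambda>T. \<Sum>i\<in>I. g i T) = (\<Sum>i\<in>I. tree_sum t (g i))"
  by (induction I rule: infinite_finite_induct) (simp_all add: tree_sum_0 tree_sum_add)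

lemma tree_sum_swap:
  "tree_sum s (\<lambda>S. tree_sum t (\<lambda>T. g S T)) = tree_sum t (\<lambda>T. tree_sum s (\<lambda>S. g S T))"
  by (induction s arbitrary: g) (simp_all add: tree_sum_sum[symmetric])

lemma tree_sum_hom:
  assumes "h 0 = 0" "\<And>x y. h (x + y) = h x + h y"
  shows "h (tree_sum t g) = tree_sum t (\<lambda>T. h (g T))"
proof -
  have "h (sum f I) = (\<Sum>i\<in>I. h (f i))" for f and I :: "'c set"
    by (induction I rule: infinite_finite_induct) (simp_all add: assms)
  note h_sum = this
  show ?thesis
  proof (induction t arbitrary: g)
    case (Prod s t)
    show ?case by (simp add: Prod) (simp add: h_sum)
  qed simp
qed

lemma tree_sum_relabel:
  "inj_on \<rho> (set (term_vars t)) \<Longrightarrow> distinct (term_vars t)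
    \<Longrightarrow> tree_sum (term_subst (\<lambda>j. Var (\<rho> j)) t) g = tree_sum t (\<lambda>T. g (map_tree \<rho> T))"
proof (induction t arbitrary: g)
  case (Var j)
  show ?case by (simp add: map_tree_def)
next
  case (Prod s t)
  have inj: "inj_on \<rho> (set (term_vars s))" "inj_on \<rho> (set (term_vars t))"
    using Prod.prems(1) by (auto intro: inj_on_subset)
  have dist: "distinct (term_vars s)" "distinct (term_vars t)" using Prod.prems by auto
  have "(\<Sum>v\<in>verts (map_tree \<rho> T). g (graft (map_tree \<rho> T) (map_tree \<rho> S) v))
     = (\<Sum>v\<in>verts T. g (map_tree \<rho> (graft T S v)))" if "verts T = set (term_vars s)" for T S
    using inj that by (simp add: sum.reindex) (simp add: map_tree_def graft_def image_Un)
  note core = this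
  have "tree_sum (term_subst (\<lambda>j. Var (\<rho> j)) (Prod s t)) g = tree_sum s (\<lambda>T. tree_sum t (\<lambda>S.
      \<Sum>v\<in>verts (map_tree \<rho> T). g (graft (map_tree \<rho> T) (map_tree \<rho> S) v)))"
    by (simp add: Prod.IH inj dist)
  also have "\<dots> = tree_sum s (\<lambda>T. tree_sum t (\<lambda>S. \<Sum>v\<in>verts T. g (map_tree \<rho> (graft T S v))))"
    by (intro tree_sum_cong dist core)
  finally show ?case by simp
qed

text \<open>
  When \<open>S\<close> is substituted for the vertex on which another tree was grafted, the grafted root is an
  additional child, and its image under the attaching map is a place for grafting on \<open>S\<close>.
\<close>

lemma sum_PiE_insert:
  assumes "c \<notin> C"
  shows "(\<Sum>f\<in>insert c C \<rightarrow>\<^sub>E V. F f) = (\<Sum>w\<in>V. \<Sum>f\<in>C \<rightarrow>\<^sub>E V. F (f(c := w)))"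
proof -
  have "(\<Sum>f\<in>insert c C \<rightarrow>\<^sub>E V. F f) = (\<Sum>(w, f)\<in>V \<times> (C \<rightarrow>\<^sub>E V). F (f(c := w)))"
    unfolding PiE_insert_eq
    by (subst sum.reindex[OF inj_combinator[OF assms]]) (simp add: case_prod_unfold)
  then show ?thesis by (simp add: sum.cartesian_product)
qed

lemma children_graft:
  assumes "arc_tree T" "arc_tree S" "verts T \<inter> verts S = {}" "v \<in> verts T"
  shows "children (fst (graft T S v)) i = 
    (if i \<in> verts S then children (fst S) i
     else if i = v then insert (snd S) (children (fst T) i) else children (fst T) i)"
  using assms(3,4) arc_in_verts[OF assms(1)] arc_in_verts[OF assms(2)]
  by (auto simp: children_def graft_def disjoint_iff)

text \<open>
  A grafting commutes with the substitution for a vertex \<open>i\<close>. There are three cases: \<open>i\<close> is a vertex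
  of the lower tree but not the place of grafting, \<open>i\<close> is the place of grafting, or \<open>i\<close> is a vertex
  of the grafted tree.
\<close>

lemma subst_graft_left:
  assumes "arc_tree T" "arc_tree T2" "verts T \<inter> verts T2 = {}" "v \<in> verts T" "v \<noteq> i" "i \<in> verts T"
  shows "subst_tree \<rho> i f (graft T T2 v) S = graft (subst_tree \<rho> i f T S) (map_tree \<rho> T2) (\<rho> v)"
proof -
  have "u \<noteq> i \<and> w \<noteq> i" if "(u, w) \<in> fst T2" for u w
    using arc_in_verts[OF assms(2) that] assms by auto
  then have "(\<lambda>(u, v). (if u = i then snd S else \<rho> u, if v = i then f u else \<rho> v)) ` fst T2
      = (\<lambda>(u, v). (\<rho> u, \<rho> v)) ` fst T2"
    by (intro image_cong) auto
  moreover have "snd T2 \<noteq> i" using root_in_verts[of T2] assms by auto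
  ultimately show ?thesis
    using assms by (simp add: subst_tree_def graft_def map_tree_def image_Un) blast
qed

lemma subst_graft_at:
  assumes "arc_tree T" "arc_tree T2" "verts T \<inter> verts T2 = {}" "i \<in> verts T"
  shows "subst_tree \<rho> i (f(snd T2 := w)) (graft T T2 i) S = graft (subst_tree \<rho> i f T S) (map_tree \<rho> T2) w"
proof -
  have "u \<noteq> i \<and> w \<noteq> i" if "(u, w) \<in> fst T2" for u w
    using arc_in_verts[OF assms(2) that] assms by auto
  then have "(\<lambda>(u, v). (if u = i then snd S else \<rho> u, if v = i then (f(snd T2 := w)) u else \<rho> v)) ` fst T2
      = (\<lambda>(u, v). (\<rho> u, \<rho> v)) ` fst T2"
    by (intro image_cong) auto
  moreover have "u \<noteq> snd T2" if "(u, v) \<in> fst T" for u v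
    using arc_in_verts[OF assms(1) that] root_in_verts[of T2] assms by auto
  then have "(\<lambda>(u, v). (if u = i then snd S else \<rho> u, if v = i then (f(snd T2 := w)) u else \<rho> v)) ` fst T
      = (\<lambda>(u, v). (if u = i then snd S else \<rho> u, if v = i then f u else \<rho> v)) ` fst T"
    by (intro image_cong) auto
  moreover have "snd T2 \<noteq> i" using root_in_verts[of T2] assms by auto
  ultimately show ?thesis
    using assms by (simp add: subst_tree_def graft_def map_tree_def image_Un) blast
qed

lemma subst_graft_right:
  assumes "arc_tree T" "arc_tree T2" "verts T \<inter> verts T2 = {}" "v \<in> verts T" "i \<in> verts T2"
  shows "subst_tree \<rho> i f (graft T T2 v) S = graft (map_tree \<rho> T) (subst_tree \<rho> i f T2 S) (\<rho> v)"
proof -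
  have "u \<noteq> i \<and> w \<noteq> i" if "(u, w) \<in> fst T" for u w
    using arc_in_verts[OF assms(1) that] assms by auto
  then have "(\<lambda>(u, v). (if u = i then snd S else \<rho> u, if v = i then f u else \<rho> v)) ` fst T
      = (\<lambda>(u, v). (\<rho> u, \<rho> v)) ` fst T"
    by (intro image_cong) auto
  moreover have "snd T \<noteq> i" using root_in_verts[of T] assms by auto
  moreover have "v \<noteq> i" using assms by auto
  ultimately show ?thesis
    by (simp add: subst_tree_def graft_def map_tree_def image_Un Un_assoc)
qed

text \<open>Substituting a monomial for a variable substitutes its trees for the corresponding vertex.\<close>

lemma tree_sum_subst:
  assumes "distinct (term_vars t)" "i \<in> set (term_vars t)" "distinct (term_vars s)"
    and "inj_on \<rho> (set (term_vars t) - {i})" "\<rho> ` (set (term_vars t) - {i}) \<inter> set (term_vars s) = {}"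
  shows "tree_sum (term_subst (\<lambda>j. if j = i then s else Var (\<rho> j)) t) g =
    tree_sum t (\<lambda>T. tree_sum s (\<lambda>S. \<Sum>f\<in>children (fst T) i \<rightarrow>\<^sub>E verts S. g (subst_tree \<rho> i f T S)))"
  using assms(1,2,4,5)
proof (induction t arbitrary: g)
  case (Var j)
  then show ?case by (simp add: children_def PiE_empty_domain subst_tree_def)
next
  case (Prod t1 t2)
  let ?\<theta> = "\<lambda>j. if j = i then s else Var (\<rho> j)"
  let ?V1 = "set (term_vars t1)" and ?V2 = "set (term_vars t2)" and ?W = "set (term_vars s)"
  have dist: "distinct (term_vars t1)" "distinct (term_vars t2)" "?V1 \<inter> ?V2 = {}"
    using Prod.prems by auto
  have other: "tree_sum (term_subst ?\<theta> t) g = tree_sum t (\<lambda>T. g (map_tree \<rho> T))"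
    if "i \<notin> set (term_vars t)" "distinct (term_vars t)" "inj_on \<rho> (set (term_vars t))"
    for t and g :: "arcs \<times> nat \<Rightarrow> 'a"
  proof -
    have "term_subst ?\<theta> t = term_subst (\<lambda>j. Var (\<rho> j)) t"
      using that(1) by (induction t) auto
    then show ?thesis using tree_sum_relabel[OF that(3,2)] by simp
  qed
  show ?case
  proof (cases "i \<in> ?V1")
    case True
    then have i2: "i \<notin> ?V2" using dist by auto
    have inj: "inj_on \<rho> (?V1 - {i})" "inj_on \<rho> ?V2" "\<rho> ` (?V1 - {i}) \<inter> ?W = {}"
      using Prod.prems(3,4) i2 by (auto intro: inj_on_subset)
    have core: "(\<Sum>f\<in>children (fst T) i \<rightarrow>\<^sub>E verts S.
          \<Sum>v\<in>verts (subst_tree \<rho> i f T S). g (graft (subst_tree \<rho> i f T S) (map_tree \<rho> T2) v))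
      = (\<Sum>v\<in>verts T. \<Sum>f\<in>children (fst (graft T T2 v)) i \<rightarrow>\<^sub>E verts S. g (subst_tree \<rho> i f (graft T T2 v) S))"
      (is "?L = ?R")
      if T: "arc_tree T" "verts T = ?V1" "arc_tree T2" "verts T2 = ?V2" "arc_tree S" "verts S = ?W" for T T2 S
    proof -
      have disj: "verts T \<inter> verts T2 = {}" and i: "i \<in> verts T" "i \<notin> verts T2"
        using T dist True i2 by auto
      have r2: "snd T2 \<notin> children (fst T) i"
        using arc_in_verts[OF T(1)] root_in_verts[of T2] disj by (auto simp: children_def disjoint_iff)
      have fin: "finite (verts T)" "finite (verts S)" using T finite_verts by auto
      have "?R = (\<Sum>f\<in>insert (snd T2) (children (fst T) i) \<rightarrow>\<^sub>E verts S. g (subst_tree \<rho> i f (graft T T2 i) S))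
         + (\<Sum>v\<in>verts T - {i}. \<Sum>f\<in>children (fst T) i \<rightarrow>\<^sub>E verts S. g (subst_tree \<rho> i f (graft T T2 v) S))"
        using i disj T(1,3) fin by (subst sum.remove[of _ i]) (auto simp: children_graft intro!: sum.cong)
      also have "(\<Sum>f\<in>insert (snd T2) (children (fst T) i) \<rightarrow>\<^sub>E verts S. g (subst_tree \<rho> i f (graft T T2 i) S))
         = (\<Sum>w\<in>verts S. \<Sum>f\<in>children (fst T) i \<rightarrow>\<^sub>E verts S. g (graft (subst_tree \<rho> i f T S) (map_tree \<rho> T2) w))"
        unfolding sum_PiE_insert[OF r2] using T disj i by (simp add: subst_graft_at)
      also have "(\<Sum>v\<in>verts T - {i}. \<Sum>f\<in>children (fst T) i \<rightarrow>\<^sub>E verts S. g (subst_tree \<rho> i f (graft T T2 v) S))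
         = (\<Sum>v\<in>verts T - {i}. \<Sum>f\<in>children (fst T) i \<rightarrow>\<^sub>E verts S. g (graft (subst_tree \<rho> i f T S) (map_tree \<rho> T2) (\<rho> v)))"
        using T disj i by (intro sum.cong refl) (simp add: subst_graft_left)
      also have "\<dots> = (\<Sum>v\<in>\<rho> ` (verts T - {i}). \<Sum>f\<in>children (fst T) i \<rightarrow>\<^sub>E verts S. g (graft (subst_tree \<rho> i f T S) (map_tree \<rho> T2) v))"
        using inj T by (simp add: sum.reindex)
      also have "(\<Sum>w\<in>verts S. \<Sum>f\<in>children (fst T) i \<rightarrow>\<^sub>E verts S. g (graft (subst_tree \<rho> i f T S) (map_tree \<rho> T2) w)) + \<dots>
         = (\<Sum>v\<in>\<rho> ` (verts T - {i}) \<union> verts S. \<Sum>f\<in>children (fst T) i \<rightarrow>\<^sub>E verts S. g (graft (subst_tree \<rho> i f T S) (map_tree \<rho> T2) v))"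
        using fin inj T by (subst sum.union_disjoint) (auto simp: add.commute)
      also have "\<dots> = ?L" by (subst sum.swap) (simp add: verts_subst_tree i)
      finally show ?thesis by simp
    qed
    have "tree_sum (term_subst ?\<theta> (Prod t1 t2)) g
       = tree_sum t1 (\<lambda>T. tree_sum s (\<lambda>S. \<Sum>f\<in>children (fst T) i \<rightarrow>\<^sub>E verts S. tree_sum t2 (\<lambda>T2.
          \<Sum>v\<in>verts (subst_tree \<rho> i f T S). g (graft (subst_tree \<rho> i f T S) (map_tree \<rho> T2) v))))"
      using Prod.IH(1)[OF dist(1) True inj(1,3)] other[OF i2 dist(2) inj(2)] by simp
    also have "\<dots> = tree_sum t1 (\<lambda>T. tree_sum t2 (\<lambda>T2. tree_sum s (\<lambda>S. \<Sum>f\<in>children (fst T) i \<rightarrow>\<^sub>E verts S. 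
          \<Sum>v\<in>verts (subst_tree \<rho> i f T S). g (graft (subst_tree \<rho> i f T S) (map_tree \<rho> T2) v))))"
      by (simp only: tree_sum_sum[symmetric] tree_sum_swap[of s t2])
    also have "\<dots> = tree_sum t1 (\<lambda>T. tree_sum t2 (\<lambda>T2. tree_sum s (\<lambda>S. 
        \<Sum>v\<in>verts T. \<Sum>f\<in>children (fst (graft T T2 v)) i \<rightarrow>\<^sub>E verts S. g (subst_tree \<rho> i f (graft T T2 v) S))))"
      by (intro tree_sum_cong dist assms(3) core) auto
    also have "\<dots> = tree_sum (Prod t1 t2) (\<lambda>T. tree_sum s (\<lambda>S. \<Sum>f\<in>children (fst T) i \<rightarrow>\<^sub>E verts S. g (subst_tree \<rho> i f T S)))"
      by (simp add: tree_sum_sum)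
    finally show ?thesis .
  next
    case False
    then have i2: "i \<in> ?V2" using Prod.prems by auto
    have inj: "inj_on \<rho> ?V1" "inj_on \<rho> (?V2 - {i})" "\<rho> ` (?V2 - {i}) \<inter> ?W = {}"
      using Prod.prems(3,4) False by (auto intro: inj_on_subset)
    have core: "(\<Sum>f\<in>children (fst T2) i \<rightarrow>\<^sub>E verts S.
          \<Sum>v\<in>verts (map_tree \<rho> T). g (graft (map_tree \<rho> T) (subst_tree \<rho> i f T2 S) v))
      = (\<Sum>v\<in>verts T. \<Sum>f\<in>children (fst (graft T T2 v)) i \<rightarrow>\<^sub>E verts S. g (subst_tree \<rho> i f (graft T T2 v) S))"
      (is "?L = ?R")
      if T: "arc_tree T" "verts T = ?V1" "arc_tree T2" "verts T2 = ?V2" "arc_tree S" "verts S = ?W" for T T2 S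
    proof -
      have disj: "verts T \<inter> verts T2 = {}" and i: "i \<in> verts T2"
        using T dist i2 by auto
      have "?R = (\<Sum>v\<in>verts T. \<Sum>f\<in>children (fst T2) i \<rightarrow>\<^sub>E verts S. g (graft (map_tree \<rho> T) (subst_tree \<rho> i f T2 S) (\<rho> v)))"
        using T disj i by (intro sum.cong refl) (simp_all add: children_graft subst_graft_right)
      also have "\<dots> = ?L" 
        using inj T by (subst sum.swap) (simp add: sum.reindex)
      finally show ?thesis by simp
    qed
    have "tree_sum (term_subst ?\<theta> (Prod t1 t2)) g
       = tree_sum t1 (\<lambda>T. tree_sum t2 (\<lambda>T2. tree_sum s (\<lambda>S. \<Sum>f\<in>children (fst T2) i \<rightarrow>\<^sub>E verts S.
          \<Sum>v\<in>verts (map_tree \<rho> T). g (graft (map_tree \<rho> T) (subst_tree \<rho> i f T2 S) v))))"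
      using Prod.IH(2)[OF dist(2) i2 inj(2,3)] other[OF False dist(1) inj(1)] by simp
    also have "\<dots> = tree_sum t1 (\<lambda>T. tree_sum t2 (\<lambda>T2. tree_sum s (\<lambda>S. 
        \<Sum>v\<in>verts T. \<Sum>f\<in>children (fst (graft T T2 v)) i \<rightarrow>\<^sub>E verts S. g (subst_tree \<rho> i f (graft T T2 v) S))))"
      by (intro tree_sum_cong dist assms(3) core) auto
    also have "\<dots> = tree_sum (Prod t1 t2) (\<lambda>T. tree_sum s (\<lambda>S. \<Sum>f\<in>children (fst T) i \<rightarrow>\<^sub>E verts S. g (subst_tree \<rho> i f T S)))"
      by (simp add: tree_sum_sum)
    finally show ?thesis .
  qed
qed

section \<open>Symmetric braces in a pre-Lie algebra\<close>

text \<open>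
  A right pre-Lie algebra; only the additive structure matters for braces.
\<close>

locale pre_Lie_algebra =
  fixes mul :: "'l::ab_group_add \<Rightarrow> 'l \<Rightarrow> 'l"  (infixl "\<star>" 70)
  assumes mul_add_left: "(x + y) \<star> z = x \<star> z + y \<star> z"
    and mul_add_right: "z \<star> (x + y) = z \<star> x + z \<star> y"
    and pre_Lie: "(x \<star> y) \<star> z - x \<star> (y \<star> z) = (x \<star> z) \<star> y - x \<star> (z \<star> y)"
begin

lemma mul_0_left: "0 \<star> z = 0" using mul_add_left[of 0 0 z] by simp
lemma mul_0_right: "z \<star> 0 = 0" using mul_add_right[of z 0 0] by simp
lemma mul_minus_left: "(- x) \<star> z = - (x \<star> z)"
  using mul_add_left[of "- x" x z] by (simp add: mul_0_left eq_neg_iff_add_eq_0)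
lemma mul_diff_left: "(x - y) \<star> z = x \<star> z - y \<star> z"
  using mul_add_left[of x "- y" z] by (simp add: mul_minus_left)
lemma mul_sum_left: "(\<Sum>i\<in>I. f i) \<star> z = (\<Sum>i\<in>I. f i \<star> z)"
  by (induction I rule: infinite_finite_induct) (simp_all add: mul_0_left mul_add_left)

text \<open>
  The brace of \<open>x\<close> with the family \<open>y\<close> of elements indexed by the entries of a list without repetitions.
  In the recursion the brace without the first entry \<open>c\<close> is multiplied by \<open>y c\<close>, and the braces in
  which one of the other arguments is multiplied by \<open>y c\<close> are subtracted.
\<close>

primrec list_brace :: "'l \<Rightarrow> 'i list \<Rightarrow> ('i \<Rightarrow> 'l) \<Rightarrow> 'l" where
  "list_brace x [] = (\<lambda>y. x)"
| "list_brace x (c # cs) = (\<lambda>y. list_brace x cs y \<star> y c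
     - (\<Sum>d\<in>set cs. list_brace x cs (y(d := y d \<star> y c))))"

lemma list_brace_Cons: "list_brace x (c # cs) y = list_brace x cs y \<star> y c
     - (\<Sum>d\<in>set cs. list_brace x cs (y(d := y d \<star> y c)))"
  by simp

declare list_brace.simps(2) [simp del] list_brace_Cons [simp]

lemma list_brace_cong: "(\<And>c. c \<in> set cs \<Longrightarrow> y c = z c) \<Longrightarrow> list_brace x cs y = list_brace x cs z"
proof (induction cs arbitrary: y z)
  case (Cons c cs)
  have 1: "list_brace x cs y = list_brace x cs z" by (rule Cons.IH) (simp add: Cons.prems)
  have 2: "list_brace x cs (y(d := y d \<star> y c)) = list_brace x cs (z(d := z d \<star> z c))" if "d \<in> set cs" for d
    by (rule Cons.IH) (use that Cons.prems in auto)
  have 3: "y c = z c" by (simp add: Cons.prems)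
  show ?case using 1 2 by (simp add: 3)
qed simp

lemma list_brace_upd_other: "d \<notin> set cs \<Longrightarrow> list_brace x cs (y(d := u)) = list_brace x cs y"
  by (rule list_brace_cong) auto

lemma list_brace_add:
  "\<lbrakk>distinct cs; d \<in> set cs\<rbrakk> \<Longrightarrow>
    list_brace x cs (y(d := u + v)) = list_brace x cs (y(d := u)) + list_brace x cs (y(d := v))"
proof (induction cs arbitrary: y u v d)
  case (Cons c cs)
  have IH: "list_brace x cs (y(d := u + v)) = list_brace x cs (y(d := u)) + list_brace x cs (y(d := v))"
    if "distinct cs" "d \<in> set cs" for d y u v
    by (rule Cons.IH[OF that])
  show ?case
  proof (cases "d = c")
    case True
    then have d: "d \<notin> set cs" using Cons.prems by simp
    have "list_brace x cs ((y(d := w))(e := z)) = list_brace x cs (y(e := z))" if "e \<in> set cs" for e w z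
      by (rule list_brace_cong) (use d that in auto)
    moreover have "list_brace x cs (y(e := y e \<star> (u + v)))
        = list_brace x cs (y(e := y e \<star> u)) + list_brace x cs (y(e := y e \<star> v))" if "e \<in> set cs" for e
    proof -
      have "distinct cs" using Cons.prems by simp
      from IH[OF this that, of y "y e \<star> u" "y e \<star> v"] show ?thesis
        by (simp only: mul_add_right)
    qed
    moreover have "e \<noteq> c" if "e \<in> set cs" for e using that Cons.prems by auto
    ultimately show ?thesis using d True
      by (simp add: list_brace_upd_other mul_add_right sum.distrib fun_upd_same fun_upd_other
          del: fun_upd_apply cong: sum.cong_simp)
  next
    case False
    then have d: "d \<in> set cs" "distinct cs" "c \<notin> set cs" using Cons.prems by auto
    have e: "list_brace x cs ((y(d := u + v))(e := (y(d := u + v)) e \<star> y c))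
      = list_brace x cs ((y(d := u))(e := (y(d := u)) e \<star> y c))
        + list_brace x cs ((y(d := v))(e := (y(d := v)) e \<star> y c))" if "e \<in> set cs" for e
    proof (cases "e = d")
      case True
      then show ?thesis using IH[of d y "u \<star> y c" "v \<star> y c"] d by (simp add: mul_add_left)
    next
      case False
      then show ?thesis using IH[of d "y(e := y e \<star> y c)" u v] d by (simp add: fun_upd_twist)
    qed
    show ?thesis using IH[of d y u v] d False
      by (simp add: e mul_add_left sum.distrib algebra_simps fun_upd_other del: fun_upd_apply)
  qed
qed simp

text \<open>
  Expanding two steps of the recursion for \<open>a\<close> and \<open>b\<close>, the pre-Lie identity is needed for the
  products of \<open>x{\<dots>}\<close>, and for those of each argument, with \<open>y a\<close> and \<open>y b\<close>. The remaining terms,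
  where \<open>y a\<close> and \<open>y b\<close> multiply different factors, are visibly symmetric.
\<close>

lemma list_brace_swap:
  assumes "distinct (a # b # cs)"
  shows "list_brace x (a # b # cs) y = list_brace x (b # a # cs) y"
proof -
  have expand: "list_brace x (a # b # cs) y =
      (list_brace x cs y \<star> y b) \<star> y a - list_brace x cs y \<star> (y b \<star> y a)
      - (\<Sum>d\<in>set cs. list_brace x cs (y(d := y d \<star> y b)) \<star> y a)
      - (\<Sum>d\<in>set cs. list_brace x cs (y(d := y d \<star> y a)) \<star> y b)
      + (\<Sum>d\<in>set cs. list_brace x cs (y(d := y d \<star> (y b \<star> y a) + (y d \<star> y a) \<star> y b)))
      + (\<Sum>d\<in>set cs. \<Sum>e\<in>set cs - {d}. list_brace x cs (y(d := y d \<star> y a, e := y e \<star> y b)))"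
    if "distinct (a # b # cs)" for a b
  proof -
    have ab: "a \<noteq> b" "a \<notin> set cs" "b \<notin> set cs" "distinct cs" using that by auto
    have 1: "list_brace x (b # cs) (y(b := y b \<star> y a)) = list_brace x cs y \<star> (y b \<star> y a)
       - (\<Sum>d\<in>set cs. list_brace x cs (y(d := y d \<star> (y b \<star> y a))))"
    proof -
      have "list_brace x cs ((y(b := y b \<star> y a))(d := (y(b := y b \<star> y a)) d \<star> (y b \<star> y a)))
          = list_brace x cs (y(d := y d \<star> (y b \<star> y a)))" if "d \<in> set cs" for d
        by (rule list_brace_cong) (use ab that in auto)
      then show ?thesis using ab by (simp add: list_brace_upd_other)
    qed
    have 2: "list_brace x (b # cs) (y(d := y d \<star> y a)) = list_brace x cs (y(d := y d \<star> y a)) \<star> y b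
       - list_brace x cs (y(d := (y d \<star> y a) \<star> y b))
       - (\<Sum>e\<in>set cs - {d}. list_brace x cs (y(d := y d \<star> y a, e := y e \<star> y b)))"
      if d: "d \<in> set cs" for d
    proof -
      have "b \<noteq> d" using d ab by auto
      then show ?thesis using d by (simp add: sum.remove[of "set cs" d] cong: sum.cong_simp)
    qed
    have 3: "(\<Sum>d\<in>set cs. list_brace x cs (y(d := y d \<star> (y b \<star> y a) + (y d \<star> y a) \<star> y b))) =
        (\<Sum>d\<in>set cs. list_brace x cs (y(d := y d \<star> (y b \<star> y a))))
        + (\<Sum>d\<in>set cs. list_brace x cs (y(d := (y d \<star> y a) \<star> y b)))"
      by (simp only: sum.distrib[symmetric]) (intro sum.cong refl list_brace_add ab(4))
    have "list_brace x (a # b # cs) y = list_brace x (b # cs) y \<star> y a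
      - list_brace x (b # cs) (y(b := y b \<star> y a))
      - (\<Sum>d\<in>set cs. list_brace x (b # cs) (y(d := y d \<star> y a)))"
      using ab by simp
    also have "(\<Sum>d\<in>set cs. list_brace x (b # cs) (y(d := y d \<star> y a))) =
       (\<Sum>d\<in>set cs. list_brace x cs (y(d := y d \<star> y a)) \<star> y b)
       - (\<Sum>d\<in>set cs. list_brace x cs (y(d := (y d \<star> y a) \<star> y b)))
       - (\<Sum>d\<in>set cs. \<Sum>e\<in>set cs - {d}. list_brace x cs (y(d := y d \<star> y a, e := y e \<star> y b)))"
      by (simp only: sum_subtractf[symmetric]) (intro sum.cong refl 2)
    also have "list_brace x (b # cs) y \<star> y a = (list_brace x cs y \<star> y b) \<star> y a
       - (\<Sum>d\<in>set cs. list_brace x cs (y(d := y d \<star> y b)) \<star> y a)"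
      by (simp add: mul_diff_left mul_sum_left)
    finally show ?thesis
      by (simp only: 1 3) (simp add: algebra_simps del: fun_upd_apply)
  qed
  have sym: "(\<Sum>d\<in>set cs. \<Sum>e\<in>set cs - {d}. list_brace x cs (y(d := y d \<star> y a, e := y e \<star> y b)))
    = (\<Sum>d\<in>set cs. \<Sum>e\<in>set cs - {d}. list_brace x cs (y(d := y d \<star> y b, e := y e \<star> y a)))"
  proof -
    have "(\<Sum>d\<in>set cs. \<Sum>e\<in>set cs - {d}. list_brace x cs (y(d := y d \<star> y a, e := y e \<star> y b)))
      = (\<Sum>d\<in>set cs. \<Sum>e | e \<in> set cs \<and> e \<noteq> d. list_brace x cs (y(d := y d \<star> y a, e := y e \<star> y b)))"
      by (intro sum.cong) auto
    also have "\<dots> = (\<Sum>e\<in>set cs. \<Sum>d | d \<in> set cs \<and> e \<noteq> d. list_brace x cs (y(d := y d \<star> y a, e := y e \<star> y b)))"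
      by (rule sum.swap_restrict) auto
    also have "\<dots> = (\<Sum>d\<in>set cs. \<Sum>e\<in>set cs - {d}. list_brace x cs (y(d := y d \<star> y b, e := y e \<star> y a)))"
      by (intro sum.cong) (auto simp: fun_upd_twist)
    finally show ?thesis .
  qed
  have inner: "y d \<star> (y b \<star> y a) + (y d \<star> y a) \<star> y b = y d \<star> (y a \<star> y b) + (y d \<star> y b) \<star> y a" for d
    using pre_Lie[of "y d" "y a" "y b"] by (simp add: algebra_simps)
  have outer: "(list_brace x cs y \<star> y b) \<star> y a - list_brace x cs y \<star> (y b \<star> y a)
      = (list_brace x cs y \<star> y a) \<star> y b - list_brace x cs y \<star> (y a \<star> y b)"
    by (rule pre_Lie)
  have "distinct (b # a # cs)" using assms by auto
  then show ?thesis
    unfolding expand[OF assms] expand[OF \<open>distinct (b # a # cs)\<close>] outer inner sym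
    by (simp only: cancel_ab_semigroup_add_class.diff_right_commute)
qed

text \<open>The brace does not depend on the order in which its arguments are inserted.\<close>

lemma list_brace_order:
  "\<lbrakk>distinct as; distinct bs; set as = set bs\<rbrakk> \<Longrightarrow> list_brace x as y = list_brace x bs y"
proof (induction "length as" arbitrary: as bs y rule: less_induct)
  case less
  show ?case
  proof (cases as)
    case Nil
    then show ?thesis using less.prems by simp
  next
    case (Cons a as')
    with less.prems obtain b bs' where bs: "bs = b # bs'" by (cases bs) auto
    have same: "list_brace x (c # cs) y = list_brace x (c # cs') y"
      if "length cs < length as" "distinct cs" "distinct cs'" "set cs = set cs'" for c cs cs'
      using less.hyps[OF that] that(4) by simp
    have "length bs = length as" using less.prems by (metis distinct_card)
    then have len: "length bs' < length as" "length as' < length as" using bs Cons by auto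
    show ?thesis
    proof (cases "a = b")
      case True
      then have "distinct as'" "distinct bs'" "set as' = set bs'" using less.prems bs Cons by auto
      then show ?thesis using same[OF len(2), of bs' a] True bs Cons by simp
    next
      case False
      define cs where "cs = remove1 b as'"
      have b: "b \<in> set as'" using less.prems bs Cons False by auto
      have cs: "distinct cs" "set cs = set as' - {b}" "a \<notin> set cs" "b \<notin> set cs"
        using less.prems Cons by (auto simp: cs_def)
      have "list_brace x as y = list_brace x (a # b # cs) y"
        unfolding Cons by (rule same[OF len(2)]) (use less.prems Cons cs b in auto)
      also have "\<dots> = list_brace x (b # a # cs) y"
        by (rule list_brace_swap) (use cs False in auto)
      also have "\<dots> = list_brace x bs y"
        unfolding bs by (rule same[OF _ _ _ , symmetric]) (use len less.prems Cons bs cs b False in auto)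
      finally show ?thesis .
    qed
  qed
qed

text \<open>
  The brace of a finite family, for any enumeration of its index set.
\<close>

definition brace :: "'l \<Rightarrow> 'i set \<Rightarrow> ('i \<Rightarrow> 'l) \<Rightarrow> 'l" where
  "brace x C y = list_brace x (SOME cs. distinct cs \<and> set cs = C) y"

lemma brace_list: "\<lbrakk>distinct cs; set cs = C\<rbrakk> \<Longrightarrow> brace x C y = list_brace x cs y"
  unfolding brace_def using someI[of "\<lambda>cs. distinct cs \<and> set cs = C" cs]
  by (intro list_brace_order) auto

lemma brace_cong: "\<lbrakk>finite C; \<And>c. c \<in> C \<Longrightarrow> y c = z c\<rbrakk> \<Longrightarrow> brace x C y = brace x C z"
  using finite_distinct_list[of C] by (metis brace_list list_brace_cong)

lemma brace_empty: "brace x {} y = x"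
  by (simp add: brace_list[of "[]"])

lemma brace_mul:
  assumes "finite C" "c \<notin> C"
  shows "brace x C y \<star> u = brace x (insert c C) (y(c := u)) + (\<Sum>d\<in>C. brace x C (y(d := y d \<star> u)))"
proof -
  obtain cs where cs: "distinct cs" "set cs = C" using finite_distinct_list[OF assms(1)] by blast
  have "list_brace x cs ((y(c := u))(d := (y(c := u)) d \<star> u)) = brace x C (y(d := y d \<star> u))" if "d \<in> C" for d
    unfolding brace_list[OF cs] by (rule list_brace_cong) (use assms that cs in auto)
  then show ?thesis
    using assms cs brace_list[of "c # cs" "insert c C"] by (simp add: brace_list[OF cs] list_brace_upd_other)
qed

lemma brace_add:
  assumes "finite C" "d \<in> C"
  shows "brace x C (y(d := u + v)) = brace x C (y(d := u)) + brace x C (y(d := v))"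
proof -
  obtain cs where cs: "distinct cs" "set cs = C" using finite_distinct_list[OF assms(1)] by blast
  then show ?thesis using assms by (simp add: brace_list[OF cs] list_brace_add)
qed

lemma brace_sum:
  assumes "finite C" "d \<in> C"
  shows "brace x C (y(d := (\<Sum>i\<in>I. f i))) = (\<Sum>i\<in>I. brace x C (y(d := f i)))"
proof -
  have "brace x C (y(d := 0)) = 0" using brace_add[OF assms, of x y 0 0] by simp
  then show ?thesis
    by (induction I rule: infinite_finite_induct) (simp_all add: brace_add[OF assms])
qed

end

section \<open>The value of a rooted tree in a pre-Lie algebra\<close>

lemma arc_tree_acyclic: assumes "arc_tree T" shows "acyclic (fst T)"
proof (rule acyclicI, rule allI, rule notI)
  fix x assume x: "(x, x) \<in> (fst T)\<^sup>+"
  have step: "(y, y) \<in> (fst T)\<^sup>+" if "(x, y) \<in> (fst T)\<^sup>*" for y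
    using that
  proof (induction rule: rtrancl_induct)
    case base
    then show ?case by (rule x)
  next
    case (step y z)
    obtain y' where y': "(y, y') \<in> fst T" "(y', y) \<in> (fst T)\<^sup>*"
      using step.IH by (meson tranclD)
    then have "y' = z" using step.hyps assms by (auto simp: arc_tree_def single_valued_def)
    then show ?case using y' step.hyps by (meson rtrancl_into_trancl1)
  qed
  have "x \<in> verts T" using x by (auto simp: verts_def dest: tranclD)
  then have "(x, snd T) \<in> (fst T)\<^sup>*" using assms by (simp add: arc_tree_def)
  from step[OF this] obtain y where "(snd T, y) \<in> fst T" by (meson tranclD)
  then show False using root_no_arc[OF assms] by blast
qed

lemma arc_tree_wf: "arc_tree T \<Longrightarrow> wf (fst T)"
  by (rule finite_acyclic_wf) (simp_all add: arc_tree_acyclic, simp add: arc_tree_def)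

lemma finite_children: "finite A \<Longrightarrow> finite (children A v)"
  by (rule finite_subset[of _ "Domain A"]) (auto simp: children_def finite_Domain)

lemma arc_tree_descendants:
  assumes "arc_tree T" shows "{w. (w, snd T) \<in> (fst T)\<^sup>*} = verts T"
  using assms by (auto simp: arc_tree_def verts_def elim: converse_rtranclE)

context pre_Lie_algebra
begin

text \<open>
  The value of the subtree at \<open>v\<close>: the brace of \<open>e v\<close> with the values of the subtrees at the children
  of \<open>v\<close>. The recursion is along the arcs, which form a well-founded relation for a tree.
\<close>

definition tree_brace :: "(nat \<Rightarrow> 'l) \<Rightarrow> arcs \<Rightarrow> nat \<Rightarrow> 'l" where
  "tree_brace e A = wfrec A (\<lambda>F v. brace (e v) (children A v) F)"

lemma tree_brace_rec:
  assumes "wf A" "finite A"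
  shows "tree_brace e A v = brace (e v) (children A v) (tree_brace e A)"
proof -
  have "tree_brace e A v = brace (e v) (children A v) (cut (tree_brace e A) A v)"
    unfolding tree_brace_def by (rule wfrec[OF assms(1)])
  also have "\<dots> = brace (e v) (children A v) (tree_brace e A)"
    using assms by (intro brace_cong finite_children) (auto simp: children_def cut_def)
  finally show ?thesis .
qed

definition tree_value :: "(nat \<Rightarrow> 'l) \<Rightarrow> arcs \<times> nat \<Rightarrow> 'l" where
  "tree_value e T = tree_brace e (fst T) (snd T)"

text \<open>
  By induction on a vertex \<open>v\<close> of \<open>T\<close>, the value of the subtree at \<open>v\<close> times that of \<open>S\<close> is the sum over
  the descendants \<open>w\<close> of \<open>v\<close> of the value at \<open>v\<close> after grafting \<open>S\<close> on \<open>w\<close>. The recursion for braces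
  produces the term \<open>w = v\<close> and, for each child \<open>d\<close> of \<open>v\<close>, the terms with \<open>w\<close> a descendant of \<open>d\<close>.
\<close>

lemma tree_value_mul:
  assumes T: "arc_tree T" and S: "arc_tree S" and disj: "verts T \<inter> verts S = {}"
  shows "tree_value e T \<star> tree_value e S = (\<Sum>w\<in>verts T. tree_value e (graft T S w))"
proof -
  define A where "A = fst T"
  define B where "B = fst S"
  define z where "z = tree_value e S"
  define G where "G w = fst (graft T S w)" for w
  have wf: "wf A" "wf B" and fin: "finite A" "finite B"
    using T S arc_tree_wf by (auto simp: A_def B_def arc_tree_def)
  have sv: "single_valued A" using T by (simp add: A_def arc_tree_def)
  have acyc: "acyclic A" using arc_tree_acyclic[OF T] by (simp add: A_def)
  have G_rec: "tree_brace e (G w) v = brace (e v) (children (G w) v) (tree_brace e (G w))"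
    if "w \<in> verts T" for w v
    using arc_tree_graft[OF T S disj that] arc_tree_wf unfolding G_def
    by (intro tree_brace_rec) (auto simp: arc_tree_def)
  have ch: "children (G w) v = (if v \<in> verts S then children B v
     else if v = w then insert (snd S) (children A v) else children A v)" if "w \<in> verts T" for v w
    unfolding G_def A_def B_def by (rule children_graft[OF T S disj that])
  have ch_in: "c \<in> verts T" if "c \<in> children A v" for c v
    using that arc_in_verts[OF T] by (auto simp: A_def children_def)
  \<comment> \<open>Subtrees that do not contain the place w of grafting keep their value.\<close>
  have onS: "tree_brace e (G w) u = tree_brace e B u" if w: "w \<in> verts T" and "u \<in> verts S" for w u
    using wf(2) \<open>u \<in> verts S\<close>
  proof (induction u rule: wf_induct_rule)
    case (less u)
    have "tree_brace e (G w) u = brace (e u) (children B u) (tree_brace e (G w))"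
      using less.prems by (simp add: G_rec[OF w] ch[OF w])
    also have "\<dots> = brace (e u) (children B u) (tree_brace e B)"
      using less.IH arc_in_verts[OF S] fin
      by (intro brace_cong finite_children) (auto simp: children_def B_def)
    finally show ?case by (simp add: tree_brace_rec[OF wf(2) fin(2), of e u])
  qed
  have offT: "tree_brace e (G w) u = tree_brace e A u"
    if w: "w \<in> verts T" and "u \<in> verts T" and "(w, u) \<notin> A\<^sup>*" for w u
    using wf(1) \<open>u \<in> verts T\<close> \<open>(w, u) \<notin> A\<^sup>*\<close>
  proof (induction u rule: wf_induct_rule)
    case (less u)
    have "w \<noteq> u" "u \<notin> verts S" using less.prems disj by auto
    then have "tree_brace e (G w) u = brace (e u) (children A u) (tree_brace e (G w))"
      by (simp add: G_rec[OF w] ch[OF w])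
    also have "\<dots> = brace (e u) (children A u) (tree_brace e A)"
    proof (intro brace_cong finite_children fin)
      fix c assume c: "c \<in> children A u"
      then have "(c, u) \<in> A" by (simp add: children_def)
      moreover have "(w, c) \<notin> A\<^sup>*" using less.prems(2) calculation by (meson rtrancl_into_rtrancl)
      ultimately show "tree_brace e (G w) c = tree_brace e A c"
        using less.IH ch_in[OF c] by blast
    qed
    finally show ?case by (simp add: tree_brace_rec[OF wf(1) fin(1), of e u])
  qed
  \<comment> \<open>Different children of a vertex have no common descendant.\<close>
  have branch: "False" if "c \<in> children A v" "d \<in> children A v" "c \<noteq> d" "(w, c) \<in> A\<^sup>*" "(w, d) \<in> A\<^sup>*" for c d v w
  proof -
    have *: False if "(c, d) \<in> A\<^sup>*" "c \<noteq> d" "(c, v) \<in> A" "(d, v) \<in> A" for c d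
    proof -
      from that obtain u where "(c, u) \<in> A" "(u, d) \<in> A\<^sup>*" by (meson converse_rtranclE)
      then have "(v, d) \<in> A\<^sup>*" using that(3) sv by (auto simp: single_valued_def)
      then have "(v, v) \<in> A\<^sup>+" using that(4) by simp
      then show False using acyc by (simp add: acyclic_def)
    qed
    show False
      using single_valued_confluent[OF sv that(4,5)] that(1-3) *[of c d] *[of d c]
      by (auto simp: children_def)
  qed
  have "tree_brace e A v \<star> z = (\<Sum>w | (w, v) \<in> A\<^sup>*. tree_brace e (G w) v)" if "v \<in> verts T" for v
    using wf(1) that
  proof (induction v rule: wf_induct_rule)
    case (less v)
    let ?C = "children A v"
    have C: "finite ?C" "snd S \<notin> ?C"
      using finite_children[OF fin(1)] ch_in root_in_verts[of S] disj by auto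
    have desc: "{w. (w, d) \<in> A\<^sup>*} \<subseteq> verts T" if "d \<in> verts T" for d
    proof
      fix w assume "w \<in> {w. (w, d) \<in> A\<^sup>*}"
      then have "(w, d) \<in> A\<^sup>*" by simp
      then show "w \<in> verts T"
        using that arc_in_verts[OF T] by (cases rule: converse_rtranclE) (auto simp: A_def)
    qed
    have vS: "v \<notin> verts S" using less.prems disj by auto
    have self: "(v, c) \<notin> A\<^sup>*" if "c \<in> ?C" for c
      using that acyc by (auto simp: children_def acyclic_def dest: rtrancl_into_trancl1)
    have "tree_brace e A v \<star> z = brace (e v) ?C (tree_brace e A) \<star> z"
      by (simp flip: tree_brace_rec[OF wf(1) fin(1)])
    also have "\<dots> = brace (e v) (insert (snd S) ?C) ((tree_brace e A)(snd S := z))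
        + (\<Sum>d\<in>?C. brace (e v) ?C ((tree_brace e A)(d := tree_brace e A d \<star> z)))"
      by (rule brace_mul[OF C])
    also have "brace (e v) (insert (snd S) ?C) ((tree_brace e A)(snd S := z)) = tree_brace e (G v) v"
    proof -
      have "tree_brace e (G v) v = brace (e v) (insert (snd S) ?C) (tree_brace e (G v))"
        using vS by (simp add: G_rec[OF less.prems] ch[OF less.prems])
      also have "\<dots> = brace (e v) (insert (snd S) ?C) ((tree_brace e A)(snd S := z))"
        using C onS[OF less.prems root_in_verts] self ch_in offT[OF less.prems]
        by (intro brace_cong) (auto simp: z_def tree_value_def B_def)
      finally show ?thesis by simp
    qed
    also have "(\<Sum>d\<in>?C. brace (e v) ?C ((tree_brace e A)(d := tree_brace e A d \<star> z)))
        = (\<Sum>d\<in>?C. \<Sum>w | (w, d) \<in> A\<^sup>*. tree_brace e (G w) v)"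
    proof (intro sum.cong refl)
      fix d assume d: "d \<in> ?C"
      have dv: "(d, v) \<in> A" "d \<in> verts T" using d ch_in by (auto simp: children_def)
      have "brace (e v) ?C ((tree_brace e A)(d := tree_brace e (G w) d)) = tree_brace e (G w) v"
        if "(w, d) \<in> A\<^sup>*" for w
      proof -
        have w: "w \<in> verts T" using desc[OF dv(2)] that by auto
        have "w \<noteq> v" using self[OF d] that by auto
        then have "tree_brace e (G w) v = brace (e v) ?C (tree_brace e (G w))"
          using vS by (simp add: G_rec[OF w] ch[OF w])
        also have "\<dots> = brace (e v) ?C ((tree_brace e A)(d := tree_brace e (G w) d))"
          using branch[OF _ d _ _ that] ch_in offT[OF w]
          by (intro brace_cong C) auto
        finally show ?thesis by simp
      qed
      then show "brace (e v) ?C ((tree_brace e A)(d := tree_brace e A d \<star> z))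
          = (\<Sum>w | (w, d) \<in> A\<^sup>*. tree_brace e (G w) v)"
        using less.IH[OF dv] by (simp add: brace_sum[OF C(1) d])
    qed
    also have "tree_brace e (G v) v + (\<Sum>d\<in>?C. \<Sum>w | (w, d) \<in> A\<^sup>*. tree_brace e (G w) v)
        = (\<Sum>w\<in>insert v (\<Union>d\<in>?C. {w. (w, d) \<in> A\<^sup>*}). tree_brace e (G w) v)"
    proof -
      have fin': "finite {w. (w, d) \<in> A\<^sup>*}" if "d \<in> ?C" for d
        using desc[OF ch_in[OF that]] finite_verts[OF T] by (rule finite_subset)
      have "(\<Sum>d\<in>?C. \<Sum>w | (w, d) \<in> A\<^sup>*. tree_brace e (G w) v)
          = (\<Sum>w\<in>(\<Union>d\<in>?C. {w. (w, d) \<in> A\<^sup>*}). tree_brace e (G w) v)"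
        using C(1) fin' branch by (intro sum.UNION_disjoint[symmetric]) blast+
      moreover have "v \<notin> (\<Union>d\<in>?C. {w. (w, d) \<in> A\<^sup>*})" using self by auto
      ultimately show ?thesis using C(1) fin' by simp
    qed
    also have "insert v (\<Union>d\<in>?C. {w. (w, d) \<in> A\<^sup>*}) = {w. (w, v) \<in> A\<^sup>*}"
      by (auto simp: children_def elim: rtranclE)
    finally show ?case .
  qed
  from this[OF root_in_verts] show ?thesis
    using arc_tree_descendants[OF T] by (simp add: z_def tree_value_def A_def G_def) (simp add: graft_def)
qed

text \<open>
  The evaluation of a monomial at a family of elements.
\<close>

primrec term_eval :: "(nat \<Rightarrow> 'l) \<Rightarrow> mag_term \<Rightarrow> 'l" where
  "term_eval e (Var j) = e j"
| "term_eval e (Prod s t) = term_eval e s \<star> term_eval e t"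

lemma term_eval_tree_sum:
  "distinct (term_vars t) \<Longrightarrow> term_eval e t = tree_sum t (tree_value e)"
proof (induction t)
  case (Var j)
  show ?case by (simp add: tree_value_def tree_brace_rec children_def brace_empty)
next
  case (Prod s t)
  have "tree_sum s (tree_value e) \<star> tree_sum t (tree_value e)
      = tree_sum s (\<lambda>T. tree_value e T \<star> tree_sum t (tree_value e))"
    by (rule tree_sum_hom) (simp_all add: mul_0_left mul_add_left)
  also have "\<dots> = tree_sum s (\<lambda>T. tree_sum t (\<lambda>S. tree_value e T \<star> tree_value e S))"
    by (subst tree_sum_hom[where h = "\<lambda>x. _ \<star> x"]) (simp_all add: mul_0_right mul_add_right)
  also have "\<dots> = tree_sum (Prod s t) (tree_value e)"
    unfolding tree_sum.simps using Prod.prems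
    by (intro tree_sum_cong tree_value_mul) auto
  finally show ?case using Prod by simp
qed

end

section \<open>Rooted trees as graphs\<close>

text \<open>
  The underlying undirected graph of a tree, with the same root.
\<close>

definition to_rtree :: "arcs \<times> nat \<Rightarrow> rtree" where
  "to_rtree T = RTree ((\<lambda>(u, v). {u, v}) ` fst T) (snd T)"

lemma sym_adjacency: "sym (adjacency E)"
  by (auto simp: sym_def adjacency_def insert_commute)

lemma adjacency_rtrancl_sym: "(u, v) \<in> (adjacency E)\<^sup>* \<Longrightarrow> (v, u) \<in> (adjacency E)\<^sup>*"
  by (rule symD[OF sym_rtrancl[OF sym_adjacency]])

lemma adjacency_mono: "E \<subseteq> E' \<Longrightarrow> (u, v) \<in> (adjacency E)\<^sup>* \<Longrightarrow> (u, v) \<in> (adjacency E')\<^sup>*"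
  by (rule rev_subsetD[OF _ rtrancl_mono]) (auto simp: adjacency_def)

lemma connecting_path:
  assumes "(u, v) \<in> (adjacency E)\<^sup>*"
  obtains p where "p \<noteq> []" "hd p = u" "last p = v" "distinct p" "successively (\<lambda>a b. {a, b} \<in> E) p"
proof -
  have "\<exists>p. p \<noteq> [] \<and> hd p = u \<and> last p = v \<and> distinct p \<and> successively (\<lambda>a b. {a, b} \<in> E) p"
    using assms
  proof (induction rule: converse_rtrancl_induct)
    case base
    show ?case by (rule exI[of _ "[v]"]) simp
  next
    case (step u w)
    then obtain p where p: "p \<noteq> []" "hd p = w" "last p = v" "distinct p" "successively (\<lambda>a b. {a, b} \<in> E) p"
      by blast
    show ?case
    proof (cases "u \<in> set p")
      case True
      then obtain p1 p2 where "p = p1 @ u # p2" by (meson split_list)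
      then show ?thesis using p by (intro exI[of _ "u # p2"]) (auto simp: successively_append_iff)
    next
      case False
      then show ?thesis using p step.hyps
        by (intro exI[of _ "u # p"]) (auto simp: successively_Cons adjacency_def)
    qed
  qed
  then show ?thesis using that by blast
qed

text \<open>In a graph without cycles every edge is a bridge.\<close>

lemma bridge:
  assumes "{u, v} \<in> E" "u \<noteq> v" "\<nexists>p. graph_cycle E p"
  shows "(u, v) \<notin> (adjacency (E - {{u, v}}))\<^sup>*"
proof
  assume "(u, v) \<in> (adjacency (E - {{u, v}}))\<^sup>*"
  then obtain p where p: "p \<noteq> []" "hd p = u" "last p = v" "distinct p"
      "successively (\<lambda>a b. {a, b} \<in> E - {{u, v}}) p"
    by (rule connecting_path)
  have "length p \<ge> 3"
  proof (rule ccontr)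
    assume "\<not> length p \<ge> 3"
    then have "length p = 1 \<or> length p = 2" using p(1) by (cases "length p") auto
    then show False
    proof
      assume "length p = 1"
      then show False using p assms(2) by (auto simp: length_Suc_conv One_nat_def)
    next
      assume "length p = 2"
      then show False using p by (auto simp: length_Suc_conv numeral_2_eq_2)
    qed
  qed
  moreover have "successively (\<lambda>a b. {a, b} \<in> E) p"
    by (rule successively_mono[OF p(5)]) auto
  ultimately have "graph_cycle E p"
    using p assms(1) by (simp add: graph_cycle_def insert_commute)
  then show False using assms(3) by blast
qed

lemma arc_tree_no_cycle:
  assumes T: "arc_tree T"
  shows "\<not> graph_cycle ((\<lambda>(u, v). {u, v}) ` fst T) p"
proof
  let ?E = "(\<lambda>(u, v). {u, v}) ` fst T"
  assume "graph_cycle ?E p"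
  then have p: "length p \<ge> 3" "distinct p" "successively (\<lambda>u v. {u, v} \<in> ?E) p" "{last p, hd p} \<in> ?E"
    by (auto simp: graph_cycle_def)
  let ?n = "length p"
  have edge: "{p ! j, p ! ((j + 1) mod ?n)} \<in> ?E" if "j < ?n" for j
  proof (cases "j + 1 < ?n")
    case True
    then show ?thesis using p(3) by (simp add: successively_conv_nth flip: Suc_eq_plus1)
  next
    case False
    then have "j = ?n - 1" using that by auto
    then show ?thesis using p(1,4) by (simp add: last_conv_nth hd_conv_nth flip: length_greater_0_conv)
  qed
  \<comment> \<open>A vertex of the cycle none of whose children is on the cycle would have two parents.\<close>
  have "wf (fst T)" by (rule arc_tree_wf[OF T])
  moreover have "hd p \<in> set p" using p(1) by (cases p) auto
  ultimately obtain x where x: "x \<in> set p" "\<And>y. (y, x) \<in> fst T \<Longrightarrow> y \<notin> set p"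
    by (rule wfE_min) blast
  obtain i where i: "i < ?n" "p ! i = x" using x(1) by (auto simp: in_set_conv_nth)
  define j where "j = (if i = 0 then ?n - 1 else i - 1)"
  have j: "j < ?n" "(j + 1) mod ?n = i" using i p(1) by (auto simp: j_def)
  have i': "(i + 1) mod ?n < ?n" using p(1) by (intro mod_less_divisor) auto
  have neq: "(i + 1) mod ?n \<noteq> j"
    using i p(1) by (cases "i + 1 = ?n") (auto simp: j_def)
  have arc: "(x, p ! k) \<in> fst T" if "k < ?n" "{x, p ! k} \<in> ?E" for k
  proof -
    have "(x, p ! k) \<in> fst T \<or> (p ! k, x) \<in> fst T" using that(2) by (auto simp: doubleton_eq_iff)
    then show ?thesis using x(2)[of "p ! k"] nth_mem[OF that(1)] by blast
  qed
  have "(x, p ! ((i + 1) mod ?n)) \<in> fst T" using arc[OF i'] edge[OF i(1)] i by simp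
  moreover have "(x, p ! j) \<in> fst T" using arc[OF j(1)] edge[OF j(1)] i j by (simp add: insert_commute)
  ultimately have "p ! ((i + 1) mod ?n) = p ! j"
    using T by (auto simp: arc_tree_def single_valued_def)
  then show False using neq i' j(1) p(2) by (simp add: nth_eq_iff_index_eq)
qed

lemma arc_to_adjacency: "(u, v) \<in> (fst T)\<^sup>* \<Longrightarrow> (u, v) \<in> (adjacency (tree_edges (to_rtree T)))\<^sup>*"
  by (rule rev_subsetD[OF _ rtrancl_mono]) (auto simp: adjacency_def to_rtree_def)

lemma is_tree_to_rtree:
  assumes T: "arc_tree T"
  shows "is_tree (verts T) (tree_edges (to_rtree T))"
  unfolding is_tree_def
proof (intro conjI ballI)
  show "verts T \<noteq> {}" by (simp add: verts_def)
  fix e assume "e \<in> tree_edges (to_rtree T)"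
  then obtain u v where e: "e = {u, v}" "(u, v) \<in> fst T" by (auto simp: to_rtree_def)
  then show "e \<subseteq> verts T" using arc_in_verts[OF T] by auto
  have "u \<noteq> v" using arc_tree_acyclic[OF T] e by (auto simp: acyclic_def)
  then show "card e = 2" using e by simp
next
  fix u v assume "u \<in> verts T" "v \<in> verts T"
  then have "(u, snd T) \<in> (fst T)\<^sup>*" "(v, snd T) \<in> (fst T)\<^sup>*" using T by (auto simp: arc_tree_def)
  then show "(u, v) \<in> (adjacency (tree_edges (to_rtree T)))\<^sup>*"
    by (meson arc_to_adjacency adjacency_rtrancl_sym rtrancl_trans)
next
  show "\<nexists>p. graph_cycle (tree_edges (to_rtree T)) p"
    using arc_tree_no_cycle[OF T] by (simp add: to_rtree_def)
qed

lemma to_rtree_in_rooted_trees: "arc_tree T \<Longrightarrow> verts T = {1..n} \<Longrightarrow> to_rtree T \<in> rooted_trees n"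
  using is_tree_to_rtree[of T] root_in_verts[of T] by (simp add: rooted_trees_def to_rtree_def)

text \<open>
  The orientation of the edges towards the root recovers the arcs: a path from the parent \<open>v\<close> to the
  root along arcs avoids the arc \<open>(u, v)\<close>, and if \<open>u\<close> were connected to the root without it, there
  would be a cycle.
\<close>

lemma tree_arcs_to_rtree:
  assumes T: "arc_tree T"
  shows "tree_arcs (to_rtree T) = fst T"
proof -
  let ?E = "tree_edges (to_rtree T)"
  have edges: "{u, v} \<in> ?E \<longleftrightarrow> (u, v) \<in> fst T \<or> (v, u) \<in> fst T" for u v
    by (auto simp: to_rtree_def doubleton_eq_iff)
  have up: "(v, snd T) \<in> (adjacency (?E - {{u, v}}))\<^sup>*" if uv: "(u, v) \<in> fst T" for u v
  proof -
    have "(v, x) \<in> (adjacency (?E - {{u, v}}))\<^sup>*" if "(v, x) \<in> (fst T)\<^sup>*" for x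
      using that
    proof (induction rule: rtrancl_induct)
      case (step x y)
      have "(u, u) \<in> (fst T)\<^sup>+" if "x = u" using uv step.hyps that by auto
      moreover have "(u, u) \<in> (fst T)\<^sup>+" if "x = v" "y = u" using uv step.hyps that by auto
      ultimately have "{x, y} \<noteq> {u, v}"
        using arc_tree_acyclic[OF T] by (auto simp: acyclic_def doubleton_eq_iff)
      then have "(x, y) \<in> adjacency (?E - {{u, v}})" using step.hyps edges by (simp add: adjacency_def)
      then show ?case using step.IH by simp
    qed simp
    moreover have "(v, snd T) \<in> (fst T)\<^sup>*" using T uv by (auto simp: arc_tree_def)
    ultimately show ?thesis by blast
  qed
  have "(u, v) \<in> fst T" if uv: "{u, v} \<in> ?E" and v: "(v, snd T) \<in> (adjacency (?E - {{u, v}}))\<^sup>*" for u v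
  proof (rule ccontr)
    assume "(u, v) \<notin> fst T"
    then have "(v, u) \<in> fst T" using uv edges by blast
    then have neq: "u \<noteq> v" and "(u, snd T) \<in> (adjacency (?E - {{u, v}}))\<^sup>*"
      using up[of v u] \<open>(u, v) \<notin> fst T\<close> by (auto simp: insert_commute)
    then have "(u, v) \<in> (adjacency (?E - {{u, v}}))\<^sup>*"
      using adjacency_rtrancl_sym[OF v] by (meson rtrancl_trans)
    moreover have "\<nexists>p. graph_cycle ?E p" using is_tree_to_rtree[OF T] by (simp add: is_tree_def)
    ultimately show False using bridge[OF uv neq] by blast
  qed
  then show ?thesis using up edges
    by (auto simp: tree_arcs_def) (auto simp: to_rtree_def)
qed

lemma tree_root_to_rtree [simp]: "tree_root (to_rtree T) = snd T"
  by (simp add: to_rtree_def)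

text \<open>
  An oriented subtree of maximal size contains all vertices by connectedness, and all edges because
  a further edge would not be a bridge.
\<close>

lemma is_tree_orientation:
  assumes tree: "is_tree V E" and r: "r \<in> V" and fin: "finite V"
  obtains T where "arc_tree T" "verts T = V" "to_rtree T = RTree E r"
proof -
  define P where "P T \<longleftrightarrow> arc_tree T \<and> snd T = r \<and> verts T \<subseteq> V \<and> tree_edges (to_rtree T) \<subseteq> E" for T
  have E: "e \<subseteq> V" "card e = 2" if "e \<in> E" for e using tree that by (auto simp: is_tree_def)
  have acyc: "\<nexists>p. graph_cycle E p" using tree by (auto simp: is_tree_def)
  have conn: "(u, v) \<in> (adjacency E)\<^sup>*" if "u \<in> V" "v \<in> V" for u v
    using tree that by (auto simp: is_tree_def)
  have "P ({}, r)" using r by (simp add: P_def arc_tree_single) (simp add: to_rtree_def)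
  moreover have "\<forall>T. P T \<longrightarrow> card (verts T) < Suc (card V)"
    using fin by (auto simp: P_def card_mono less_Suc_eq_le)
  ultimately have "\<exists>T. P T \<and> (\<forall>S. P S \<longrightarrow> card (verts S) \<le> card (verts T))"
    by (rule Lattices_Big.ex_has_greatest_nat[where f = "\<lambda>T. card (verts T)"])
  then obtain T where T: "P T" "\<And>S. P S \<Longrightarrow> card (verts S) \<le> card (verts T)" by blast
  have T': "arc_tree T" "snd T = r" "verts T \<subseteq> V" "tree_edges (to_rtree T) \<subseteq> E"
    using T(1) by (auto simp: P_def)
  have V: "verts T = V"
  proof (rule ccontr)
    assume "verts T \<noteq> V"
    then obtain w where w: "w \<in> V" "w \<notin> verts T" using T' by auto
    have "\<exists>a b. (a, b) \<in> adjacency E \<and> a \<in> verts T \<and> b \<notin> verts T"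
    proof (rule ccontr)
      assume *: "\<not> ?thesis"
      have "x \<in> verts T" if "(r, x) \<in> (adjacency E)\<^sup>*" for x
        using that by (induction rule: rtrancl_induct) (use * root_in_verts[of T] T'(2) in auto)
      then show False using conn[OF r w(1)] w(2) by blast
    qed
    then obtain a b where ab: "{a, b} \<in> E" "a \<in> verts T" "b \<notin> verts T" by (auto simp: adjacency_def)
    have "P (graft T ({}, b) a)"
      using ab T' E(1)[OF ab(1)] arc_tree_graft[OF T'(1) arc_tree_single, of b a]
      by (auto simp: P_def) (auto simp: to_rtree_def graft_def insert_commute)
    from T(2)[OF this] show False using ab(3) finite_verts[OF T'(1)] by simp
  qed
  have "E \<subseteq> tree_edges (to_rtree T)"
  proof
    fix e assume e: "e \<in> E"
    show "e \<in> tree_edges (to_rtree T)"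
    proof (rule ccontr)
      assume ne: "e \<notin> tree_edges (to_rtree T)"
      obtain a b where ab: "e = {a, b}" "a \<noteq> b" using E(2)[OF e] by (auto simp: card_2_iff)
      have "a \<in> verts T" "b \<in> verts T" using E(1)[OF e] ab V by auto
      then have "(a, b) \<in> (adjacency (tree_edges (to_rtree T)))\<^sup>*"
        using is_tree_to_rtree[OF T'(1)] by (simp add: is_tree_def)
      moreover have "tree_edges (to_rtree T) \<subseteq> E - {{a, b}}" using T'(4) ne ab by auto
      ultimately have "(a, b) \<in> (adjacency (E - {{a, b}}))\<^sup>*" by (meson adjacency_mono)
      then show False using bridge[of a b E] e ab acyc by blast
    qed
  qed
  then have "to_rtree T = RTree E r" using T' by (simp add: to_rtree_def)
  then show ?thesis using that T'(1) V by blast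
qed

lemma rooted_trees_orientation:
  assumes "R \<in> rooted_trees n"
  obtains T where "arc_tree T" "verts T = {1..n}" "to_rtree T = R"
proof (rule is_tree_orientation)
  show "is_tree {1..n} (tree_edges R)" "tree_root R \<in> {1..n}" using assms by (auto simp: rooted_trees_def)
qed (use that in auto)

section \<open>Composition of rooted trees\<close>

lemma tree_relabel_to_rtree: "tree_relabel \<sigma> (to_rtree T) = to_rtree (map_tree \<sigma> T)"
  by (simp add: tree_relabel_def to_rtree_def map_tree_def image_image case_prod_unfold)

lemma tree_graft_to_rtree:
  assumes T: "arc_tree T" and S: "arc_tree S"
  shows "tree_graft m i f (to_rtree T) (to_rtree S) =
    to_rtree (subst_tree (outer_label m i) i (\<lambda>j. inner_label i (f {j, i})) T (map_tree (inner_label i) S))"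
proof -
  let ?o = "outer_label m i" and ?n = "inner_label i"
  have ii: "(i, i) \<notin> fst T" using arc_tree_acyclic[OF T] by (auto simp: acyclic_def)
  let ?h = "\<lambda>(u, v). {if u = i then ?n (snd S) else ?o u, if v = i then ?n (f {u, i}) else ?o v}"
  have "fst T = {(u, v) \<in> fst T. u \<noteq> i \<and> v \<noteq> i} \<union> {(j, i) | j. (j, i) \<in> fst T} \<union> {(i, j) | j. (i, j) \<in> fst T}"
    by auto
  then have "?h ` fst T = ?h ` {(u, v) \<in> fst T. u \<noteq> i \<and> v \<noteq> i} \<union> ?h ` {(j, i) | j. (j, i) \<in> fst T}
      \<union> ?h ` {(i, j) | j. (i, j) \<in> fst T}"
    by (metis image_Un)
  also have "?h ` {(u, v) \<in> fst T. u \<noteq> i \<and> v \<noteq> i} = {?o ` e | e. e \<in> tree_edges (to_rtree T) \<and> i \<notin> e}"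
  proof -
    let ?X = "{(u, v) \<in> fst T. u \<noteq> i \<and> v \<noteq> i}"
    have "?h ` ?X = (\<lambda>p. ?o ` (case p of (u, v) \<Rightarrow> {u, v})) ` ?X"
      by (intro image_cong) auto
    also have "\<dots> = (`) ?o ` (\<lambda>(u, v). {u, v}) ` ?X" by (simp only: image_image)
    also have "(\<lambda>(u, v). {u, v}) ` ?X = {e \<in> tree_edges (to_rtree T). i \<notin> e}"
      by (auto simp: to_rtree_def)
    also have "(`) ?o ` \<dots> = {?o ` e | e. e \<in> tree_edges (to_rtree T) \<and> i \<notin> e}"
      by auto
    finally show ?thesis .
  qed
  also have "?h ` {(j, i) | j. (j, i) \<in> fst T} = {{?o j, ?n (f {j, i})} | j. (j, i) \<in> fst T}"
  proof -
    have "?h ` {(j, i) | j. (j, i) \<in> fst T} = (\<lambda>j. ?h (j, i)) ` {j. (j, i) \<in> fst T}" by blast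
    also have "\<dots> = (\<lambda>j. {?o j, ?n (f {j, i})}) ` {j. (j, i) \<in> fst T}"
      by (rule image_cong) (use ii in auto)
    finally show ?thesis by (simp add: setcompr_eq_image)
  qed
  also have "?h ` {(i, j) | j. (i, j) \<in> fst T} = {{?n (snd S), ?o j} | j. (i, j) \<in> fst T}"
  proof -
    have "?h ` {(i, j) | j. (i, j) \<in> fst T} = (\<lambda>j. ?h (i, j)) ` {j. (i, j) \<in> fst T}" by blast
    also have "\<dots> = (\<lambda>j. {?n (snd S), ?o j}) ` {j. (i, j) \<in> fst T}"
      by (rule image_cong) (use ii in auto)
    finally show ?thesis by (simp add: setcompr_eq_image)
  qed
  finally have h: "?h ` fst T = {?o ` e | e. e \<in> tree_edges (to_rtree T) \<and> i \<notin> e}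
      \<union> {{?o j, ?n (f {j, i})} | j. (j, i) \<in> fst T} \<union> {{?n (snd S), ?o j} | j. (i, j) \<in> fst T}" .
  have "tree_edges (to_rtree (subst_tree ?o i (\<lambda>j. ?n (f {j, i})) T (map_tree ?n S)))
     = ?h ` fst T \<union> {?n ` e | e. e \<in> tree_edges (to_rtree S)}"
    unfolding Setcompr_eq_image to_rtree_def subst_tree_def map_tree_def fst_conv snd_conv rtree.sel
      image_Un image_image
    by (intro arg_cong2[where f = "(\<union>)"] image_cong refl) (simp_all add: case_prod_unfold)
  then show ?thesis
    unfolding h tree_graft_def tree_arcs_to_rtree[OF T] 
    by (simp add: to_rtree_def subst_tree_def map_tree_def) blast
qed

lemma subst_tree_cong:
  "(\<And>c. c \<in> children (fst T) i \<Longrightarrow> f c = g c) \<Longrightarrow> subst_tree \<rho> i f T S = subst_tree \<rho> i g T S"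
proof -
  assume *: "\<And>c. c \<in> children (fst T) i \<Longrightarrow> f c = g c"
  have "(\<lambda>(u, v). (if u = i then snd S else \<rho> u, if v = i then f u else \<rho> v)) ` fst T
      = (\<lambda>(u, v). (if u = i then snd S else \<rho> u, if v = i then g u else \<rho> v)) ` fst T"
    by (rule image_cong) (auto simp: * children_def)
  then show ?thesis by (simp add: subst_tree_def)
qed

lemma tree_comp_to_rtree:
  assumes T: "arc_tree T" and S: "arc_tree S" "verts S = {1..m}" and i: "i \<ge> 1"
  shows "tree_comp m i (to_rtree T) (to_rtree S) =
    (\<Sum>f\<in>children (fst T) i \<rightarrow>\<^sub>E verts (map_tree (inner_label i) S).
       basis_elem (to_rtree (subst_tree (outer_label m i) i f T (map_tree (inner_label i) S))))"
proof -
  let ?C = "children (fst T) i" and ?n = "inner_label i"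
  have ii: "j \<noteq> i" if "j \<in> ?C" for j
    using arc_tree_acyclic[OF T] that by (auto simp: acyclic_def children_def)
  have inc: "incoming_edges (to_rtree T) i = (\<lambda>j. {j, i}) ` ?C"
    unfolding incoming_edges_def tree_arcs_to_rtree[OF T] by (auto simp: children_def)
  have el: "the_elem ({j, i} - {i}) = j" if "j \<in> ?C" for j
    using ii[OF that] by (simp add: insert_Diff_if)
  let ?F = "\<lambda>f. \<lambda>j\<in>?C. ?n (f {j, i})"
  \<comment> \<open>The edge {j, i} determines the child j, and the shift of labels by i - 1 is undone.\<close>
  let ?G = "\<lambda>g. \<lambda>e\<in>(\<lambda>j. {j, i}) ` ?C. g (the_elem (e - {i})) + 1 - i"
  show ?thesis
    unfolding tree_comp_def inc verts_map_tree S(2)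
  proof (rule sum.reindex_bij_witness[where i = ?G and j = ?F])
    fix f assume f: "f \<in> (\<lambda>j. {j, i}) ` ?C \<rightarrow>\<^sub>E {1..m}"
    show "?G (?F f) = f"
    proof (rule ext)
      fix e show "?G (?F f) e = f e"
        using f i PiE_arb[OF f, of e] by (cases "e \<in> (\<lambda>j. {j, i}) ` ?C") (auto simp: el inner_label_def)
    qed
    show "?F f \<in> ?C \<rightarrow>\<^sub>E ?n ` {1..m}" using f by auto
    show "basis_elem (to_rtree (subst_tree (outer_label m i) i (?F f) T (map_tree ?n S)))
      = basis_elem (tree_graft m i f (to_rtree T) (to_rtree S))"
      unfolding tree_graft_to_rtree[OF T S(1)]
      by (subst subst_tree_cong[where g = "\<lambda>j. ?n (f {j, i})"]) auto
  next
    fix g assume g: "g \<in> ?C \<rightarrow>\<^sub>E ?n ` {1..m}"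
    have gj: "\<exists>k\<in>{1..m}. g j = ?n k" if "j \<in> ?C" for j using g that by auto
    show "?F (?G g) = g"
    proof (rule ext)
      fix j show "?F (?G g) j = g j"
        using g gj[of j] i PiE_arb[OF g, of j] by (cases "j \<in> ?C") (auto simp: el inner_label_def)
    qed
    show "?G g \<in> (\<lambda>j. {j, i}) ` ?C \<rightarrow>\<^sub>E {1..m}"
      using gj i by (fastforce simp: el inner_label_def)
  qed
qed

section \<open>The free pre-Lie algebra as a quotient of the free magmatic algebra\<close>

text \<open>
  The product of the free magmatic algebra on the variables \<open>Var j\<close>.
\<close>

definition mag_mul :: "(mag_term \<Rightarrow>\<^sub>0 'k::comm_ring_1) \<Rightarrow> (mag_term \<Rightarrow>\<^sub>0 'k) \<Rightarrow> (mag_term \<Rightarrow>\<^sub>0 'k)" where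
  "mag_mul = bilinear_ext (\<lambda>s t. basis_elem (Prod s t))"

lemma klinear_mag_mul_left: "klinear f \<Longrightarrow> klinear (\<lambda>x. mag_mul (f x) y)"
  unfolding mag_mul_def by (rule klinear_bil_left)
lemma klinear_mag_mul_right: "klinear f \<Longrightarrow> klinear (\<lambda>x. mag_mul y (f x))"
  unfolding mag_mul_def by (rule klinear_bil_right)
lemma mag_mul_basis [simp]: "mag_mul (basis_elem s) (basis_elem t) = basis_elem (Prod s t)"
  by (simp add: mag_mul_def)

lemma klinear_plus: "klinear f \<Longrightarrow> klinear g \<Longrightarrow> klinear (\<lambda>x. f x + g x)"
  by (rule klinearI) (simp_all add: klinear_add klinear_scale scale_add algebra_simps)
lemma klinear_minus: "klinear f \<Longrightarrow> klinear g \<Longrightarrow> klinear (\<lambda>x. f x - g x)"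
  by (rule klinearI) (simp_all add: klinear_add klinear_scale scale_diff algebra_simps)

definition pre_Lie_relation ::
  "(mag_term \<Rightarrow>\<^sub>0 'k::comm_ring_1) \<Rightarrow> (mag_term \<Rightarrow>\<^sub>0 'k) \<Rightarrow> (mag_term \<Rightarrow>\<^sub>0 'k) \<Rightarrow> (mag_term \<Rightarrow>\<^sub>0 'k)" where
  "pre_Lie_relation x y z =
     mag_mul (mag_mul x y) z - mag_mul x (mag_mul y z) - mag_mul (mag_mul x z) y + mag_mul x (mag_mul z y)"

lemma klinear_pre_Lie_relation:
  "klinear (\<lambda>x. pre_Lie_relation x y z)" "klinear (\<lambda>y. pre_Lie_relation x y z)" "klinear (pre_Lie_relation x y)"
  unfolding pre_Lie_relation_def
  by (intro klinear_plus klinear_minus klinear_mag_mul_left klinear_mag_mul_right klinear_ident)+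

text \<open>
  The instances of the pre-Lie relation in a monomial context, together with the list of the
  variables that occur in (each of the monomials of) such an instance.
\<close>

inductive relation_instance :: "nat list \<Rightarrow> (mag_term \<Rightarrow>\<^sub>0 'k::comm_ring_1) \<Rightarrow> bool" where
  base: "relation_instance (term_vars a @ term_vars b @ term_vars c)
    (pre_Lie_relation (basis_elem a) (basis_elem b) (basis_elem c))"
| left: "relation_instance xs g \<Longrightarrow> relation_instance (term_vars s @ xs) (mag_mul (basis_elem s) g)"
| right: "relation_instance xs g \<Longrightarrow> relation_instance (xs @ term_vars s) (mag_mul g (basis_elem s))"

text \<open>
  The two-sided ideal generated by the pre-Lie relations, as the span of their instances.
\<close>

inductive_set pre_Lie_ideal :: "(mag_term \<Rightarrow>\<^sub>0 'k::comm_ring_1) set" where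
  zero: "0 \<in> pre_Lie_ideal"
| add: "x \<in> pre_Lie_ideal \<Longrightarrow> y \<in> pre_Lie_ideal \<Longrightarrow> x + y \<in> pre_Lie_ideal"
| inst: "relation_instance xs g \<Longrightarrow> scale a g \<in> pre_Lie_ideal"

lemma pre_Lie_ideal_scale: "x \<in> pre_Lie_ideal \<Longrightarrow> scale a x \<in> pre_Lie_ideal"
  by (induction rule: pre_Lie_ideal.induct)
    (simp_all add: pre_Lie_ideal.intros scale_add scale_scale)

lemma pre_Lie_ideal_uminus: "x \<in> pre_Lie_ideal \<Longrightarrow> - x \<in> pre_Lie_ideal"
  using pre_Lie_ideal_scale[of x "-1"] by (simp add: scale_minus_one)

lemma pre_Lie_ideal_diff: "x \<in> pre_Lie_ideal \<Longrightarrow> y \<in> pre_Lie_ideal \<Longrightarrow> x - y \<in> pre_Lie_ideal"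
  using pre_Lie_ideal.add[OF _ pre_Lie_ideal_uminus, of x y] by simp

lemma klinear_in_pre_Lie_ideal:
  assumes f: "klinear f" and "keys x \<subseteq> B" and basis: "\<And>b. b \<in> B \<Longrightarrow> f (basis_elem b) \<in> pre_Lie_ideal"
  shows "f x \<in> pre_Lie_ideal"
  using assms(2)
proof (induction x rule: span_induct)
  case zero
  then show ?case by (simp add: klinear_0[OF f] pre_Lie_ideal.zero)
next
  case (add x y)
  then show ?case by (simp add: klinear_add[OF f] pre_Lie_ideal.add)
next
  case (basis b a)
  then show ?case
    by (subst klinear_single[OF f]) (rule pre_Lie_ideal_scale[OF assms(3)])
qed

lemma pre_Lie_relation_in_ideal: "pre_Lie_relation x y z \<in> pre_Lie_ideal"
proof (rule klinear_in_pre_Lie_ideal[OF klinear_pre_Lie_relation(1) subset_UNIV],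
    rule klinear_in_pre_Lie_ideal[OF klinear_pre_Lie_relation(2) subset_UNIV],
    rule klinear_in_pre_Lie_ideal[OF klinear_pre_Lie_relation(3) subset_UNIV])
  fix a b c
  show "pre_Lie_relation (basis_elem a) (basis_elem b) (basis_elem c) \<in> pre_Lie_ideal"
    using pre_Lie_ideal.inst[OF relation_instance.base, of 1] by simp
qed

lemma pre_Lie_ideal_mul_right:
  fixes x :: "mag_term \<Rightarrow>\<^sub>0 'k::comm_ring_1"
  shows "x \<in> pre_Lie_ideal \<Longrightarrow> mag_mul x y \<in> pre_Lie_ideal"
proof (rule klinear_in_pre_Lie_ideal[OF klinear_mag_mul_right[OF klinear_ident] subset_UNIV])
  fix s assume "x \<in> pre_Lie_ideal"
  note lin = klinear_mag_mul_left[OF klinear_ident, of "basis_elem s :: mag_term \<Rightarrow>\<^sub>0 'k"]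
  from \<open>x \<in> pre_Lie_ideal\<close> show "mag_mul x (basis_elem s) \<in> pre_Lie_ideal"
  proof (induction rule: pre_Lie_ideal.induct)
    case zero
    then show ?case using klinear_0[OF lin] by (simp add: pre_Lie_ideal.zero)
  next
    case (add x y)
    then show ?case using klinear_add[OF lin] by (simp add: pre_Lie_ideal.add)
  next
    case (inst xs g a)
    then show ?case
      using klinear_scale[OF lin] pre_Lie_ideal.inst[OF relation_instance.right] by simp
  qed
qed

lemma pre_Lie_ideal_mul_left:
  fixes x :: "mag_term \<Rightarrow>\<^sub>0 'k::comm_ring_1"
  shows "x \<in> pre_Lie_ideal \<Longrightarrow> mag_mul y x \<in> pre_Lie_ideal"
proof (rule klinear_in_pre_Lie_ideal[OF klinear_mag_mul_left[OF klinear_ident] subset_UNIV])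
  fix s assume "x \<in> pre_Lie_ideal"
  note lin = klinear_mag_mul_right[OF klinear_ident, of "basis_elem s :: mag_term \<Rightarrow>\<^sub>0 'k"]
  from \<open>x \<in> pre_Lie_ideal\<close> show "mag_mul (basis_elem s) x \<in> pre_Lie_ideal"
  proof (induction rule: pre_Lie_ideal.induct)
    case zero
    then show ?case using klinear_0[OF lin] by (simp add: pre_Lie_ideal.zero)
  next
    case (add x y)
    then show ?case using klinear_add[OF lin] by (simp add: pre_Lie_ideal.add)
  next
    case (inst xs g a)
    then show ?case
      using klinear_scale[OF lin] pre_Lie_ideal.inst[OF relation_instance.left] by simp
  qed
qed

text \<open>
  The free pre-Lie algebra on the variables \<open>Var j\<close>.
\<close>

quotient_type (overloaded) 'k free_pre_Lie =
  "mag_term \<Rightarrow>\<^sub>0 'k::comm_ring_1" / "\<lambda>x y. x - y \<in> pre_Lie_ideal"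
proof (rule equivpI)
  show "reflp (\<lambda>x y :: mag_term \<Rightarrow>\<^sub>0 'k. x - y \<in> pre_Lie_ideal)"
    by (rule reflpI) (simp add: pre_Lie_ideal.zero)
  show "symp (\<lambda>x y :: mag_term \<Rightarrow>\<^sub>0 'k. x - y \<in> pre_Lie_ideal)"
    by (rule sympI) (metis minus_diff_eq pre_Lie_ideal_uminus)
  show "transp (\<lambda>x y :: mag_term \<Rightarrow>\<^sub>0 'k. x - y \<in> pre_Lie_ideal)"
    by (rule transpI) (metis diff_add_cancel add_diff_eq pre_Lie_ideal.add)
qed

instantiation free_pre_Lie :: (comm_ring_1) ab_group_add
begin

lift_definition zero_free_pre_Lie :: "'a free_pre_Lie" is 0 .

lift_definition plus_free_pre_Lie :: "'a free_pre_Lie \<Rightarrow> 'a free_pre_Lie \<Rightarrow> 'a free_pre_Lie" is "(+)"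
  by (metis add_diff_add pre_Lie_ideal.add)

lift_definition uminus_free_pre_Lie :: "'a free_pre_Lie \<Rightarrow> 'a free_pre_Lie" is uminus
  by (metis minus_diff_minus pre_Lie_ideal_uminus)

lift_definition minus_free_pre_Lie :: "'a free_pre_Lie \<Rightarrow> 'a free_pre_Lie \<Rightarrow> 'a free_pre_Lie" is "(-)"
proof -
  fix x y u v :: "mag_term \<Rightarrow>\<^sub>0 'a"
  assume "x - y \<in> pre_Lie_ideal" "u - v \<in> pre_Lie_ideal"
  moreover have "x - u - (y - v) = (x - y) - (u - v)" by simp
  ultimately show "x - u - (y - v) \<in> pre_Lie_ideal" by (simp only: pre_Lie_ideal_diff)
qed

instance
  by standard (transfer; simp add: algebra_simps pre_Lie_ideal.zero)+

end

lift_definition free_pre_Lie_mul :: "'k::comm_ring_1 free_pre_Lie \<Rightarrow> 'k free_pre_Lie \<Rightarrow> 'k free_pre_Lie"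
  is mag_mul
proof -
  fix x y u v :: "mag_term \<Rightarrow>\<^sub>0 'k"
  assume "x - y \<in> pre_Lie_ideal" "u - v \<in> pre_Lie_ideal"
  then have "mag_mul (x - y) u + mag_mul y (u - v) \<in> pre_Lie_ideal"
    by (intro pre_Lie_ideal.add pre_Lie_ideal_mul_right pre_Lie_ideal_mul_left)
  then show "mag_mul x u - mag_mul y v \<in> pre_Lie_ideal"
    by (simp add: klinear_diff[OF klinear_mag_mul_left[OF klinear_ident]]
        klinear_diff[OF klinear_mag_mul_right[OF klinear_ident]])
qed

lemma abs_free_pre_Lie_eq_iff:
  "abs_free_pre_Lie x = abs_free_pre_Lie y \<longleftrightarrow> x - y \<in> pre_Lie_ideal"
  by (rule free_pre_Lie.abs_eq_iff)

interpretation free_pre_Lie: pre_Lie_algebra free_pre_Lie_mul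
proof
  fix x y z :: "'k::comm_ring_1 free_pre_Lie"
  show "free_pre_Lie_mul (x + y) z = free_pre_Lie_mul x z + free_pre_Lie_mul y z"
    by transfer (simp add: klinear_add[OF klinear_mag_mul_left[OF klinear_ident]] pre_Lie_ideal.zero)
  show "free_pre_Lie_mul z (x + y) = free_pre_Lie_mul z x + free_pre_Lie_mul z y"
    by transfer (simp add: klinear_add[OF klinear_mag_mul_right[OF klinear_ident]] pre_Lie_ideal.zero)
  show "free_pre_Lie_mul (free_pre_Lie_mul x y) z - free_pre_Lie_mul x (free_pre_Lie_mul y z)
    = free_pre_Lie_mul (free_pre_Lie_mul x z) y - free_pre_Lie_mul x (free_pre_Lie_mul z y)"
  proof transfer
    fix x y z :: "mag_term \<Rightarrow>\<^sub>0 'k"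
    show "mag_mul (mag_mul x y) z - mag_mul x (mag_mul y z)
        - (mag_mul (mag_mul x z) y - mag_mul x (mag_mul z y)) \<in> pre_Lie_ideal"
      using pre_Lie_relation_in_ideal[of x y z] by (simp add: pre_Lie_relation_def algebra_simps)
  qed
qed

section \<open>The operadic ideal of the pre-Lie relation\<close>

lemma keys_add_subset: "keys x \<subseteq> C \<Longrightarrow> keys y \<subseteq> C \<Longrightarrow> keys (x + y) \<subseteq> C"
  using Poly_Mapping.keys_add[of x y] by blast

lemma keys_diff_subset: "keys x \<subseteq> C \<Longrightarrow> keys y \<subseteq> C \<Longrightarrow> keys (x - y) \<subseteq> C"
  using keys_diff[of x y] by blast

lemma keys_relation_instance:
  "relation_instance xs g \<Longrightarrow> keys g \<subseteq> {t. mset (term_vars t) = mset xs}"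
proof (induction rule: relation_instance.induct)
  case (base a b c)
  then show ?case unfolding pre_Lie_relation_def mag_mul_basis
    by (intro keys_add_subset keys_diff_subset keys_basis_subset) simp_all
next
  case (left xs g s)
  then show ?case unfolding mag_mul_def
    by (intro keys_bilinear[of _ "{s}"]) auto
next
  case (right xs g s)
  then show ?case unfolding mag_mul_def
    by (intro keys_bilinear[OF _ , where C = "{s}"]) auto
qed

text \<open>
  The linear extensions of relabelling and of substitution for one variable.
\<close>

abbreviation relabel_elem :: "(nat \<Rightarrow> nat) \<Rightarrow> (mag_term \<Rightarrow>\<^sub>0 'k::comm_ring_1) \<Rightarrow> (mag_term \<Rightarrow>\<^sub>0 'k)" where
  "relabel_elem \<rho> \<equiv> linear_ext (\<lambda>t. basis_elem (term_relabel \<rho> t))"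

definition subst_elem ::
  "nat \<Rightarrow> (mag_term \<Rightarrow>\<^sub>0 'k::comm_ring_1) \<Rightarrow> (mag_term \<Rightarrow>\<^sub>0 'k) \<Rightarrow> (mag_term \<Rightarrow>\<^sub>0 'k)" where
  "subst_elem i = bilinear_ext (\<lambda>t s. basis_elem (term_subst (\<lambda>j. if j = i then s else Var j) t))"

lemma term_subst_fresh: "i \<notin> set (term_vars t) \<Longrightarrow> term_subst (\<lambda>j. if j = i then s else Var j) t = t"
  by (induction t) auto

text \<open>
  An operadic ideal that contains the pre-Lie relator.
\<close>

locale pre_Lie_operad_ideal =
  fixes I :: "nat \<Rightarrow> (mag_term \<Rightarrow>\<^sub>0 'k::comm_ring_1) set"
  assumes ideal: "operad_ideal (ring_of_type_algebra :: 'k ring) free_magmatic_operad I"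
    and relator: "pre_Lie_relator \<in> I 3"
begin

lemma submod:
  assumes "n \<ge> 1"
  shows "submodule (I n) (ring_of_type_algebra :: 'k ring) (free_module (multilinear_terms n))"
  using ideal assms by (simp add: operad_ideal_def sym_submodule_def)

lemma I_closed:
  assumes n: "n \<ge> 1"
  shows "0 \<in> I n" "x \<in> I n \<Longrightarrow> y \<in> I n \<Longrightarrow> x + y \<in> I n" "x \<in> I n \<Longrightarrow> scale a x \<in> I n"
proof -
  have sub: "subgroup (I n) (add_monoid (free_module (multilinear_terms n) :: ('k, mag_term \<Rightarrow>\<^sub>0 'k) module))"
    using submod[OF n] by (rule submodule.axioms)
  show "0 \<in> I n" using subgroup.one_closed[OF sub] by simp
  show "x + y \<in> I n" if "x \<in> I n" "y \<in> I n" using subgroup.m_closed[OF sub that] by simp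
  show "scale a x \<in> I n" if "x \<in> I n" using submodule.smult_closed[OF submod[OF n], of a x] that by simp
qed

lemma I_act: "n \<ge> 1 \<Longrightarrow> \<sigma> permutes {1..n} \<Longrightarrow> x \<in> I n \<Longrightarrow> relabel_elem \<sigma> x \<in> I n"
  using ideal by (simp add: operad_ideal_def sym_submodule_def)

lemma I_comp:
  assumes "n \<ge> 1" "m \<ge> 1" "i \<in> {1..n}" "keys x \<subseteq> multilinear_terms n" "keys y \<subseteq> multilinear_terms m"
    and "x \<in> I n \<or> y \<in> I m"
  shows "bilinear_ext (\<lambda>t s. basis_elem (term_comp m i t s)) x y \<in> I (n + m - 1)"
proof -
  have "\<forall>n\<ge>1. \<forall>m\<ge>1. \<forall>i\<in>{1..n}. \<forall>x\<in>carrier (op_mod (free_magmatic_operad :: ('k, _) operad) n).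
      \<forall>y\<in>carrier (op_mod (free_magmatic_operad :: ('k, _) operad) m).
        x \<in> I n \<or> y \<in> I m \<longrightarrow> op_comp free_magmatic_operad n m i x y \<in> I (n + m - 1)"
    using ideal unfolding operad_ideal_def by blast
  note closed = this
  have "op_comp free_magmatic_operad n m i x y \<in> I (n + m - 1)"
    by (rule closed[rule_format]) (use assms in simp_all)
  then show ?thesis by simp
qed

text \<open>The ideal transported to elements whose variables are those of a finite set \<open>A\<close>.\<close>

definition in_ideal :: "nat set \<Rightarrow> (mag_term \<Rightarrow>\<^sub>0 'k) \<Rightarrow> bool" where
  "in_ideal A x \<longleftrightarrow> keys x \<subseteq> monomials A \<and>
     (\<exists>\<beta>. bij_betw \<beta> A {1..card A} \<and> relabel_elem \<beta> x \<in> I (card A))"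

text \<open>
  By invariance under the symmetric groups, the choice of the numbering of \<open>A\<close> does not matter.
\<close>

lemma in_ideal_any:
  assumes x: "in_ideal A x" and A: "finite A" "A \<noteq> {}" and \<gamma>: "bij_betw \<gamma> A {1..card A}"
  shows "relabel_elem \<gamma> x \<in> I (card A)"
proof -
  let ?n = "card A"
  have n: "?n \<ge> 1" using A by (simp add: Suc_leI card_gt_0_iff One_nat_def)
  obtain \<beta> where \<beta>: "bij_betw \<beta> A {1..?n}" "relabel_elem \<beta> x \<in> I ?n"
    and k: "keys x \<subseteq> monomials A"
    using x by (auto simp: in_ideal_def)
  define \<sigma> where "\<sigma> p = (if p \<in> {1..?n} then \<gamma> (inv_into A \<beta> p) else p)" for p
  have "bij_betw (\<gamma> \<circ> inv_into A \<beta>) {1..?n} {1..?n}"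
    using bij_betw_trans[OF bij_betw_inv_into[OF \<beta>(1)] \<gamma>] .
  moreover have "(\<gamma> \<circ> inv_into A \<beta>) p = \<sigma> p" if "p \<in> {1..?n}" for p
    using that by (simp add: \<sigma>_def)
  ultimately have "bij_betw \<sigma> {1..?n} {1..?n}"
    using bij_betw_cong[of "{1..?n}" "\<gamma> \<circ> inv_into A \<beta>" \<sigma>] by blast
  then have \<sigma>: "\<sigma> permutes {1..?n}" by (rule bij_imp_permutes) (auto simp: \<sigma>_def)
  have "relabel_elem \<sigma> (relabel_elem \<beta> x) = relabel_elem \<gamma> x"
  proof (rule klinear_cong[OF klinear_lin[OF klinear_linear_ext] klinear_linear_ext k])
    fix t assume t: "t \<in> monomials A"
    have "\<sigma> (\<beta> j) = \<gamma> j" if "j \<in> A" for j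
      using that \<beta>(1) bij_betwE[OF \<beta>(1)] by (simp add: \<sigma>_def bij_betw_def)
    then have "term_relabel \<sigma> (term_relabel \<beta> t) = term_relabel \<gamma> t"
      unfolding term_relabel_relabel using t by (intro term_relabel_cong) (simp add: monomials_def)
    then show "relabel_elem \<sigma> (relabel_elem \<beta> (basis_elem t)) = (relabel_elem \<gamma> (basis_elem t) :: _ \<Rightarrow>\<^sub>0 'k)"
      by simp
  qed
  then show ?thesis using I_act[OF n \<sigma> \<beta>(2)] by simp
qed

text \<open>
  Up to numberings of the variables, a substitution is a partial composition.
\<close>

lemma in_ideal_subst:
  assumes A: "finite A" "i \<in> A" and B: "finite B" "B \<noteq> {}" "(A - {i}) \<inter> B = {}"
    and x: "keys x \<subseteq> monomials A" and y: "keys y \<subseteq> monomials B"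
    and xy: "in_ideal A x \<or> in_ideal B y"
  shows "in_ideal (A - {i} \<union> B) (subst_elem i x y)"
proof -
  let ?n = "card A" and ?m = "card B" and ?C = "A - {i} \<union> B"
  have "?n \<noteq> 0" "?m \<noteq> 0" using A B by (auto simp: card_eq_0_iff)
  then have n: "?n \<ge> 1" "?m \<ge> 1" by linarith+
  obtain \<gamma> where \<gamma>: "bij_betw \<gamma> A {1..?n}" using ex_bij_betw_finite_nat[OF A(1)]
    by (metis One_nat_def atLeastLessThanSuc_atLeastAtMost bij_betw_iff_card card_atLeastAtMost diff_Suc_1 finite_atLeastAtMost A(1))
  obtain \<beta> where \<beta>: "bij_betw \<beta> B {1..?m}" using ex_bij_betw_finite_nat[OF B(1)]
    by (metis One_nat_def atLeastLessThanSuc_atLeastAtMost bij_betw_iff_card card_atLeastAtMost diff_Suc_1 finite_atLeastAtMost B(1))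
  have \<gamma>i: "\<gamma> i \<in> {1..?n}" using bij_betwE[OF \<gamma>] A(2) by blast
  have \<gamma>inj: "\<gamma> k = \<gamma> i \<longleftrightarrow> k = i" if "k \<in> A" for k
    using bij_betw_imp_inj_on[OF \<gamma>] that A(2) by (auto dest: inj_onD)
  define \<delta> where "\<delta> j = (if j \<in> B then inner_label (\<gamma> i) (\<beta> j) else outer_label ?m (\<gamma> i) (\<gamma> j))" for j
  have card: "card ?C = ?n + ?m - 1"
    using A B n by (subst card_Un_disjoint) auto
  have "\<delta> ` ?C = \<delta> ` (A - {i}) \<union> \<delta> ` B" by (rule image_Un)
  also have "\<delta> ` (A - {i}) = outer_label ?m (\<gamma> i) ` \<gamma> ` (A - {i})"
    unfolding image_image using B(3) by (intro image_cong refl) (auto simp: \<delta>_def)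
  also have "\<gamma> ` (A - {i}) = {1..?n} - {\<gamma> i}"
    using \<gamma> \<gamma>inj by (auto simp: bij_betw_def)
  also have "\<delta> ` B = inner_label (\<gamma> i) ` \<beta> ` B"
    unfolding image_image by (intro image_cong refl) (auto simp: \<delta>_def)
  also have "\<beta> ` B = {1..?m}" using \<beta> by (simp add: bij_betw_def)
  also have "outer_label ?m (\<gamma> i) ` ({1..?n} - {\<gamma> i}) \<union> inner_label (\<gamma> i) ` {1..?m} = {1..card ?C}"
    unfolding card by (rule labels_image[OF \<gamma>i n(2)])
  finally have img: "\<delta> ` ?C = {1..card ?C}" .
  then have \<delta>: "bij_betw \<delta> ?C {1..card ?C}"
    using A(1) B(1) by (simp add: bij_betw_def eq_card_imp_inj_on)
  have eq: "bilinear_ext (\<lambda>t s. basis_elem (term_comp ?m (\<gamma> i) t s)) (relabel_elem \<gamma> x) (relabel_elem \<beta> y)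
      = relabel_elem \<delta> (subst_elem i x y)"
    unfolding subst_elem_def
  proof (rule bilinear_cong[OF _ _ _ _ x y])
    fix t s assume t: "t \<in> monomials A" and s: "s \<in> monomials B"
    have "term_comp ?m (\<gamma> i) (term_relabel \<gamma> t) (term_relabel \<beta> s)
        = term_relabel \<delta> (term_subst (\<lambda>j. if j = i then s else Var j) t)"
      unfolding term_comp_def term_comp_relabel_left term_relabel_subst term_relabel_relabel
    proof (rule term_subst_cong)
      fix k assume "k \<in> set (term_vars t)"
      then have k: "k \<in> A" using t by (simp add: monomials_def)
      have "term_relabel (\<lambda>j. inner_label (\<gamma> i) (\<beta> j)) s = term_relabel \<delta> s"
        using s by (intro term_relabel_cong) (simp add: monomials_def \<delta>_def)
      moreover have "k \<notin> B" if "k \<noteq> i" using that k B(3) by auto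
      ultimately show "(if \<gamma> k = \<gamma> i then term_relabel (\<lambda>j. inner_label (\<gamma> i) (\<beta> j)) s
          else Var (outer_label ?m (\<gamma> i) (\<gamma> k))) = term_relabel \<delta> (if k = i then s else Var k)"
        using \<gamma>inj[OF k] by (simp add: \<delta>_def)
    qed
    then show "bilinear_ext (\<lambda>t s. basis_elem (term_comp ?m (\<gamma> i) t s)) (relabel_elem \<gamma> (basis_elem t))
        (relabel_elem \<beta> (basis_elem s))
      = relabel_elem \<delta> (bilinear_ext (\<lambda>t s. basis_elem (term_subst (\<lambda>j. if j = i then s else Var j) t))
          (basis_elem t) (basis_elem s))" by simp
  qed (intro klinear_intros)+
  have kx: "keys (relabel_elem \<gamma> x) \<subseteq> multilinear_terms ?n"
    by (rule keys_klinear[OF klinear_linear_ext x]) (simp add: multilinear_terms_eq relabel_monomials[OF _ \<gamma>])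
  have ky: "keys (relabel_elem \<beta> y) \<subseteq> multilinear_terms ?m"
    by (rule keys_klinear[OF klinear_linear_ext y]) (simp add: multilinear_terms_eq relabel_monomials[OF _ \<beta>])
  have "relabel_elem \<gamma> x \<in> I ?n \<or> relabel_elem \<beta> y \<in> I ?m"
    using xy in_ideal_any[OF _ A(1) _ \<gamma>] in_ideal_any[OF _ B(1,2) \<beta>] A(2) by blast
  then have "relabel_elem \<delta> (subst_elem i x y) \<in> I (card ?C)"
    unfolding eq[symmetric] card using n \<gamma>i kx ky by (intro I_comp)
  moreover have "keys (subst_elem i x y) \<subseteq> monomials ?C"
    unfolding subst_elem_def
  proof (rule keys_bilinear[OF x y])
    fix t s assume t: "t \<in> monomials A" and s: "s \<in> monomials B"
    have "set (term_vars (term_subst (\<lambda>j. if j = i then s else Var j) t)) = ?C"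
      using t s A(2) by (auto simp: monomials_def set_term_vars_subst split: if_splits)
    moreover have "distinct (term_vars (term_subst (\<lambda>j. if j = i then s else Var j) t))"
      using t s B(3) by (intro distinct_term_vars_subst) (auto simp: monomials_def)
    ultimately show "keys (basis_elem (term_subst (\<lambda>j. if j = i then s else Var j) t) :: _ \<Rightarrow>\<^sub>0 'k) \<subseteq> monomials ?C"
      by (simp add: monomials_def)
  qed
  ultimately show ?thesis using \<delta> by (auto simp: in_ideal_def)
qed

lemma in_ideal_relator:
  assumes "distinct [u, v, w]"
  shows "in_ideal {u, v, w} (pre_Lie_relation (basis_elem (Var u)) (basis_elem (Var v)) (basis_elem (Var w)))"
proof -
  define \<beta> where "\<beta> j = (if j = u then 1 else if j = v then 2 else 3 :: nat)" for j
  have card: "card {u, v, w} = 3" using assms by simp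
  have "\<beta> ` {u, v, w} = {1..3}" using assms by (auto simp: \<beta>_def)
  moreover have "inj_on \<beta> {u, v, w}" using assms by (auto simp: \<beta>_def)
  ultimately have "bij_betw \<beta> {u, v, w} {1..3}" by (simp add: bij_betw_def)
  moreover have "relabel_elem \<beta> (pre_Lie_relation (basis_elem (Var u)) (basis_elem (Var v)) (basis_elem (Var w)))
      = (pre_Lie_relator :: _ \<Rightarrow>\<^sub>0 'k)"
    using assms by (simp add: pre_Lie_relation_def pre_Lie_relator_def klinear_add[OF klinear_linear_ext]
        klinear_diff[OF klinear_linear_ext] \<beta>_def)
  moreover have "keys (pre_Lie_relation (basis_elem (Var u)) (basis_elem (Var v)) (basis_elem (Var w)) :: _ \<Rightarrow>\<^sub>0 'k)
      \<subseteq> monomials {u, v, w}"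
  proof
    fix t assume "t \<in> keys (pre_Lie_relation (basis_elem (Var u)) (basis_elem (Var v)) (basis_elem (Var w)) :: _ \<Rightarrow>\<^sub>0 'k)"
    then have *: "mset (term_vars t) = mset [u, v, w]"
      using keys_relation_instance[OF relation_instance.base[of "Var u" "Var v" "Var w"]] by auto
    then show "t \<in> monomials {u, v, w}"
      using mset_eq_imp_distinct_iff[OF *] mset_eq_setD[OF *] assms by (auto simp: monomials_def)
  qed
  ultimately show ?thesis 
    using relator unfolding in_ideal_def card by (intro conjI exI[of _ \<beta>]) simp_all
qed

lemma term_vars_nonempty: "term_vars t \<noteq> []"
  by (induction t) auto

text \<open>
  An instance arises from the relator in three fresh variables by substitutions for these; a product
  with a monomial \<open>s\<close> is a substitution into a product of \<open>s\<close> with a fresh variable.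
\<close>

lemma relation_instance_in_ideal:
  "relation_instance xs g \<Longrightarrow> distinct xs \<Longrightarrow> in_ideal (set xs) g"
proof (induction rule: relation_instance.induct)
  case (base a b c)
  let ?V = "set (term_vars a @ term_vars b @ term_vars c)"
  obtain u where u: "u \<notin> ?V" using ex_new_if_finite[OF infinite_UNIV_nat finite_set] by blast
  obtain v where v: "v \<notin> insert u ?V"
    using ex_new_if_finite[OF infinite_UNIV_nat, of "insert u ?V"] by blast
  obtain w where w: "w \<notin> insert v (insert u ?V)"
    using ex_new_if_finite[OF infinite_UNIV_nat, of "insert v (insert u ?V)"] by blast
  have mono: "keys (basis_elem t :: _ \<Rightarrow>\<^sub>0 'k) \<subseteq> monomials (set (term_vars t))" if "distinct (term_vars t)" for t
    using that by (simp add: monomials_def)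
  have d: "distinct (term_vars a)" "distinct (term_vars b)" "distinct (term_vars c)" using base by auto
  let ?r = "pre_Lie_relation (basis_elem (Var u)) (basis_elem (Var v)) (basis_elem (Var w)) :: _ \<Rightarrow>\<^sub>0 'k"
  have lin: "subst_elem i (x - y) z = subst_elem i x z - subst_elem i y z"
     "subst_elem i (x + y) z = subst_elem i x z + subst_elem i y z" for i and x y z :: "_ \<Rightarrow>\<^sub>0 'k"
    unfolding subst_elem_def by (rule klinear_diff klinear_add, rule klinear_bilinear_ext_left)+
  have sb: "subst_elem i (basis_elem s) (basis_elem t)
      = (basis_elem (term_subst (\<lambda>j. if j = i then t else Var j) s) :: _ \<Rightarrow>\<^sub>0 'k)" for i s t
    by (simp add: subst_elem_def)
  have 1: "in_ideal {u, v, w} ?r" using u v w by (intro in_ideal_relator) auto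
  have 2: "in_ideal ({u, v, w} - {u} \<union> set (term_vars a)) (subst_elem u ?r (basis_elem a))"
    by (rule in_ideal_subst) (use 1 mono[OF d(1)] term_vars_nonempty u v w in \<open>auto simp: in_ideal_def\<close>)
  have 3: "in_ideal ({u, v, w} - {u} \<union> set (term_vars a) - {v} \<union> set (term_vars b))
      (subst_elem v (subst_elem u ?r (basis_elem a)) (basis_elem b))"
    by (rule in_ideal_subst) (use 2 mono[OF d(2)] term_vars_nonempty base u v w in \<open>auto simp: in_ideal_def\<close>)
  have 4: "in_ideal ({u, v, w} - {u} \<union> set (term_vars a) - {v} \<union> set (term_vars b) - {w} \<union> set (term_vars c))
      (subst_elem w (subst_elem v (subst_elem u ?r (basis_elem a)) (basis_elem b)) (basis_elem c))"
    by (rule in_ideal_subst) (use 3 mono[OF d(3)] term_vars_nonempty base u v w in \<open>auto simp: in_ideal_def\<close>)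
  have "subst_elem w (subst_elem v (subst_elem u ?r (basis_elem a)) (basis_elem b)) (basis_elem c)
      = pre_Lie_relation (basis_elem a) (basis_elem b) (basis_elem c)"
    using u v w by (simp add: pre_Lie_relation_def lin sb term_subst_fresh)
  moreover have "{u, v, w} - {u} \<union> set (term_vars a) - {v} \<union> set (term_vars b) - {w} \<union> set (term_vars c) = ?V"
    using u v w by auto
  ultimately show ?case using 4 by simp
next
  case (left xs g s)
  then have g: "in_ideal (set xs) g" by simp
  have ne: "xs \<noteq> []"
    using left.hyps by (induction rule: relation_instance.induct) (auto simp: term_vars_nonempty)
  obtain v where v: "v \<notin> set (term_vars s)" using ex_new_if_finite[OF infinite_UNIV_nat finite_set] by blast
  have gk: "keys g \<subseteq> monomials (set xs)" using g by (simp add: in_ideal_def)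
  have "mag_mul (basis_elem s) g = subst_elem v (basis_elem (Prod s (Var v))) g"
    unfolding mag_mul_def subst_elem_def
    by (rule klinear_cong[OF klinear_bilinear_ext_right klinear_bilinear_ext_right gk])
      (simp add: term_subst_fresh[OF v])
  moreover have "in_ideal (insert v (set (term_vars s)) - {v} \<union> set xs) (subst_elem v (basis_elem (Prod s (Var v))) g)"
    by (rule in_ideal_subst) (use g gk ne v left.prems in \<open>auto simp: monomials_def\<close>)
  moreover have "insert v (set (term_vars s)) - {v} \<union> set xs = set (term_vars s @ xs)" using v by auto
  ultimately show ?case by simp
next
  case (right xs g s)
  then have g: "in_ideal (set xs) g" by simp
  have ne: "xs \<noteq> []"
    using right.hyps by (induction rule: relation_instance.induct) (auto simp: term_vars_nonempty)
  obtain v where v: "v \<notin> set (term_vars s)" using ex_new_if_finite[OF infinite_UNIV_nat finite_set] by blast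
  have gk: "keys g \<subseteq> monomials (set xs)" using g by (simp add: in_ideal_def)
  have "mag_mul g (basis_elem s) = subst_elem v (basis_elem (Prod (Var v) s)) g"
    unfolding mag_mul_def subst_elem_def
    by (rule klinear_cong[OF klinear_bilinear_ext_left klinear_bilinear_ext_right gk])
      (simp add: term_subst_fresh[OF v])
  moreover have "in_ideal (insert v (set (term_vars s)) - {v} \<union> set xs) (subst_elem v (basis_elem (Prod (Var v) s)) g)"
    by (rule in_ideal_subst) (use g gk ne v right.prems in \<open>auto simp: monomials_def\<close>)
  moreover have "insert v (set (term_vars s)) - {v} \<union> set xs = set (xs @ term_vars s)" using v by auto
  ultimately show ?case by simp
qed

text \<open>
  Every instance is homogeneous in the variables, so the projection \<open>pr\<close> onto the multilinear part
  either fixes it or annihilates it.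
\<close>

lemma pre_Lie_ideal_multilinear:
  assumes "x \<in> pre_Lie_ideal" "keys x \<subseteq> multilinear_terms n" "n \<ge> 1"
  shows "x \<in> I n"
proof -
  define pr :: "(mag_term \<Rightarrow>\<^sub>0 'k) \<Rightarrow> (mag_term \<Rightarrow>\<^sub>0 'k)" where
    "pr = linear_ext (\<lambda>t. if t \<in> multilinear_terms n then basis_elem t else 0)"
  have lin: "klinear pr" unfolding pr_def by (rule klinear_linear_ext)
  have id: "pr y = y" if "keys y \<subseteq> multilinear_terms n" for y
    using klinear_cong[OF lin klinear_ident that] by (simp add: pr_def)
  have "pr x \<in> I n" using assms(1)
  proof (induction rule: pre_Lie_ideal.induct)
    case zero
    then show ?case using I_closed[OF assms(3)] by (simp add: klinear_0[OF lin])
  next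
    case (add x y)
    then show ?case using I_closed[OF assms(3)] by (simp add: klinear_add[OF lin])
  next
    case (inst xs g a)
    have k: "keys g \<subseteq> {t. mset (term_vars t) = mset xs}" by (rule keys_relation_instance[OF inst])
    have "pr g \<in> I n"
    proof (cases "distinct xs \<and> set xs = {1..n}")
      case True
      then have g: "in_ideal {1..n} g" using relation_instance_in_ideal[OF inst] by auto
      then have gk: "keys g \<subseteq> multilinear_terms n" by (simp add: in_ideal_def multilinear_terms_eq)
      have "relabel_elem (\<lambda>j. j) g \<in> I (card {1..n})"
        using assms(3) by (intro in_ideal_any[OF g]) (auto simp: bij_betw_def)
      moreover have "relabel_elem (\<lambda>j. j) g = g"
        by (rule klinear_cong[OF klinear_linear_ext klinear_ident gk]) (simp add: term_relabel_def)
      ultimately show ?thesis using id[OF gk] by simp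
    next
      case False
      have "t \<notin> multilinear_terms n" if "t \<in> keys g" for t
      proof -
        have "mset (term_vars t) = mset xs" using k that by auto
        then show ?thesis using False mset_eq_setD mset_eq_imp_distinct_iff
          by (metis (mono_tags, lifting) mem_Collect_eq multilinear_terms_def)
      qed
      then have "pr g = 0" by (simp add: pr_def linear_ext_def)
      then show ?thesis using I_closed[OF assms(3)] by simp
    qed
    then show ?case using I_closed[OF assms(3)] by (simp add: klinear_scale[OF lin])
  qed
  then show ?thesis using id[OF assms(2)] by simp
qed

end

section \<open>From monomials to rooted trees\<close>

text \<open>
  The map \<open>\<Phi>\<close> from the free magmatic operad to the operad of rooted trees.
\<close>

definition tree_expansion :: "(mag_term \<Rightarrow>\<^sub>0 'k::comm_ring_1) \<Rightarrow> (rtree \<Rightarrow>\<^sub>0 'k)" where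
  "tree_expansion = linear_ext (\<lambda>t. tree_sum t (\<lambda>T. basis_elem (to_rtree T)))"

lemma klinear_tree_expansion: "klinear f \<Longrightarrow> klinear (\<lambda>x. tree_expansion (f x))"
  unfolding tree_expansion_def by (rule klinear_lin)

lemmas klinear_tree_expansion' = klinear_tree_expansion[OF klinear_ident]

lemma tree_expansion_basis [simp]:
  "tree_expansion (basis_elem t) = tree_sum t (\<lambda>T. basis_elem (to_rtree T))"
  by (simp add: tree_expansion_def)

lemma tree_sum_klinear:
  assumes "klinear h" shows "h (tree_sum t g) = tree_sum t (\<lambda>T. h (g T))"
  by (rule tree_sum_hom) (simp_all add: klinear_0[OF assms] klinear_add[OF assms])

lemma tree_sum_bilinear:
  "bilinear_ext g (tree_sum s (\<lambda>T. basis_elem (p T))) (tree_sum t (\<lambda>S. basis_elem (q S)))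
     = tree_sum s (\<lambda>T. tree_sum t (\<lambda>S. g (p T) (q S)))"
proof -
  have "bilinear_ext g (tree_sum s (\<lambda>T. basis_elem (p T))) y
      = tree_sum s (\<lambda>T. bilinear_ext g (basis_elem (p T)) y)" for y
    by (rule tree_sum_klinear[OF klinear_bilinear_ext_left])
  moreover have "bilinear_ext g x (tree_sum t (\<lambda>S. basis_elem (q S)))
      = tree_sum t (\<lambda>S. bilinear_ext g x (basis_elem (q S)))" for x
    by (rule tree_sum_klinear[OF klinear_bilinear_ext_right])
  ultimately show ?thesis by (simp add: tree_sum_swap[of t s])
qed

lemma tree_sum_closed:
  assumes "distinct (term_vars t)" "P 0" "\<And>x y. P x \<Longrightarrow> P y \<Longrightarrow> P (x + y)"
    and "\<And>T. arc_tree T \<Longrightarrow> verts T = set (term_vars t) \<Longrightarrow> P (g T)"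
  shows "P (tree_sum t g)"
  using assms(1,4)
proof (induction t arbitrary: g)
  case (Var j)
  then show ?case by (simp add: arc_tree_single)
next
  case (Prod s t)
  have sum: "P (\<Sum>v\<in>V. f v)" if "\<And>v. v \<in> V \<Longrightarrow> P (f v)" for V and f :: "nat \<Rightarrow> 'a"
    using that by (induction V rule: infinite_finite_induct) (simp_all add: assms(2,3))
  have "P (\<Sum>v\<in>verts T. g (graft T S v))"
    if "arc_tree T" "verts T = set (term_vars s)" "arc_tree S" "verts S = set (term_vars t)" for T S
    using Prod.prems(1) that by (intro sum Prod.prems(2) arc_tree_graft) auto
  then show ?case
    using Prod.prems(1) by (auto intro!: Prod.IH)
qed

lemma keys_tree_expansion:
  assumes "keys x \<subseteq> multilinear_terms n"
  shows "keys (tree_expansion x) \<subseteq> rooted_trees n"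
proof (rule keys_klinear[OF klinear_tree_expansion' assms])
  fix t assume "t \<in> multilinear_terms n"
  then show "keys (tree_expansion (basis_elem t) :: _ \<Rightarrow>\<^sub>0 'a) \<subseteq> rooted_trees n"
    unfolding tree_expansion_basis
    by (intro tree_sum_closed[where P = "\<lambda>x. keys x \<subseteq> rooted_trees n"] keys_add_subset)
      (auto simp: multilinear_terms_def to_rtree_in_rooted_trees)
qed

lemma RT_simps [simp]:
  "op_mod RT_operad n = free_module (rooted_trees n)"
  "op_act RT_operad n \<sigma> = linear_ext (\<lambda>T. basis_elem (tree_relabel \<sigma> T))"
  "op_unit RT_operad = basis_elem (RTree {} 1)"
  "op_comp RT_operad n m i = bilinear_ext (tree_comp m i)"
  by (simp_all add: RT_operad_def)

lemma tree_expansion_act: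
  assumes "\<sigma> permutes {1..n}" "keys x \<subseteq> multilinear_terms n"
  shows "tree_expansion (relabel_elem \<sigma> x) = linear_ext (\<lambda>T. basis_elem (tree_relabel \<sigma> T)) (tree_expansion x)"
proof (rule klinear_cong[OF _ _ assms(2)])
  fix t assume t: "t \<in> multilinear_terms n"
  have "inj_on \<sigma> A" for A by (rule inj_on_subset[OF permutes_inj[OF assms(1)]]) simp
  then show "tree_expansion (relabel_elem \<sigma> (basis_elem t))
      = linear_ext (\<lambda>T. basis_elem (tree_relabel \<sigma> T)) (tree_expansion (basis_elem t))"
    using t by (simp add: tree_sum_klinear[OF klinear_linear_ext] term_relabel_def tree_sum_relabel
        multilinear_terms_def tree_relabel_to_rtree)
qed (intro klinear_tree_expansion klinear_intros klinear_tree_expansion')+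

lemma tree_expansion_comp:
  assumes i: "i \<in> {1..n}" and m: "m \<ge> 1" and x: "keys x \<subseteq> multilinear_terms n" and y: "keys y \<subseteq> multilinear_terms m"
  shows "tree_expansion (bilinear_ext (\<lambda>t s. basis_elem (term_comp m i t s)) x y)
    = bilinear_ext (tree_comp m i) (tree_expansion x) (tree_expansion y)"
proof (rule bilinear_cong[OF _ _ _ _ x y])
  fix t s assume "t \<in> multilinear_terms n" "s \<in> multilinear_terms m"
  then have t: "distinct (term_vars t)" "set (term_vars t) = {1..n}"
    and s: "distinct (term_vars s)" "set (term_vars s) = {1..m}" by (auto simp: multilinear_terms_def)
  have i1: "i \<ge> 1" using i by simp
  have inj: "inj_on (outer_label m i) A" "inj_on (inner_label i) A" for A
    using inj_outer_label[OF m] inj_inner_label[OF i1] by (auto simp: inj_on_def)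
  let ?s = "term_relabel (inner_label i) s"
  have s': "distinct (term_vars ?s)" "set (term_vars ?s) = inner_label i ` {1..m}"
    using s inj by (simp_all add: term_vars_relabel distinct_map)
  have "tree_sum (term_comp m i t s) g = tree_sum t (\<lambda>T. tree_sum ?s (\<lambda>S.
      \<Sum>f\<in>children (fst T) i \<rightarrow>\<^sub>E verts S. g (subst_tree (outer_label m i) i f T S)))"
    for g :: "arcs \<times> nat \<Rightarrow> rtree \<Rightarrow>\<^sub>0 'a"
    unfolding term_comp_def
    by (rule tree_sum_subst) (use i t s' inj outer_inner_disjoint[OF i1] in auto)
  then have "tree_sum (term_comp m i t s) (\<lambda>T. basis_elem (to_rtree T) :: _ \<Rightarrow>\<^sub>0 'a)
      = tree_sum t (\<lambda>T. tree_sum s (\<lambda>S. \<Sum>f\<in>children (fst T) i \<rightarrow>\<^sub>E verts (map_tree (inner_label i) S).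
          basis_elem (to_rtree (subst_tree (outer_label m i) i f T (map_tree (inner_label i) S)))))"
    by (simp only: term_relabel_def tree_sum_relabel[OF inj(2) s(1)])
  also have "\<dots> = tree_sum t (\<lambda>T. tree_sum s (\<lambda>S. tree_comp m i (to_rtree T) (to_rtree S)))"
    using s i1 by (intro tree_sum_cong t s tree_comp_to_rtree[symmetric]) auto
  finally show "tree_expansion (bilinear_ext (\<lambda>t s. basis_elem (term_comp m i t s)) (basis_elem t) (basis_elem s))
    = (bilinear_ext (tree_comp m i) (tree_expansion (basis_elem t)) (tree_expansion (basis_elem s)) :: _ \<Rightarrow>\<^sub>0 'a)"
    by (simp add: tree_sum_bilinear)
qed (intro klinear_tree_expansion klinear_intros klinear_tree_expansion')+

section \<open>Every rooted tree is an expansion\<close>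

text \<open>
  The inverse of \<open>to_rtree\<close>.
\<close>

definition of_rtree :: "rtree \<Rightarrow> arcs \<times> nat" where
  "of_rtree R = (tree_arcs R, tree_root R)"

lemma of_rtree_to_rtree [simp]: "arc_tree T \<Longrightarrow> of_rtree (to_rtree T) = T"
  by (simp add: of_rtree_def tree_arcs_to_rtree)

lemma tree_expansion_mul:
  assumes x: "keys x \<subseteq> monomials A" and y: "keys y \<subseteq> monomials B"
  shows "tree_expansion (mag_mul x y) = bilinear_ext
    (\<lambda>R R'. \<Sum>v\<in>verts (of_rtree R). basis_elem (to_rtree (graft (of_rtree R) (of_rtree R') v)))
    (tree_expansion x) (tree_expansion y)"
  unfolding mag_mul_def
proof (rule bilinear_cong[OF _ _ _ _ x y])
  fix s t assume "s \<in> monomials A" "t \<in> monomials B"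
  then show "tree_expansion (bilinear_ext (\<lambda>s t. basis_elem (Prod s t)) (basis_elem s) (basis_elem t))
    = (bilinear_ext (\<lambda>R R'. \<Sum>v\<in>verts (of_rtree R). basis_elem (to_rtree (graft (of_rtree R) (of_rtree R') v)))
      (tree_expansion (basis_elem s)) (tree_expansion (basis_elem t)) :: _ \<Rightarrow>\<^sub>0 'a)"
    by (simp add: tree_sum_bilinear) (intro tree_sum_cong, auto simp: monomials_def)
qed (intro klinear_tree_expansion klinear_intros klinear_tree_expansion')+

text \<open>Cutting a tree above a child \<open>c\<close> of its root.\<close>

lemma arc_tree_split:
  assumes T: "arc_tree T" and c: "(c, snd T) \<in> fst T"
  obtains U S where "arc_tree U" "arc_tree S" "verts U \<inter> verts S = {}" "snd U = snd T" "snd S = c"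
    "graft U S (snd T) = T" "(c, snd T) \<notin> fst U"
proof -
  define r where "r = snd T"
  define A where "A = fst T"
  define D where "D = {v. (v, c) \<in> A\<^sup>*}"
  have T': "finite A" "single_valued A" "r \<notin> Domain A" "(c, r) \<in> A"
    "\<And>v. v \<in> verts T \<union> Range A \<Longrightarrow> (v, r) \<in> A\<^sup>*"
    using T c by (auto simp: arc_tree_def A_def r_def)
  have acyc: "(v, v) \<notin> A\<^sup>+" for v using arc_tree_acyclic[OF T] by (simp add: acyclic_def A_def)
  have down: "u \<in> D" if "(u, v) \<in> A" "v \<in> D" for u v
    using that by (auto simp: D_def)
  have up: "v \<in> D" if "(u, v) \<in> A" "u \<in> D" "u \<noteq> c" for u v
    using that T'(2) by (auto simp: D_def single_valued_def elim: converse_rtranclE)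
  have cr: "v = r" if "(c, v) \<in> A" for v using that T'(2,4) by (auto simp: single_valued_def)
  have rD: "r \<notin> D" using T'(4) acyc[of r] by (auto simp: D_def dest: rtrancl_into_trancl1)
  have cD: "c \<in> D" by (simp add: D_def)
  define U where "U = ({(u, v) \<in> A. u \<notin> D}, r)"
  define S where "S = ({(u, v) \<in> A. u \<in> D \<and> u \<noteq> c}, c)"
  have vU: "verts U \<inter> D = {}" using rD by (auto simp: verts_def U_def)
  have vS: "verts S \<subseteq> D" using cD by (auto simp: verts_def S_def)
  have "arc_tree U"
  proof -
    have reach: "(v, r) \<in> (fst U)\<^sup>*" if "(v, r) \<in> A\<^sup>*" "v \<notin> D" for v
      using that
    proof (induction rule: converse_rtrancl_induct)
      case (step u v)
      then have "v \<notin> D" "(u, v) \<in> fst U" using down[OF step.hyps(1)] by (auto simp: U_def)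
      then show ?case using step.IH by (meson converse_rtrancl_into_rtrancl)
    qed simp
    have "\<forall>v \<in> verts U \<union> Range (fst U). (v, snd U) \<in> (fst U)\<^sup>*"
    proof
      fix v assume v: "v \<in> verts U \<union> Range (fst U)"
      have "v \<notin> D" using v vU down by (auto simp: U_def)
      moreover have "v = r \<or> v \<in> verts T \<union> Range A" using v by (auto simp: U_def verts_def A_def r_def)
      then have "(v, r) \<in> A\<^sup>*" using T'(5) by auto
      ultimately show "(v, snd U) \<in> (fst U)\<^sup>*" using reach by (simp add: U_def)
    qed
    moreover have "finite (fst U)" by (rule finite_subset[OF _ T'(1)]) (auto simp: U_def)
    moreover have "single_valued (fst U)" using T'(2) by (auto simp: U_def single_valued_def)
    moreover have "snd U \<notin> Domain (fst U)" using T'(3) by (auto simp: U_def)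
    ultimately show ?thesis unfolding arc_tree_def by blast
  qed
  moreover have "arc_tree S"
  proof -
    have reach: "(v, c) \<in> (fst S)\<^sup>*" if "(v, c) \<in> A\<^sup>*" for v
      using that
    proof (induction rule: converse_rtrancl_induct)
      case (step u v)
      then have "u \<noteq> c" using acyc[of c] by (auto dest: rtrancl_into_trancl2)
      moreover have "u \<in> D" using step.hyps by (auto simp: D_def)
      ultimately have "(u, v) \<in> fst S" using step.hyps(1) by (simp add: S_def)
      then show ?case using step.IH by (meson converse_rtrancl_into_rtrancl)
    qed simp
    have "\<forall>v \<in> verts S \<union> Range (fst S). (v, snd S) \<in> (fst S)\<^sup>*"
    proof
      fix v assume v: "v \<in> verts S \<union> Range (fst S)"
      have "v \<in> D" using v vS up by (auto simp: S_def)
      then show "(v, snd S) \<in> (fst S)\<^sup>*" using reach[of v] by (simp add: S_def D_def)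
    qed
    moreover have "finite (fst S)" by (rule finite_subset[OF _ T'(1)]) (auto simp: S_def)
    moreover have "single_valued (fst S)" using T'(2) by (auto simp: S_def single_valued_def)
    moreover have "snd S \<notin> Domain (fst S)" by (auto simp: S_def)
    ultimately show ?thesis unfolding arc_tree_def by blast
  qed
  moreover have "graft U S (snd T) = T"
  proof -
    have "insert (c, r) (fst U \<union> fst S) = A"
      using T'(4) cD by (auto simp: U_def S_def dest: cr)
    then show ?thesis by (simp add: graft_def U_def S_def A_def r_def)
  qed
  ultimately show ?thesis
    using that[of U S] vU vS cD by (auto simp: U_def S_def r_def)
qed

text \<open>
  The image of \<open>\<Phi>\<close> on the multilinear elements in the variables of \<open>A\<close>.
\<close>

definition expansions :: "nat set \<Rightarrow> (rtree \<Rightarrow>\<^sub>0 'k::comm_ring_1) set" where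
  "expansions A = tree_expansion ` {x. keys x \<subseteq> monomials A}"

lemma expansions_0: "0 \<in> expansions A"
  unfolding expansions_def using klinear_0[OF klinear_tree_expansion'] by (intro image_eqI[of _ _ 0]) auto

lemma expansions_add: "u \<in> expansions A \<Longrightarrow> v \<in> expansions A \<Longrightarrow> u + v \<in> expansions A"
  unfolding expansions_def
  by (auto intro!: imageI simp: keys_add_subset simp flip: klinear_add[OF klinear_tree_expansion'])

lemma expansions_diff: "u \<in> expansions A \<Longrightarrow> v \<in> expansions A \<Longrightarrow> u - v \<in> expansions A"
  unfolding expansions_def
  by (auto intro!: imageI simp: keys_diff_subset simp flip: klinear_diff[OF klinear_tree_expansion'])

lemma expansions_scale: "u \<in> expansions A \<Longrightarrow> scale a u \<in> expansions A"
  unfolding expansions_def using keys_scale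
  by (fastforce simp flip: klinear_scale[OF klinear_tree_expansion'])

lemma expansions_sum: "(\<And>i. i \<in> J \<Longrightarrow> f i \<in> expansions A) \<Longrightarrow> (\<Sum>i\<in>J. f i) \<in> expansions A"
  by (induction J rule: infinite_finite_induct) (simp_all add: expansions_0 expansions_add)

text \<open>
  The induction is on the number of vertices and then on the number of children of the root.
\<close>

lemma arc_tree_in_expansions:
  "arc_tree T \<Longrightarrow> (basis_elem (to_rtree T) :: _ \<Rightarrow>\<^sub>0 'k::comm_ring_1) \<in> expansions (verts T)"
proof (induction T rule: wf_induct_rule[OF wf_measures[of "[\<lambda>T. card (verts T), \<lambda>T. card (children (fst T) (snd T))]"]])
  case (1 T)
  note T = 1(2)
  show ?case
  proof (cases "children (fst T) (snd T) = {}")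
    case True
    have "fst T = {}"
    proof (rule ccontr)
      assume "fst T \<noteq> {}"
      then obtain u v where "(u, v) \<in> fst T" by auto
      then have "(u, snd T) \<in> (fst T)\<^sup>*" "u \<noteq> snd T"
        using T arc_in_verts[OF T] root_no_arc[OF T] by (auto simp: arc_tree_def)
      then show False using True by (auto simp: children_def elim: rtranclE)
    qed
    then have "T = ({}, snd T)" by (simp add: prod_eq_iff)
    then obtain r where r: "T = ({}, r)" by blast
    have "tree_expansion (basis_elem (Var r)) = (basis_elem (to_rtree T) :: _ \<Rightarrow>\<^sub>0 'k)"
      by (simp add: r)
    then show ?thesis
      unfolding expansions_def r by (intro image_eqI[of _ _ "basis_elem (Var r)"]) (auto simp: monomials_def)
  next
    case False
    then obtain c where c: "(c, snd T) \<in> fst T" by (auto simp: children_def)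
    obtain U S where US: "arc_tree U" "arc_tree S" "verts U \<inter> verts S = {}" "snd U = snd T" "snd S = c"
        "graft U S (snd T) = T" "(c, snd T) \<notin> fst U"
      by (rule arc_tree_split[OF T c])
    have vT: "verts T = verts U \<union> verts S" using US(6) by (metis verts_graft)
    have fin: "finite (verts U)" "finite (verts S)" using US finite_verts by auto
    have ne: "card (verts U) > 0" "card (verts S) > 0"
      using fin root_in_verts[of U] root_in_verts[of S] by (auto simp: card_gt_0_iff)
    have cardT: "card (verts T) = card (verts U) + card (verts S)"
      unfolding vT using fin US(3) by (rule card_Un_disjoint)
    have "basis_elem (to_rtree U) \<in> (expansions (verts U) :: (rtree \<Rightarrow>\<^sub>0 'k) set)"
      using cardT ne by (intro 1(1) US) simp
    then obtain x where x: "tree_expansion x = (basis_elem (to_rtree U) :: _ \<Rightarrow>\<^sub>0 'k)" "keys x \<subseteq> monomials (verts U)"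
      by (auto simp: expansions_def)
    have "basis_elem (to_rtree S) \<in> (expansions (verts S) :: (rtree \<Rightarrow>\<^sub>0 'k) set)"
      using cardT ne by (intro 1(1) US) simp
    then obtain y where y: "tree_expansion y = (basis_elem (to_rtree S) :: _ \<Rightarrow>\<^sub>0 'k)" "keys y \<subseteq> monomials (verts S)"
      by (auto simp: expansions_def)
    have "keys (mag_mul x y) \<subseteq> monomials (verts T)"
      unfolding mag_mul_def vT
      by (rule keys_bilinear[OF x(2) y(2)]) (use US(3) in \<open>auto simp: monomials_def\<close>)
    then have "tree_expansion (mag_mul x y) \<in> (expansions (verts T) :: (rtree \<Rightarrow>\<^sub>0 'k) set)"
      by (auto simp: expansions_def)
    also have "tree_expansion (mag_mul x y) = (\<Sum>v\<in>verts U. basis_elem (to_rtree (graft U S v)) :: _ \<Rightarrow>\<^sub>0 'k)"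
      using US by (simp add: tree_expansion_mul[OF x(2) y(2)] x(1) y(1))
    also have "\<dots> = basis_elem (to_rtree T) + (\<Sum>v\<in>verts U - {snd T}. basis_elem (to_rtree (graft U S v)))"
      using fin US root_in_verts[of U] by (subst sum.remove[of _ "snd T"]) auto
    finally have main: "basis_elem (to_rtree T) + (\<Sum>v\<in>verts U - {snd T}. basis_elem (to_rtree (graft U S v)))
       \<in> (expansions (verts T) :: (rtree \<Rightarrow>\<^sub>0 'k) set)" .
    \<comment> \<open>Grafting elsewhere than at the root yields a tree whose root has one child less.\<close>
    have "(\<Sum>v\<in>verts U - {snd T}. basis_elem (to_rtree (graft U S v))) \<in> (expansions (verts T) :: (rtree \<Rightarrow>\<^sub>0 'k) set)"
    proof (rule expansions_sum)
      fix v assume v: "v \<in> verts U - {snd T}"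
      have g: "arc_tree (graft U S v)" using v by (intro arc_tree_graft US) auto
      have vg: "verts (graft U S v) = verts T" by (simp add: vT)
      have rS: "snd T \<notin> verts S" using US(3,4) root_in_verts[of U] by auto
      have "children (fst (graft U S v)) (snd T) = children (fst U) (snd T)"
        using v rS by (subst children_graft[OF US(1-3)]) auto
      also have "\<dots> \<subset> children (fst T) (snd T)"
      proof -
        have "fst U \<subseteq> fst T" using US(6) by (auto simp: graft_def prod_eq_iff)
        then show ?thesis using c US(7) by (auto simp: children_def)
      qed
      finally have "card (children (fst (graft U S v)) (snd T)) < card (children (fst T) (snd T))"
        using T by (intro psubset_card_mono finite_children) (auto simp: arc_tree_def)
      moreover have "snd (graft U S v) = snd T" using US(4) by (simp add: graft_def)
      ultimately have "(graft U S v, T) \<in> measures [\<lambda>T. card (verts T), \<lambda>T. card (children (fst T) (snd T))]"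
        using vg by simp
      from 1(1)[OF this g] show "(basis_elem (to_rtree (graft U S v)) :: _ \<Rightarrow>\<^sub>0 'k) \<in> expansions (verts T)"
        unfolding vg .
    qed
    from expansions_diff[OF main this] show ?thesis by simp
  qed
qed

lemma tree_expansion_surj:
  "tree_expansion ` {x. keys x \<subseteq> multilinear_terms n} = {u :: rtree \<Rightarrow>\<^sub>0 'k::comm_ring_1. keys u \<subseteq> rooted_trees n}"
proof (intro equalityI subsetI)
  fix u :: "rtree \<Rightarrow>\<^sub>0 'k" assume "u \<in> tree_expansion ` {x. keys x \<subseteq> multilinear_terms n}"
  then show "u \<in> {u. keys u \<subseteq> rooted_trees n}" using keys_tree_expansion by auto
next
  fix u :: "rtree \<Rightarrow>\<^sub>0 'k" assume "u \<in> {u. keys u \<subseteq> rooted_trees n}"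
  then have "keys u \<subseteq> rooted_trees n" by simp
  then have "u \<in> expansions {1..n}"
  proof (induction u rule: span_induct)
    case zero
    show ?case by (rule expansions_0)
  next
    case (add x y)
    then show ?case by (rule expansions_add)
  next
    case (basis a R)
    then obtain T where T: "arc_tree T" "verts T = {1..n}" "to_rtree T = R" by (rule rooted_trees_orientation)
    have "scale a (basis_elem R) \<in> (expansions {1..n} :: (rtree \<Rightarrow>\<^sub>0 'k) set)"
      using arc_tree_in_expansions[OF T(1)] T by (intro expansions_scale) simp
    then show ?case by (simp add: scale_basis)
  qed
  then show "u \<in> tree_expansion ` {x. keys x \<subseteq> multilinear_terms n}"
    by (simp add: expansions_def multilinear_terms_eq)
qed

section \<open>The kernel of the expansion\<close>

lemma abs_basis_eval:
  "(abs_free_pre_Lie (basis_elem t) :: 'k::comm_ring_1 free_pre_Lie) = free_pre_Lie.term_eval (\<lambda>j. abs_free_pre_Lie (basis_elem (Var j))) t"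
proof (induction t)
  case (Prod s t)
  have "(abs_free_pre_Lie (basis_elem (Prod s t)) :: 'k free_pre_Lie)
      = free_pre_Lie_mul (abs_free_pre_Lie (basis_elem s)) (abs_free_pre_Lie (basis_elem t))"
    by (simp add: free_pre_Lie_mul.abs_eq)
  then show ?case using Prod by simp
qed simp

text \<open>
  The linear map \<open>\<psi>\<close> sends a tree to a representative of its value in the free pre-Lie algebra. It
  inverts \<open>\<Phi>\<close> modulo the ideal.
\<close>

lemma tree_expansion_kernel:
  fixes x :: "mag_term \<Rightarrow>\<^sub>0 'k::comm_ring_1"
  assumes x: "keys x \<subseteq> multilinear_terms n" and "tree_expansion x = 0"
  shows "x \<in> pre_Lie_ideal"
proof -
  define e :: "nat \<Rightarrow> 'k free_pre_Lie" where "e j = abs_free_pre_Lie (basis_elem (Var j))" for j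
  define \<psi> where "\<psi> R = rep_free_pre_Lie (free_pre_Lie.tree_value e (of_rtree R))" for R
  have "x - linear_ext \<psi> (tree_expansion x) \<in> pre_Lie_ideal"
  proof (rule klinear_in_pre_Lie_ideal[OF _ x])
    show "klinear (\<lambda>x. x - linear_ext \<psi> (tree_expansion x))"
      by (intro klinear_minus klinear_lin klinear_tree_expansion klinear_ident)
    fix t assume "t \<in> multilinear_terms n"
    then have t: "distinct (term_vars t)" by (simp add: multilinear_terms_def)
    have "abs_free_pre_Lie (linear_ext \<psi> (tree_expansion (basis_elem t)))
        = abs_free_pre_Lie (tree_sum t (\<lambda>T. \<psi> (to_rtree T)))"
      by (simp add: tree_sum_klinear[OF klinear_linear_ext])
    also have "\<dots> = tree_sum t (\<lambda>T. abs_free_pre_Lie (\<psi> (to_rtree T)))"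
      by (rule tree_sum_hom) (simp_all add: zero_free_pre_Lie_def plus_free_pre_Lie.abs_eq)
    also have "\<dots> = tree_sum t (free_pre_Lie.tree_value e)"
      by (rule tree_sum_cong[OF t]) (simp add: \<psi>_def Quotient_abs_rep[OF Quotient_free_pre_Lie])
    also have "\<dots> = free_pre_Lie.term_eval e t"
      by (rule free_pre_Lie.term_eval_tree_sum[OF t, symmetric])
    also have "\<dots> = abs_free_pre_Lie (basis_elem t)"
      unfolding e_def by (rule abs_basis_eval[symmetric])
    finally show "basis_elem t - linear_ext \<psi> (tree_expansion (basis_elem t)) \<in> pre_Lie_ideal"
      using abs_free_pre_Lie_eq_iff by metis
  qed
  then show ?thesis using assms(2) klinear_0[OF klinear_linear_ext, of \<psi>] by simp
qed

lemma pre_Lie_relator_expansion: "tree_expansion pre_Lie_relator = 0"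
proof -
  have "{(3, 1), (2, 1)} = {(2, 1), (3, 1) :: nat \<times> nat}" by auto
  then show ?thesis
    by (simp add: pre_Lie_relator_def klinear_add[OF klinear_tree_expansion'] klinear_diff[OF klinear_tree_expansion']
      graft_def verts_def insert_commute)
qed

lemma pre_Lie_relator_multilinear: "keys (pre_Lie_relator :: _ \<Rightarrow>\<^sub>0 'k::comm_ring_1) \<subseteq> multilinear_terms 3"
proof -
  have "{1..3} = {1, 2, 3 :: nat}" by auto
  then show ?thesis unfolding pre_Lie_relator_def
    by (intro keys_add_subset keys_diff_subset keys_basis_subset) (auto simp: multilinear_terms_def)
qed

text \<open>
  The kernel of \<open>\<Phi>\<close> in arity \<open>n\<close>.
\<close>

definition expansion_kernel :: "nat \<Rightarrow> (mag_term \<Rightarrow>\<^sub>0 'k::comm_ring_1) set" where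
  "expansion_kernel n = {x. keys x \<subseteq> multilinear_terms n \<and> tree_expansion x = 0}"

lemma sym_submodule_kernel:
  "sym_submodule (ring_of_type_algebra :: 'k::comm_ring_1 ring) free_magmatic_operad n (expansion_kernel n)"
  unfolding sym_submodule_def
proof (intro conjI allI impI ballI)
  interpret Module.module "ring_of_type_algebra :: 'k ring" "free_module (multilinear_terms n) :: ('k, mag_term \<Rightarrow>\<^sub>0 'k) module"
    by (rule module_free_module)
  note lin = klinear_tree_expansion'
  have "submodule (expansion_kernel n) (ring_of_type_algebra :: 'k ring) (free_module (multilinear_terms n))"
  proof (rule submoduleI)
    fix x :: "mag_term \<Rightarrow>\<^sub>0 'k" assume "x \<in> expansion_kernel n"
    then show "\<ominus>\<^bsub>free_module (multilinear_terms n)\<^esub> x \<in> expansion_kernel n"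
      by (subst a_inv_free_module) (auto simp: expansion_kernel_def klinear_uminus[OF lin])
  next
    fix a :: 'k and x :: "mag_term \<Rightarrow>\<^sub>0 'k" assume "x \<in> expansion_kernel n"
    then show "a \<odot>\<^bsub>free_module (multilinear_terms n)\<^esub> x \<in> expansion_kernel n"
      using keys_scale[of a x] by (auto simp: expansion_kernel_def klinear_scale[OF lin])
  next
    fix x y :: "mag_term \<Rightarrow>\<^sub>0 'k" assume "x \<in> expansion_kernel n" "y \<in> expansion_kernel n"
    then show "x \<oplus>\<^bsub>free_module (multilinear_terms n)\<^esub> y \<in> expansion_kernel n"
      by (simp add: expansion_kernel_def klinear_add[OF lin] keys_add_subset)
  qed (simp_all add: expansion_kernel_def klinear_0[OF lin] subset_iff)
  then show "submodule (expansion_kernel n) (ring_of_type_algebra :: 'k ring) (op_mod free_magmatic_operad n)"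
    by simp
  fix \<sigma> and x :: "mag_term \<Rightarrow>\<^sub>0 'k" assume "\<sigma> permutes {1..n}" "x \<in> expansion_kernel n"
  then show "op_act free_magmatic_operad n \<sigma> x \<in> expansion_kernel n"
    by (simp add: expansion_kernel_def keys_act tree_expansion_act klinear_0[OF klinear_linear_ext])
qed

lemma operad_ideal_kernel:
  "operad_ideal (ring_of_type_algebra :: 'k::comm_ring_1 ring) free_magmatic_operad expansion_kernel"
  unfolding operad_ideal_def
proof (intro conjI allI impI ballI)
  show "sym_submodule (ring_of_type_algebra :: 'k ring) free_magmatic_operad n (expansion_kernel n)" for n
    by (rule sym_submodule_kernel)
  fix n m i and x y :: "mag_term \<Rightarrow>\<^sub>0 'k"
  assume a: "1 \<le> n" "1 \<le> m" "i \<in> {1..n}" "x \<in> carrier (op_mod free_magmatic_operad n)"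
    "y \<in> carrier (op_mod free_magmatic_operad m)" and "x \<in> expansion_kernel n \<or> y \<in> expansion_kernel m"
  then have "tree_expansion x = 0 \<or> tree_expansion y = 0" by (auto simp: expansion_kernel_def)
  then have "bilinear_ext (tree_comp m i) (tree_expansion x) (tree_expansion y) = 0"
    using klinear_0[OF klinear_bilinear_ext_left] klinear_0[OF klinear_bilinear_ext_right] by metis
  then show "op_comp free_magmatic_operad n m i x y \<in> expansion_kernel (n + m - 1)"
    using a by (simp add: expansion_kernel_def keys_comp tree_expansion_comp[where n = n])
qed

lemma relator_in_relations: "pre_Lie_relator \<in> pre_Lie_relations"
  by (auto simp: pre_Lie_relations_def sym_submodule_generated_def)

text \<open>
  The definition of the ideal as an intersection gives both inclusions: the kernel is one of the
  ideals that are intersected, and it is contained in each of them.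
\<close>

lemma generated_ideal_eq_kernel:
  assumes n: "n \<ge> 1"
  shows "operad_ideal_generated (ring_of_type_algebra :: 'k::comm_ring_1 ring) free_magmatic_operad
    (\<lambda>n. if n = 3 then pre_Lie_relations else {}) n = expansion_kernel n"
proof (intro equalityI subsetI)
  have "pre_Lie_relations \<subseteq> (expansion_kernel 3 :: (mag_term \<Rightarrow>\<^sub>0 'k) set)"
    unfolding pre_Lie_relations_def sym_submodule_generated_def
    using sym_submodule_kernel[of 3] pre_Lie_relator_expansion pre_Lie_relator_multilinear
    by (intro Inter_lower) (auto simp: expansion_kernel_def)
  then have "expansion_kernel n \<in> {I n | I :: nat \<Rightarrow> (mag_term \<Rightarrow>\<^sub>0 'k) set.
      operad_ideal ring_of_type_algebra free_magmatic_operad I \<and>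
      (\<forall>m\<ge>1. (if m = 3 then pre_Lie_relations else {}) \<subseteq> I m)}"
    using operad_ideal_kernel by auto
  moreover fix x assume "x \<in> operad_ideal_generated (ring_of_type_algebra :: 'k ring) free_magmatic_operad
    (\<lambda>n. if n = 3 then pre_Lie_relations else {}) n"
  ultimately show "x \<in> expansion_kernel n" unfolding operad_ideal_generated_def by blast
next
  fix x :: "mag_term \<Rightarrow>\<^sub>0 'k" assume x: "x \<in> expansion_kernel n"
  have "x \<in> I n" if I: "operad_ideal (ring_of_type_algebra :: 'k ring) free_magmatic_operad I"
      "\<forall>m\<ge>1. (if m = 3 then pre_Lie_relations else {}) \<subseteq> I m" for I
  proof -
    have "pre_Lie_relations \<subseteq> I 3" using I(2)[rule_format, of 3] by simp
    then interpret pre_Lie_operad_ideal I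
      using I(1) relator_in_relations by unfold_locales auto
    show ?thesis
      using x tree_expansion_kernel[of x n] n by (intro pre_Lie_ideal_multilinear) (auto simp: expansion_kernel_def)
  qed
  then show "x \<in> operad_ideal_generated (ring_of_type_algebra :: 'k ring) free_magmatic_operad
    (\<lambda>n. if n = 3 then pre_Lie_relations else {}) n"
    unfolding operad_ideal_generated_def by blast
qed

theorem PL_isomorphic_RT:
  "isomorphic_operads (ring_of_type_algebra :: 'k::comm_ring_1 ring) PL_operad RT_operad"
proof -
  interpret operad_surjection "ring_of_type_algebra :: 'k ring" free_magmatic_operad RT_operad "\<lambda>_. tree_expansion"
  proof (intro operad_surjection.intro operad_free_magmatic operad_surjection_axioms.intro, goal_cases)
    case (1 n)
    show ?case by (simp add: module_free_module)
  next
    case (2 n)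
    show ?case using tree_expansion_surj[of n] by (simp add: free_module_def RT_operad_def free_magmatic_operad_def)
  next
    case (3 n x y)
    show ?case by (simp add: klinear_add[OF klinear_tree_expansion'])
  next
    case (4 n a x)
    show ?case by (simp add: klinear_scale[OF klinear_tree_expansion'])
  next
    case (5 n \<sigma> x)
    then show ?case by (simp add: tree_expansion_act)
  next
    case 6
    show ?case by (simp add: to_rtree_def)
  next
    case (7 i n m x y)
    then show ?case by (simp add: tree_expansion_comp[where n = n])
  qed
  show ?thesis
    unfolding PL_operad_def
    by (rule quotient_by_kernel) (simp add: generated_ideal_eq_kernel expansion_kernel_def)
qed

theorem mainTheorem1:
  shows "isomorphic_operads (ring_of_type_algebra :: 'k::field ring) PL_operad RT_operad
    \<and>
    isomorphic_operads (ring_of_type_algebra :: int ring) PL_operad RT_operad"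
  by (intro conjI PL_isomorphic_RT)

end
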